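(* Let $X=\mathbb P^2\# m\overline{\mathbb P^2}$ be the blowing-up of $\mathbb P^2$ along $m$ points. If $X$ admits a scalar-flat Hermitian metric, then $m\geq 10$.
   Context: $\mathbb P^2$ is the complex projective plane. For a smooth Hermitian metric $\omega$ on a complex manifold of dimension $n$, $\mathrm{Ric}(\omega)=-\sqrt{-1}\,\partial\bar\partial\log\omega^n$ is the Chern-Ricci curvature and $s=\mathrm{tr}_\omega\mathrm{Ric}(\omega)$ is the (Chern) scalar curvature; $\omega$ is scalar-flat if $s\equiv 0$. *)

theory Defs
  imports "HOL-Analysis.Analysis"
begin

section \<open>Complex manifolds\<close>

definition holomorphic_map_on :: "(complex^'n \<Rightarrow> complex^'m) \<Rightarrow> (complex^'n) set \<Rightarrow> bool" where
  "holomorphic_map_on f D \<longleftrightarrow>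
     (\<forall>z\<in>D. \<exists>L. (f has_derivative L) (at z) \<and> Vector_Spaces.linear (*s) (*s) L)"

text \<open>
  A complex manifold is given by a holomorphic atlas; a chart is a pair of its domain and its
  coordinate map, whose values outside the domain are irrelevant. The underlying set is the union
  of the chart domains and the topology is the one making all charts homeomorphisms onto open
  sets, so that neither has to be carried around separately. The dimension is the cardinality
  of the index type.
\<close>

type_synonym ('a, 'n) chart = "'a set \<times> ('a \<Rightarrow> complex^'n)"
type_synonym ('a, 'n) atlas = "('a, 'n) chart set"

definition points :: "('a, 'n) atlas \<Rightarrow> 'a set" where
  "points A = (\<Union>(U, \<phi>)\<in>A. U)"

definition complex_atlas :: "('a, 'n::finite) atlas \<Rightarrow> bool" where
  "complex_atlas A \<longleftrightarrow>
     (\<forall>(U, \<phi>)\<in>A. inj_on \<phi> U \<and> open (\<phi> ` U)) \<and>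
     (\<forall>(U, \<phi>)\<in>A. \<forall>(V, \<psi>)\<in>A. open (\<phi> ` (U \<inter> V)) \<and>
        holomorphic_map_on (\<psi> \<circ> inv_into U \<phi>) (\<phi> ` (U \<inter> V)))"

definition atlas_topology :: "('a, 'n::finite) atlas \<Rightarrow> 'a topology" where
  "atlas_topology A = topology (\<lambda>W. W \<subseteq> points A \<and> (\<forall>(U, \<phi>)\<in>A. open (\<phi> ` (W \<inter> U))))"

lemma openin_atlas_topology:
  assumes "complex_atlas A"
  shows "openin (atlas_topology A) W \<longleftrightarrow>
           W \<subseteq> points A \<and> (\<forall>(U, \<phi>)\<in>A. open (\<phi> ` (W \<inter> U)))"
proof -
  have "istopology (\<lambda>W. W \<subseteq> points A \<and> (\<forall>(U, \<phi>)\<in>A. open (\<phi> ` (W \<inter> U))))"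
    unfolding istopology_def
  proof (intro conjI allI impI)
    fix S T
    assume S: "S \<subseteq> points A \<and> (\<forall>(U, \<phi>)\<in>A. open (\<phi> ` (S \<inter> U)))"
      and T: "T \<subseteq> points A \<and> (\<forall>(U, \<phi>)\<in>A. open (\<phi> ` (T \<inter> U)))"
    show "S \<inter> T \<subseteq> points A" using S by blast
    have "open (\<phi> ` (S \<inter> T \<inter> U))" if "(U, \<phi>) \<in> A" for U \<phi>
    proof -
      have "inj_on \<phi> U" using assms that by (auto simp: complex_atlas_def)
      then have "\<phi> ` (S \<inter> T \<inter> U) = \<phi> ` (S \<inter> U) \<inter> \<phi> ` (T \<inter> U)"
        by (auto simp: inj_on_def)
      then show ?thesis using S T that by auto
    qed
    then show "\<forall>(U, \<phi>)\<in>A. open (\<phi> ` (S \<inter> T \<inter> U))" by auto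
  next
    fix K
    assume K: "\<forall>W\<in>K. W \<subseteq> points A \<and> (\<forall>(U, \<phi>)\<in>A. open (\<phi> ` (W \<inter> U)))"
    then show "\<Union>K \<subseteq> points A" by blast
    have "open (\<phi> ` (\<Union>K \<inter> U))" if "(U, \<phi>) \<in> A" for U \<phi>
    proof -
      have "\<phi> ` (\<Union>K \<inter> U) = (\<Union>W\<in>K. \<phi> ` (W \<inter> U))" by auto
      moreover have "open (\<phi> ` (W \<inter> U))" if "W \<in> K" for W
        using K that \<open>(U, \<phi>) \<in> A\<close> by fastforce
      ultimately show ?thesis by (metis open_UN)
    qed
    then show "\<forall>(U, \<phi>)\<in>A. open (\<phi> ` (\<Union>K \<inter> U))" by auto
  qed
  then show ?thesis by (simp add: atlas_topology_def)
qed

definition complex_manifold :: "('a, 'n::finite) atlas \<Rightarrow> bool" where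
  "complex_manifold A \<longleftrightarrow> complex_atlas A \<and>
     Hausdorff_space (atlas_topology A) \<and> second_countable (atlas_topology A)"

definition holomorphic_between ::
    "('a, 'n::finite) atlas \<Rightarrow> ('b, 'm::finite) atlas \<Rightarrow> ('a \<Rightarrow> 'b) \<Rightarrow> bool" where
  "holomorphic_between A B f \<longleftrightarrow>
     continuous_map (atlas_topology A) (atlas_topology B) f \<and>
     (\<forall>(U, \<phi>)\<in>A. \<forall>(V, \<psi>)\<in>B.
        holomorphic_map_on (\<psi> \<circ> f \<circ> inv_into U \<phi>) (\<phi> ` (U \<inter> f -` V)))"

definition biholomorphism ::
    "('a, 'n::finite) atlas \<Rightarrow> ('b, 'm::finite) atlas \<Rightarrow> ('a \<Rightarrow> 'b) \<Rightarrow> bool" where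
  "biholomorphism A B f \<longleftrightarrow> bij_betw f (points A) (points B) \<and>
     holomorphic_between A B f \<and> holomorphic_between B A (inv_into (points A) f)"

text \<open>The open submanifold on \<open>W \<inter> points A\<close>, for an open set \<open>W\<close>.\<close>

definition restrict_atlas :: "('a, 'n) atlas \<Rightarrow> 'a set \<Rightarrow> ('a, 'n) atlas" where
  "restrict_atlas A W = (\<lambda>(U, \<phi>). (U \<inter> W, \<phi>)) ` A"


section \<open>The projective plane\<close>

definition proj_space :: "(complex^'n) set set" where
  "proj_space = {vec.span {z} | z. z \<noteq> 0}"

text \<open>
  The representative of the point \<open>l\<close> of projective space whose \<open>i\<close>-th homogeneous coordinate
  is 1; it exists (uniquely) iff \<open>l\<close> is in the \<open>i\<close>-th affine piece.
\<close>

definition affine_piece :: "'n \<Rightarrow> (complex^'n) set set" where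
  "affine_piece i = {l \<in> proj_space. \<exists>w\<in>l. w $ i = 1}"

definition affine_rep :: "'n \<Rightarrow> (complex^'n) set \<Rightarrow> complex^'n" where
  "affine_rep i l = (THE w. w \<in> l \<and> w $ i = 1)"

text \<open>
  The three standard affine charts. The index type \<open>3\<close> is the cyclic group of order 3, so
  \<open>i + 1\<close> and \<open>i + 2\<close> are the two indices different from \<open>i\<close>.
\<close>

definition projective_plane :: "((complex^3) set, 2) atlas" where
  "projective_plane =
     range (\<lambda>i::3. (affine_piece i,
                    \<lambda>l. vector [affine_rep i l $ (i + 1), affine_rep i l $ (i + 2)]))"


section \<open>Blowing up points\<close>

text \<open>
  The local model is the incidence variety of all \<open>(z, l)\<close> with \<open>z \<in> l\<close>. On the \<open>i\<close>-th chart the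
  coordinates are \<open>z $ i\<close> and the ratios \<open>w $ j / w $ i\<close> for \<open>j \<noteq> i\<close>, where \<open>w\<close> spans \<open>l\<close>.
\<close>

definition blowup_origin :: "((complex^'n) \<times> (complex^'n) set, 'n::finite) atlas" where
  "blowup_origin =
     range (\<lambda>i. ({(z, l). l \<in> affine_piece i \<and> z \<in> l},
                 \<lambda>(z, l). \<chi> j. if j = i then z $ i else affine_rep i l $ j))"

text \<open>
  \<open>p : X \<rightarrow> M\<close> is the blowing-up of the complex manifold \<open>M\<close> along the finite set \<open>S\<close> of points:
  it is biholomorphic over the complement of \<open>S\<close> and, over a coordinate neighbourhood \<open>W\<close> of each point of
  \<open>S\<close>, it is isomorphic to the local model.
\<close>

definition is_blowup ::
    "('a, 'n::finite) atlas \<Rightarrow> 'a set \<Rightarrow> ('b, 'n) atlas \<Rightarrow> ('b \<Rightarrow> 'a) \<Rightarrow> bool" where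
  "is_blowup M S X p \<longleftrightarrow>
     finite S \<and> S \<subseteq> points M \<and> complex_manifold X \<and> holomorphic_between X M p \<and>
     biholomorphism (restrict_atlas X (p -` (- S))) (restrict_atlas M (- S)) p \<and>
     (\<forall>x\<in>S. \<exists>W (\<phi> :: 'a \<Rightarrow> complex^'n) F.
        openin (atlas_topology M) W \<and> x \<in> W \<and> \<phi> x = 0 \<and> open (\<phi> ` W) \<and>
        biholomorphism (restrict_atlas M W) {(\<phi> ` W, id)} \<phi> \<and>
        biholomorphism (restrict_atlas X (p -` W)) (restrict_atlas blowup_origin (fst -` (\<phi> ` W))) F \<and>
        (\<forall>q\<in>points X. p q \<in> W \<longrightarrow> fst (F q) = \<phi> (p q)))"


section \<open>Hermitian metrics and the Chern scalar curvature\<close>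

primrec Ck_on :: "nat \<Rightarrow> 'a::real_normed_vector set \<Rightarrow> ('a \<Rightarrow> 'b::real_normed_vector) \<Rightarrow> bool" where
  "Ck_on 0 D f \<longleftrightarrow> continuous_on D f"
| "Ck_on (Suc k) D f \<longleftrightarrow> (\<forall>x\<in>D. f differentiable at x) \<and>
     (\<forall>v. Ck_on k D (\<lambda>x. frechet_derivative f (at x) v))"

definition smooth_on :: "'a::real_normed_vector set \<Rightarrow> ('a \<Rightarrow> 'b::real_normed_vector) \<Rightarrow> bool" where
  "smooth_on D f \<longleftrightarrow> (\<forall>k. Ck_on k D f)"

definition hermitian_pos_def :: "complex^'n^'n \<Rightarrow> bool" where
  "hermitian_pos_def G \<longleftrightarrow> (\<forall>i j. G $ j $ i = cnj (G $ i $ j)) \<and>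
     (\<forall>v. v \<noteq> 0 \<longrightarrow> Re (\<Sum>i\<in>UNIV. \<Sum>j\<in>UNIV. G $ i $ j * v $ i * cnj (v $ j)) > 0)"

text \<open>
  A Hermitian metric is given by its coefficient matrices in the charts: \<open>g (U, \<phi>) z $ i $ j\<close>,
  for \<open>z \<in> \<phi> ` U\<close>, is the coefficient of \<open>dz\<^sub>i \<otimes> d(cnj z\<^sub>j)\<close> at the point with coordinates \<open>z\<close>.
  The last condition is the transformation law of these coefficients under change of chart.
\<close>

definition hermitian_metric ::
    "('a, 'n::finite) atlas \<Rightarrow> (('a, 'n) chart \<Rightarrow> complex^'n \<Rightarrow> complex^'n^'n) \<Rightarrow> bool" where
  "hermitian_metric A g \<longleftrightarrow>
     (\<forall>(U, \<phi>)\<in>A. smooth_on (\<phi> ` U) (g (U, \<phi>)) \<and>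
        (\<forall>z\<in>\<phi> ` U. hermitian_pos_def (g (U, \<phi>) z))) \<and>
     (\<forall>(U, \<phi>)\<in>A. \<forall>(V, \<psi>)\<in>A. \<forall>x\<in>U \<inter> V.
        let J = matrix (frechet_derivative (\<psi> \<circ> inv_into U \<phi>) (at (\<phi> x)))
        in g (U, \<phi>) (\<phi> x) = transpose J ** g (V, \<psi>) (\<psi> x) ** map_matrix cnj J)"

definition d_hol :: "'n \<Rightarrow> (complex^'n \<Rightarrow> complex) \<Rightarrow> complex^'n \<Rightarrow> complex" where
  "d_hol i f z =
     (frechet_derivative f (at z) (axis i 1) - \<i> * frechet_derivative f (at z) (axis i \<i>)) / 2"

definition d_antihol :: "'n \<Rightarrow> (complex^'n \<Rightarrow> complex) \<Rightarrow> complex^'n \<Rightarrow> complex" where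
  "d_antihol i f z =
     (frechet_derivative f (at z) (axis i 1) + \<i> * frechet_derivative f (at z) (axis i \<i>)) / 2"

text \<open>
  In coordinates \<open>\<omega>\<^sup>n\<close> is a constant multiple of \<open>det G\<close> times the Euclidean volume form, so
  the coefficients of the Chern-Ricci form are those of \<open>- \<partial>\<partial>bar log (det G)\<close>. The scalar curvature
  is the trace of the Chern-Ricci form with respect to the metric.
\<close>

definition chern_ricci :: "(complex^'n \<Rightarrow> complex^'n^'n) \<Rightarrow> complex^'n \<Rightarrow> complex^'n^'n" where
  "chern_ricci G z = (\<chi> i j. - d_hol i (d_antihol j (\<lambda>u. of_real (ln (Re (det (G u)))))) z)"

definition chern_scalar :: "(complex^'n \<Rightarrow> complex^'n^'n) \<Rightarrow> complex^'n \<Rightarrow> complex" where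
  "chern_scalar G z = trace (matrix_inv (G z) ** chern_ricci G z)"

definition scalar_flat ::
    "('a, 'n::finite) atlas \<Rightarrow> (('a, 'n) chart \<Rightarrow> complex^'n \<Rightarrow> complex^'n^'n) \<Rightarrow> bool" where
  "scalar_flat A g \<longleftrightarrow> (\<forall>(U, \<phi>)\<in>A. \<forall>z\<in>\<phi> ` U. chern_scalar (g (U, \<phi>)) z = 0)"

end

theory Submission
  imports Defs "HOL-Complex_Analysis.Complex_Analysis"
begin

no_notation fps_nth (infixl "$" 75)

text \<open>
  If \<open>m \<le> 9\<close>, the 10-dimensional space of plane cubics contains a nonzero cubic form \<open>c\<close> through the
  \<open>m\<close> points, and \<open>c\<close> defines a holomorphic section \<open>\<sigma>\<close> of the anticanonical bundle of \<open>X\<close>. Away from the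
  zeros of \<open>\<sigma>\<close>, \<open>tr\<^sub>\<omega> \<i>\<partial>\<partial>bar log |\<sigma>|\<^sup>2 = - s = 0\<close> for the norm induced by a scalar-flat \<open>\<omega>\<close>. By the strong
  maximum principle the set where \<open>|\<sigma>|\<^sup>2\<close> attains its maximum on the compact surface \<open>X\<close> is open. It is
  also closed, so it contains the preimage of a line that avoids the \<open>m\<close> points and meets this set;
  but \<open>c\<close> has a zero on every line.

  The norm is only shown to extend continuously over the exceptional curves. This is enough:
  the maximum principle is applied in a viscosity form that uses \<open>\<sigma>\<close> only along complex lines of generic
  direction, which meet the exceptional curves in isolated points.
\<close>

section \<open>Holomorphic functions of several variables\<close>

text \<open>In local coordinates an anticanonical section is \<open>h\<close> times the coordinate
  bivector, and its squared norm is |h|^2 det G, with G the matrix of the metric. Off the zeros of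
  \<open>h\<close> the term log |h|^2 is pluriharmonic, so the complex Hessian of the log norm is
  that of log det G, which is minus the Chern-Ricci form. The argument is pointwise, without
  integration, and so it applies to metrics that are merely Hermitian. A cubic gives such a section
  because the anticanonical bundle of the plane is O(3). On the blowing-up the Jacobian of the
  blow-down produces a simple pole along each exceptional curve. It is cancelled if the cubic
  vanishes at the centre, which is one linear condition per centre. Extending the section itself
  over an exceptional curve would be a removability statement in two variables. On a line of generic
  direction the singularity is isolated, and Riemann's theorem in one variable is enough. The
  inequality obtained for these directions passes to all directions by continuity, and two of them
  suffice to recover the trace.\<close>

definition hol_at :: "(complex^'n \<Rightarrow> complex) \<Rightarrow> complex^'n \<Rightarrow> bool" where
  "hol_at h z \<longleftrightarrow> (\<exists>L. (h has_derivative L) (at z) \<and> (\<forall>c x. L (c *s x) = c * L x))"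

definition hol_map_at :: "(complex^'n \<Rightarrow> complex^'m) \<Rightarrow> complex^'n \<Rightarrow> bool" where
  "hol_map_at f z \<longleftrightarrow> (\<forall>k. hol_at (\<lambda>x. f x $ k) z)"

definition cderiv :: "(complex^'n \<Rightarrow> complex^'m) \<Rightarrow> complex^'n \<Rightarrow> complex^'n^'m" where
  "cderiv f z = matrix (frechet_derivative f (at z))"

definition cpartial :: "'n \<Rightarrow> (complex^'n \<Rightarrow> complex) \<Rightarrow> complex^'n \<Rightarrow> complex" where
  "cpartial i h z = frechet_derivative h (at z) (axis i 1)"

lemma hol_atI:
  assumes "(h has_derivative L) (at z)" "\<And>c x. L (c *s x) = c * L x"
  shows "hol_at h z"
  using assms unfolding hol_at_def by blast

lemma hol_atE:
  assumes "hol_at h z"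
  obtains L where "(h has_derivative L) (at z)" "\<And>c x. L (c *s x) = c * L x"
  using assms unfolding hol_at_def by blast

lemma hol_at_imp_continuous: "hol_at h z \<Longrightarrow> isCont h z"
  by (auto simp: hol_at_def dest: has_derivative_continuous)

lemma hol_at_const [intro, simp]: "hol_at (\<lambda>x. c) z"
  by (rule hol_atI[where L = "\<lambda>_. 0"]) auto

lemma hol_at_component [intro, simp]: "hol_at (\<lambda>x. x $ k) z"
  by (rule hol_atI[where L = "\<lambda>x. x $ k"]) (auto intro!: derivative_eq_intros bounded_linear_imp_has_derivative)

lemma hol_at_add [intro]: "hol_at f z \<Longrightarrow> hol_at g z \<Longrightarrow> hol_at (\<lambda>x. f x + g x) z"
  apply (elim hol_atE)
  subgoal for L K by (rule hol_atI[where L = "\<lambda>x. L x + K x"]) (auto intro: has_derivative_add simp: distrib_left)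
  done

lemma hol_at_diff [intro]: "hol_at f z \<Longrightarrow> hol_at g z \<Longrightarrow> hol_at (\<lambda>x. f x - g x) z"
  apply (elim hol_atE)
  subgoal for L K by (rule hol_atI[where L = "\<lambda>x. L x - K x"]) (auto intro: has_derivative_diff simp: right_diff_distrib)
  done

lemma hol_at_mult [intro]: "hol_at f z \<Longrightarrow> hol_at g z \<Longrightarrow> hol_at (\<lambda>x. f x * g x) z"
  apply (elim hol_atE)
  subgoal for L K
    by (rule hol_atI[OF has_derivative_mult[of f L z UNIV g K]]) (simp_all add: algebra_simps)
  done

lemma hol_at_inverse: "hol_at f z \<Longrightarrow> f z \<noteq> 0 \<Longrightarrow> hol_at (\<lambda>x. inverse (f x)) z"
  apply (elim hol_atE)
  subgoal for L
    using has_derivative_inverse[where f=f and x=z and f'=L and S=UNIV] by (auto intro!: hol_atI[of _ "\<lambda>h. - (inverse (f z) * L h * inverse (f z))"])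
  done

lemma hol_at_divide [intro]: "hol_at f z \<Longrightarrow> hol_at g z \<Longrightarrow> g z \<noteq> 0 \<Longrightarrow> hol_at (\<lambda>x. f x / g x) z"
  unfolding divide_inverse by (intro hol_at_mult hol_at_inverse)

lemma hol_at_power [intro]: "hol_at f z \<Longrightarrow> hol_at (\<lambda>x. f x ^ k) z"
  by (induction k) auto

lemma hol_at_sum [intro]: "(\<And>i. i \<in> I \<Longrightarrow> hol_at (f i) z) \<Longrightarrow> hol_at (\<lambda>x. \<Sum>i\<in>I. f i x) z"
  by (induction I rule: infinite_finite_induct) auto

lemma hol_at_cong:
  assumes "eventually (\<lambda>x. f x = g x) (nhds z)"
  shows "hol_at f z \<longleftrightarrow> hol_at g z"
proof -
  have *: "(a has_derivative L) (at z) \<Longrightarrow> (b has_derivative L) (at z)"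
    if ab: "eventually (\<lambda>x. a x = b x) (nhds z)" for a b L
    by (rule has_derivative_transform_eventually[of a L z UNIV b])
       (use ab in \<open>auto simp: eventually_nhds_conv_at\<close>)
  have "eventually (\<lambda>x. g x = f x) (nhds z)"
    using assms by (rule eventually_mono) auto
  then show ?thesis
    unfolding hol_at_def using *[of f g] *[of g f] assms by blast
qed

lemma hol_map_at_cong:
  assumes "eventually (\<lambda>x. f x = g x) (nhds z)"
  shows "hol_map_at f z \<longleftrightarrow> hol_map_at g z"
  unfolding hol_map_at_def
  by (intro all_cong1 hol_at_cong eventually_mono[OF assms]) auto

lemma cderiv_cong:
  assumes "eventually (\<lambda>x. f x = g x) (nhds z)"
  shows "cderiv f z = cderiv g z"
proof -
  have *: "(a has_derivative L) (at z) \<Longrightarrow> (b has_derivative L) (at z)"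
    if ab: "eventually (\<lambda>x. a x = b x) (nhds z)" for a b :: "complex^'a \<Rightarrow> complex^'b" and L
    by (rule has_derivative_transform_eventually[of a L z UNIV b])
       (use ab in \<open>auto simp: eventually_nhds_conv_at\<close>)
  have "eventually (\<lambda>x. g x = f x) (nhds z)"
    using assms by (rule eventually_mono) auto
  then have "(f has_derivative L) (at z) \<longleftrightarrow> (g has_derivative L) (at z)" for L
    using *[of f g] *[of g f] assms by blast
  then show ?thesis unfolding cderiv_def frechet_derivative_def by simp
qed

text \<open>Bridge from the componentwise notion, which is closed under the algebra of scalar
  functions, to the vector-valued derivative in \<open>holomorphic_map_on\<close>: the derivatives
  of the components are collected into one complex linear map.\<close>

lemma hol_map_at_iff:
  fixes f :: "complex^'n \<Rightarrow> complex^'m"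
  shows "hol_map_at f z \<longleftrightarrow> (\<exists>L. (f has_derivative L) (at z) \<and> Vector_Spaces.linear (*s) (*s) L)"
proof
  assume "hol_map_at f z"
  then have "\<forall>k. \<exists>L. ((\<lambda>x. f x $ k) has_derivative L) (at z) \<and> (\<forall>c x. L (c *s x) = c * L x)"
    by (auto simp: hol_map_at_def hol_at_def)
  then obtain L where L: "\<And>k. ((\<lambda>x. f x $ k) has_derivative L k) (at z)"
      "\<And>k c x. L k (c *s x) = c * L k x"
    by metis
  define K where "K = (\<lambda>x. (\<chi> k. L k x))"
  have "(f has_derivative K) (at z)"
  proof -
    have "((\<lambda>x. f x \<bullet> b) has_derivative (\<lambda>x. K x \<bullet> b)) (at z)" if "b \<in> Basis" for b
    proof -
      obtain k c where b: "b = axis k c" using \<open>b \<in> Basis\<close> by (auto simp: Basis_vec_def)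
      show ?thesis unfolding b inner_axis
        by (auto simp: K_def intro!: derivative_eq_intros L(1))
    qed
    then show ?thesis using has_derivative_componentwise_within by blast
  qed
  moreover have "Vector_Spaces.linear (*s) (*s) K"
  proof -
    have "L k (x + y) = L k x + L k y" for k x y
      using has_derivative_bounded_linear[OF L(1)] by (simp add: bounded_linear.linear linear_add)
    then show ?thesis
      by unfold_locales (auto simp: K_def vec_eq_iff L(2) algebra_simps)
  qed
  ultimately show "\<exists>L. (f has_derivative L) (at z) \<and> Vector_Spaces.linear (*s) (*s) L" by blast
next
  assume "\<exists>L. (f has_derivative L) (at z) \<and> Vector_Spaces.linear (*s) (*s) L"
  then obtain L where L: "(f has_derivative L) (at z)" and lin: "Vector_Spaces.linear (*s) (*s) L" by blast
  interpret Vector_Spaces.linear "(*s)" "(*s)" L by fact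
  show "hol_map_at f z" unfolding hol_map_at_def
    by (auto intro!: hol_atI[of _ "\<lambda>x. L x $ _"] bounded_linear.has_derivative[OF bounded_linear_vec_nth L] simp: scale)
qed

lemma holomorphic_map_on_iff: "holomorphic_map_on f D \<longleftrightarrow> (\<forall>z\<in>D. hol_map_at f z)"
  by (simp add: holomorphic_map_on_def hol_map_at_iff)

lemma hol_map_at_has_derivative:
  fixes f :: "complex^'n \<Rightarrow> complex^'m"
  assumes "hol_map_at f z"
  shows "(f has_derivative (\<lambda>x. cderiv f z *v x)) (at z)"
proof -
  obtain L where L: "(f has_derivative L) (at z)" "Vector_Spaces.linear (*s) (*s) L"
    using assms by (auto simp: hol_map_at_iff)
  have "frechet_derivative f (at z) = L" using L(1) frechet_derivative_at by metis
  then have "(\<lambda>x. cderiv f z *v x) = L" using L(2) by (auto simp: cderiv_def matrix_works)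
  with L(1) show ?thesis by simp
qed

lemma hol_map_at_unique:
  fixes f :: "complex^'n \<Rightarrow> complex^'m"
  assumes "(f has_derivative (\<lambda>x. A *v x)) (at z)"
  shows "cderiv f z = A"
proof -
  have "frechet_derivative f (at z) = (\<lambda>x. A *v x)" using assms frechet_derivative_at by metis
  then show ?thesis by (simp add: cderiv_def matrix_of_matrix_vector_mul)
qed

lemma hol_map_atI:
  fixes f :: "complex^'n \<Rightarrow> complex^'m"
  assumes "(f has_derivative (\<lambda>x. A *v x)) (at z)"
  shows "hol_map_at f z"
  unfolding hol_map_at_iff using assms matrix_vector_mul_linear_gen by blast

lemma hol_map_at_imp_continuous: "hol_map_at f z \<Longrightarrow> isCont f z"
  by (auto simp: hol_map_at_iff dest: has_derivative_continuous)

lemma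
  fixes f :: "complex^'n \<Rightarrow> complex^'m" and g :: "complex^'m \<Rightarrow> complex^'k"
  assumes f: "hol_map_at f z" and g: "hol_map_at g (f z)"
  shows hol_map_at_compose: "hol_map_at (g \<circ> f) z"
    and cderiv_compose: "cderiv (g \<circ> f) z = cderiv g (f z) ** cderiv f z"
proof -
  have "(g \<circ> f has_derivative (\<lambda>x. cderiv g (f z) *v x) \<circ> (\<lambda>x. cderiv f z *v x)) (at z)"
    by (rule diff_chain_at) (use f g hol_map_at_has_derivative in auto)
  then have *: "(g \<circ> f has_derivative (\<lambda>x. (cderiv g (f z) ** cderiv f z) *v x)) (at z)"
    by (simp add: o_def matrix_vector_mul_assoc)
  show "hol_map_at (g \<circ> f) z" "cderiv (g \<circ> f) z = cderiv g (f z) ** cderiv f z"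
    using hol_map_atI[OF *] hol_map_at_unique[OF *] by auto
qed

lemma hol_at_compose:
  fixes f :: "complex^'n \<Rightarrow> complex^'m"
  assumes f: "hol_map_at f z" and g: "hol_at g (f z)"
  shows "hol_at (\<lambda>x. g (f x)) z"
proof -
  obtain L where L: "(f has_derivative L) (at z)" "Vector_Spaces.linear (*s) (*s) L"
    using f by (auto simp: hol_map_at_iff)
  interpret Vector_Spaces.linear "(*s)" "(*s)" L by fact
  obtain K where K: "(g has_derivative K) (at (f z))" "\<And>c x. K (c *s x) = c * K x"
    using g by (elim hol_atE) blast
  have "((g \<circ> f) has_derivative (K \<circ> L)) (at z)" by (rule diff_chain_at[OF L(1) K(1)])
  then show ?thesis by (intro hol_atI[of _ "K \<circ> L"]) (auto simp: o_def K(2) scale)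
qed

text \<open>Complex homogeneity expresses the directions \<open>axis i \<i>\<close> through
  \<open>axis i 1\<close>, so the complex partials determine the whole derivative.\<close>

lemma hol_at_has_derivative:
  fixes h :: "complex^'n \<Rightarrow> complex"
  assumes "hol_at h z"
  shows "(h has_derivative (\<lambda>v. \<Sum>i\<in>UNIV. cpartial i h z * v $ i)) (at z)"
proof -
  obtain L where L: "(h has_derivative L) (at z)" "\<And>c x. L (c *s x) = c * L x"
    using assms by (elim hol_atE) blast
  have fr: "frechet_derivative h (at z) = L" using L(1) frechet_derivative_at by metis
  have add: "L (\<Sum>i\<in>I. f i) = (\<Sum>i\<in>I. L (f i))" for I and f :: "'n \<Rightarrow> _"
    using has_derivative_bounded_linear[OF L(1)] by (simp add: bounded_linear.linear linear_sum)
  have "L v = (\<Sum>i\<in>UNIV. cpartial i h z * v $ i)" for v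
  proof -
    have "L v = L (\<Sum>i\<in>UNIV. (v $ i) *s axis i 1)" by (simp add: basis_expansion)
    also have "\<dots> = (\<Sum>i\<in>UNIV. cpartial i h z * v $ i)"
      unfolding add by (simp add: L(2) cpartial_def fr mult.commute)
    finally show ?thesis .
  qed
  then have "L = (\<lambda>v. \<Sum>i\<in>UNIV. cpartial i h z * v $ i)" by blast
  with L(1) show ?thesis by simp
qed

lemma cderiv_component:
  fixes f :: "complex^'n \<Rightarrow> complex^'m"
  assumes "hol_map_at f z"
  shows "cderiv f z $ k $ i = cpartial i (\<lambda>x. f x $ k) z"
proof -
  have "((\<lambda>x. f x $ k) has_derivative (\<lambda>x. (cderiv f z *v x) $ k)) (at z)"
    using bounded_linear.has_derivative[OF bounded_linear_vec_nth hol_map_at_has_derivative[OF assms]] .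
  then have "frechet_derivative (\<lambda>x. f x $ k) (at z) = (\<lambda>x. (cderiv f z *v x) $ k)"
    using frechet_derivative_at by metis
  then show ?thesis
    by (simp add: cpartial_def matrix_vector_mult_def axis_def if_distrib cong: if_cong)
qed

text \<open>The door to one-variable function theory: Cauchy's formula, removable singularities and
  holomorphic logarithms are all used on complex lines.\<close>

lemma hol_at_line:
  fixes h :: "complex^'n \<Rightarrow> complex"
  assumes "hol_at h (z + t *s v)"
  shows "((\<lambda>s. h (z + s *s v)) has_field_derivative (\<Sum>i\<in>UNIV. cpartial i h (z + t *s v) * v $ i)) (at t)"
proof -
  let ?D = "\<lambda>v. \<Sum>i\<in>UNIV. cpartial i h (z + t *s v) * v $ i"
  have bl: "bounded_linear (\<lambda>s. s *s v)"
  proof -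
    have "linear (\<lambda>s::complex. s *s v)"
      by (rule linearI) (auto simp: vec_eq_iff algebra_simps)
    then show ?thesis by (simp add: linear_conv_bounded_linear)
  qed
  have "((\<lambda>s. z + s *s v) has_derivative (\<lambda>s. s *s v)) (at t)"
    by (auto intro!: derivative_eq_intros bounded_linear_imp_has_derivative bl)
  from diff_chain_at[OF this hol_at_has_derivative[OF assms]]
  have "((\<lambda>s. h (z + s *s v)) has_derivative (\<lambda>s. \<Sum>i\<in>UNIV. cpartial i h (z + t *s v) * (s * v $ i))) (at t)"
    by (simp add: o_def)
  moreover have "(\<lambda>s. \<Sum>i\<in>UNIV. cpartial i h (z + t *s v) * (s * v $ i)) =
      (*) (\<Sum>i\<in>UNIV. cpartial i h (z + t *s v) * v $ i)"
    by (auto simp: fun_eq_iff sum_distrib_right intro!: sum.cong)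
  ultimately show ?thesis
    unfolding has_field_derivative_def by simp
qed

section \<open>Atlases\<close>

lemma complex_atlasD:
  assumes "complex_atlas A" "(U, \<phi>) \<in> A"
  shows "inj_on \<phi> U" "open (\<phi> ` U)" "U \<subseteq> points A"
    "\<And>V \<psi>. (V, \<psi>) \<in> A \<Longrightarrow> open (\<phi> ` (U \<inter> V))"
    "\<And>V \<psi>. (V, \<psi>) \<in> A \<Longrightarrow> holomorphic_map_on (\<psi> \<circ> inv_into U \<phi>) (\<phi> ` (U \<inter> V))"
  using assms by (fastforce simp: complex_atlas_def points_def)+

lemma holomorphic_map_on_imp_continuous_on:
  "holomorphic_map_on f D \<Longrightarrow> continuous_on D f"
  by (meson continuous_at_imp_continuous_on hol_map_at_imp_continuous holomorphic_map_on_iff)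

lemma openin_points:
  assumes "complex_atlas A"
  shows "openin (atlas_topology A) (points A)"
  unfolding openin_atlas_topology[OF assms]
proof (safe)
  fix U \<phi> assume U: "(U, \<phi>) \<in> A"
  then have "points A \<inter> U = U" using complex_atlasD(3)[OF assms U] by blast
  then show "open (\<phi> ` (points A \<inter> U))" using complex_atlasD(2)[OF assms U] by simp
qed

lemma topspace_atlas_topology:
  assumes "complex_atlas A"
  shows "topspace (atlas_topology A) = points A"
  using openin_points[OF assms] openin_atlas_topology[OF assms]
  by (metis openin_subset openin_topspace subset_antisym)

lemma openin_atlas_chart:
  assumes A: "complex_atlas A" and U: "(U, \<phi>) \<in> A" and "V \<subseteq> U"
  shows "openin (atlas_topology A) V \<longleftrightarrow> open (\<phi> ` V)"
proof
  assume "openin (atlas_topology A) V"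
  then have "open (\<phi> ` (V \<inter> U))" using U by (auto simp: openin_atlas_topology[OF A])
  then show "open (\<phi> ` V)" using \<open>V \<subseteq> U\<close> by (simp add: Int_absorb2)
next
  assume op: "open (\<phi> ` V)"
  have "open (\<psi> ` (V \<inter> W))" if W: "(W, \<psi>) \<in> A" for W \<psi>
  proof -
    have inj: "inj_on \<phi> U" "inj_on \<psi> W" using complex_atlasD(1)[OF A] U W by auto
    have "continuous_on (\<psi> ` (W \<inter> U)) (\<phi> \<circ> inv_into W \<psi>)"
      using complex_atlasD(5)[OF A W U] holomorphic_map_on_imp_continuous_on by blast
    then have "open (\<psi> ` (W \<inter> U) \<inter> (\<phi> \<circ> inv_into W \<psi>) -` (\<phi> ` V))"
      using complex_atlasD(4)[OF A W U] op by (intro continuous_open_preimage)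
    also have "\<psi> ` (W \<inter> U) \<inter> (\<phi> \<circ> inv_into W \<psi>) -` (\<phi> ` V) = \<psi> ` (V \<inter> W)"
      using inj \<open>V \<subseteq> U\<close> by (auto simp: inj_on_image_mem_iff dest: inj_onD) (metis inj_onD subsetD)
    finally show ?thesis .
  qed
  then show "openin (atlas_topology A) V"
    using complex_atlasD(3)[OF A U] \<open>V \<subseteq> U\<close> by (auto simp: openin_atlas_topology[OF A])
qed

lemma openin_chart_domain:
  assumes "complex_atlas A" "(U, \<phi>) \<in> A"
  shows "openin (atlas_topology A) U"
  using openin_atlas_chart[OF assms order_refl] complex_atlasD(2)[OF assms] by simp

lemma continuous_map_inv_chart:
  assumes A: "complex_atlas A" and U: "(U, \<phi>) \<in> A"
  shows "continuous_map (top_of_set (\<phi> ` U)) (atlas_topology A) (inv_into U \<phi>)"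
  unfolding continuous_map_def
proof (intro conjI allI impI)
  have inj: "inj_on \<phi> U" using complex_atlasD(1)[OF A U] .
  show "inv_into U \<phi> \<in> topspace (top_of_set (\<phi> ` U)) \<rightarrow> topspace (atlas_topology A)"
    using complex_atlasD(3)[OF A U] by (auto simp: topspace_atlas_topology[OF A] inv_into_into)
  fix T assume T: "openin (atlas_topology A) T"
  have "{z \<in> topspace (top_of_set (\<phi> ` U)). inv_into U \<phi> z \<in> T} = \<phi> ` (T \<inter> U)"
    using inj by auto
  moreover have "open (\<phi> ` (T \<inter> U))" using T U by (auto simp: openin_atlas_topology[OF A])
  ultimately show "openin (top_of_set (\<phi> ` U)) {z \<in> topspace (top_of_set (\<phi> ` U)). inv_into U \<phi> z \<in> T}"
    by (auto simp: openin_open_eq[OF complex_atlasD(2)[OF A U]])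
qed

section \<open>Open submanifolds and biholomorphisms in charts\<close>

lemma points_restrict_atlas: "points (restrict_atlas A W) = points A \<inter> W"
  by (auto simp: points_def restrict_atlas_def)

lemma restrict_atlasE:
  assumes "(V, \<psi>) \<in> restrict_atlas A W"
  obtains U where "(U, \<psi>) \<in> A" "V = U \<inter> W"
  using assms by (auto simp: restrict_atlas_def)

lemma restrict_atlasI: "(U, \<phi>) \<in> A \<Longrightarrow> (U \<inter> W, \<phi>) \<in> restrict_atlas A W"
  by (force simp: restrict_atlas_def)

lemma inv_into_restrict:
  assumes "inj_on \<phi> U" "z \<in> \<phi> ` (U \<inter> W)"
  shows "inv_into (U \<inter> W) \<phi> z = inv_into U \<phi> z"
proof -
  obtain x where "x \<in> U \<inter> W" "z = \<phi> x" using assms by auto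
  moreover have "inj_on \<phi> (U \<inter> W)" using assms inj_on_subset by blast
  ultimately show ?thesis using assms by (simp add: inv_into_f_f)
qed

lemma holomorphic_map_on_cong:
  assumes "open D" "\<And>z. z \<in> D \<Longrightarrow> f z = g z" "holomorphic_map_on f D"
  shows "holomorphic_map_on g D"
  unfolding holomorphic_map_on_iff
proof
  fix z assume z: "z \<in> D"
  have "eventually (\<lambda>x. f x = g x) (nhds z)"
    using assms z eventually_nhds by blast
  then show "hol_map_at g z" using assms(3) z hol_map_at_cong holomorphic_map_on_iff by blast
qed

lemma holomorphic_map_on_subset: "holomorphic_map_on f D \<Longrightarrow> D' \<subseteq> D \<Longrightarrow> holomorphic_map_on f D'"
  by (auto simp: holomorphic_map_on_def)

text \<open>\<open>W\<close> is intersected with the underlying set because it is usually a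
  complement or a preimage, which may contain elements outside the manifold.\<close>

lemma
  assumes A: "complex_atlas A" and W: "openin (atlas_topology A) (points A \<inter> W)"
  shows complex_atlas_restrict: "complex_atlas (restrict_atlas A W)"
    and atlas_topology_restrict: "atlas_topology (restrict_atlas A W) = subtopology (atlas_topology A) W"
proof -
  have op: "open (\<phi> ` (U \<inter> W))" if "(U, \<phi>) \<in> A" for U \<phi>
  proof -
    have "open (\<phi> ` ((points A \<inter> W) \<inter> U))" using W that by (auto simp: openin_atlas_topology[OF A])
    moreover have "(points A \<inter> W) \<inter> U = U \<inter> W" using complex_atlasD(3)[OF A that] by auto
    ultimately show ?thesis by simp
  qed
  show R: "complex_atlas (restrict_atlas A W)"
    unfolding complex_atlas_def
  proof (safe)
    fix V \<phi> assume "(V, \<phi>) \<in> restrict_atlas A W"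
    then obtain U where U: "(U, \<phi>) \<in> A" "V = U \<inter> W" by (rule restrict_atlasE)
    show "inj_on \<phi> V" using complex_atlasD(1)[OF A U(1)] U(2) inj_on_subset by blast
    show "open (\<phi> ` V)" using op U by auto
    fix V' \<psi> assume "(V', \<psi>) \<in> restrict_atlas A W"
    then obtain U' where U': "(U', \<psi>) \<in> A" "V' = U' \<inter> W" by (rule restrict_atlasE)
    have "\<phi> ` (V \<inter> V') = \<phi> ` (U \<inter> U') \<inter> \<phi> ` (U \<inter> W)"
      using complex_atlasD(1)[OF A U(1)] unfolding U U' by (auto simp: inj_on_def)
    then show o: "open (\<phi> ` (V \<inter> V'))"
      using complex_atlasD(4)[OF A U(1) U'(1)] op[OF U(1)] by auto
    show "holomorphic_map_on (\<psi> \<circ> inv_into V \<phi>) (\<phi> ` (V \<inter> V'))"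
    proof (rule holomorphic_map_on_cong[OF o])
      show "holomorphic_map_on (\<psi> \<circ> inv_into U \<phi>) (\<phi> ` (V \<inter> V'))"
        by (rule holomorphic_map_on_subset[OF complex_atlasD(5)[OF A U(1) U'(1)]]) (auto simp: U U')
      show "(\<psi> \<circ> inv_into U \<phi>) z = (\<psi> \<circ> inv_into V \<phi>) z" if "z \<in> \<phi> ` (V \<inter> V')" for z
        using inv_into_restrict[OF complex_atlasD(1)[OF A U(1)], of z W] that by (auto simp: U)
    qed
  qed
  have "openin (atlas_topology (restrict_atlas A W)) T \<longleftrightarrow> openin (subtopology (atlas_topology A) W) T" for T
  proof -
    have *: "openin (subtopology (atlas_topology A) W) T \<longleftrightarrow> openin (atlas_topology A) T \<and> T \<subseteq> points A \<inter> W"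
    proof -
      have "subtopology (atlas_topology A) W = subtopology (atlas_topology A) (points A \<inter> W)"
        by (metis subtopology_restrict topspace_atlas_topology[OF A])
      then show ?thesis using openin_open_subtopology[OF W] by simp
    qed
    have "openin (atlas_topology (restrict_atlas A W)) T \<longleftrightarrow>
        T \<subseteq> points A \<inter> W \<and> (\<forall>(U,\<phi>)\<in>A. open (\<phi> ` (T \<inter> (U \<inter> W))))"
      unfolding openin_atlas_topology[OF R] points_restrict_atlas
      by (auto simp: restrict_atlas_def)
    also have "\<dots> \<longleftrightarrow> T \<subseteq> points A \<inter> W \<and> (\<forall>(U,\<phi>)\<in>A. open (\<phi> ` (T \<inter> U)))"
    proof -
      have "T \<inter> (U \<inter> W) = T \<inter> U" if "T \<subseteq> points A \<inter> W" for U using that by auto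
      then show ?thesis by auto
    qed
    also have "\<dots> \<longleftrightarrow> openin (atlas_topology A) T \<and> T \<subseteq> points A \<inter> W"
      unfolding openin_atlas_topology[OF A] by auto
    finally show ?thesis using * by simp
  qed
  then show "atlas_topology (restrict_atlas A W) = subtopology (atlas_topology A) W"
    by (simp add: topology_eq)
qed

lemma openin_diff_finite:
  assumes A: "complex_atlas A" and "finite S"
  shows "openin (atlas_topology A) (points A - S)"
  unfolding openin_atlas_topology[OF A]
proof (safe)
  fix U \<phi> assume U: "(U, \<phi>) \<in> A"
  have "\<phi> ` ((points A - S) \<inter> U) = \<phi> ` U - \<phi> ` (S \<inter> U)"
    using complex_atlasD(1,3)[OF A U] by (auto simp: inj_on_def)
  moreover have "closed (\<phi> ` (S \<inter> U))" using assms by (intro finite_imp_closed) auto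
  ultimately show "open (\<phi> ` ((points A - S) \<inter> U))" using complex_atlasD(2)[OF A U] by auto
qed

lemma open_chart_preimage:
  assumes A: "complex_atlas A" and U: "(U, \<phi>) \<in> A"
    and f: "continuous_map (atlas_topology A) Y f" and V: "openin Y V"
  shows "open (\<phi> ` (U \<inter> f -` V))"
proof -
  have "openin (atlas_topology A) {x \<in> points A. f x \<in> V}"
    using openin_continuous_map_preimage[OF f V] by (simp add: topspace_atlas_topology[OF A])
  then have "open (\<phi> ` ({x \<in> points A. f x \<in> V} \<inter> U))" using U by (auto simp: openin_atlas_topology[OF A])
  moreover have "{x \<in> points A. f x \<in> V} \<inter> U = U \<inter> f -` V" using complex_atlasD(3)[OF A U] by auto
  ultimately show ?thesis by simp
qed

text \<open>The coordinate expression of the inverse map, composed with \<open>h\<close>, is the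
  identity near \<open>z\<close>. By the chain rule the two Jacobian determinants then have product
  1.\<close>

lemma biholomorphism_chart:
  fixes A :: "('a, 'n::finite) atlas" and B :: "('b, 'n) atlas"
  assumes A: "complex_atlas A" and B: "complex_atlas B" and f: "biholomorphism A B f"
    and U: "(U, \<phi>) \<in> A" and V: "(V, \<psi>) \<in> B"
  defines "h \<equiv> \<psi> \<circ> f \<circ> inv_into U \<phi>"
  shows "open (\<phi> ` (U \<inter> f -` V))"
    and "\<And>z. z \<in> \<phi> ` (U \<inter> f -` V) \<Longrightarrow> hol_map_at h z"
    and "\<And>z. z \<in> \<phi> ` (U \<inter> f -` V) \<Longrightarrow> det (cderiv h z) \<noteq> 0"
proof -
  have bij: "bij_betw f (points A) (points B)" and hf: "holomorphic_between A B f"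
    and hg: "holomorphic_between B A (inv_into (points A) f)"
    using f by (auto simp: biholomorphism_def)
  have cf: "continuous_map (atlas_topology A) (atlas_topology B) f"
    using hf by (auto simp: holomorphic_between_def)
  have injU: "inj_on \<phi> U" and injV: "inj_on \<psi> V"
    using complex_atlasD(1)[OF A U] complex_atlasD(1)[OF B V] .
  have UA: "U \<subseteq> points A" using complex_atlasD(3)[OF A U] .
  show op: "open (\<phi> ` (U \<inter> f -` V))"
    by (rule open_chart_preimage[OF A U cf openin_chart_domain[OF B V]])
  show hol: "hol_map_at h z" if "z \<in> \<phi> ` (U \<inter> f -` V)" for z
    using hf U V that unfolding holomorphic_between_def h_def holomorphic_map_on_iff by fast
  show "det (cderiv h z) \<noteq> 0" if z: "z \<in> \<phi> ` (U \<inter> f -` V)" for z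
  proof -
    define k where "k = \<phi> \<circ> inv_into (points A) f \<circ> inv_into V \<psi>"
    have kh: "k (h y) = y" "inv_into V \<psi> (h y) \<in> V" "h y \<in> \<psi> ` (V \<inter> inv_into (points A) f -` U)"
      if y: "y \<in> \<phi> ` (U \<inter> f -` V)" for y
    proof -
      obtain x where x: "x \<in> U" "f x \<in> V" "y = \<phi> x" using y by auto
      have "h y = \<psi> (f x)" using x injU by (simp add: h_def)
      moreover have "inv_into (points A) f (f x) = x"
        using bij x UA by (meson bij_betw_imp_inj_on inv_into_f_f subsetD)
      ultimately show "k (h y) = y" "inv_into V \<psi> (h y) \<in> V" "h y \<in> \<psi> ` (V \<inter> inv_into (points A) f -` U)"
        using x injV by (auto simp: k_def)
    qed
    have "hol_map_at k (h z)"
      using hg U V kh(3)[OF z] unfolding holomorphic_between_def k_def holomorphic_map_on_iff by fast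
    then have "cderiv (k \<circ> h) z = cderiv k (h z) ** cderiv h z"
      using hol[OF z] by (intro cderiv_compose)
    moreover have "cderiv (k \<circ> h) z = cderiv (\<lambda>x. x) z"
    proof (rule cderiv_cong)
      have "eventually (\<lambda>y. y \<in> \<phi> ` (U \<inter> f -` V)) (nhds z)"
        using op z eventually_nhds_in_open by blast
      then show "\<forall>\<^sub>F x in nhds z. (k \<circ> h) x = x" by eventually_elim (use kh in auto)
    qed
    moreover have "cderiv (\<lambda>x::complex^'n. x) z = mat 1"
      by (rule hol_map_at_unique) simp
    ultimately have "cderiv k (h z) ** cderiv h z = mat 1" by simp
    then have "det (cderiv k (h z)) * det (cderiv h z) = 1" by (metis det_I det_mul)
    then show ?thesis by auto
  qed
qed

section \<open>The projective plane and the blown-up origin\<close>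

lemma span_single: "vec.span {w} = range (\<lambda>c. c *s w)"
  by (rule vec.span_singleton)

lemma span_eq_of_mem:
  fixes u w :: "complex^'n"
  assumes "u \<in> vec.span {w}" "u \<noteq> 0"
  shows "vec.span {u} = vec.span {w}"
proof -
  obtain c where c: "u = c *s w" using assms(1) by (auto simp: span_single)
  then have "c \<noteq> 0" using assms(2) by auto
  have "a *s w = (a / c) *s u" for a using \<open>c \<noteq> 0\<close> by (simp add: c vector_smult_assoc)
  then have "range (\<lambda>c. c *s w) \<subseteq> range (\<lambda>a. a *s u)" by (metis image_subsetI rangeI)
  moreover have "range (\<lambda>a. a *s u) \<subseteq> range (\<lambda>c. c *s w)" by (auto simp: c vector_smult_assoc)
  ultimately show ?thesis unfolding span_single by blast
qed

lemma affine_rep_span: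
  fixes w :: "complex^'n"
  assumes "w $ i \<noteq> 0"
  shows "affine_rep i (vec.span {w}) = (1 / w $ i) *s w"
  unfolding affine_rep_def
proof (rule the_equality)
  show "(1 / w $ i) *s w \<in> vec.span {w} \<and> ((1 / w $ i) *s w) $ i = 1"
    using assms by (auto simp: span_single)
  fix v assume "v \<in> vec.span {w} \<and> v $ i = 1"
  then show "v = (1 / w $ i) *s w" using assms by (auto simp: span_single vec_eq_iff field_simps)
qed

lemma span_in_proj_space: "w \<noteq> 0 \<Longrightarrow> vec.span {w} \<in> proj_space"
  by (auto simp: proj_space_def)

lemma span_in_affine_piece:
  fixes w :: "complex^'n"
  shows "vec.span {w} \<in> affine_piece i \<longleftrightarrow> w $ i \<noteq> 0"
proof
  assume "vec.span {w} \<in> affine_piece i"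
  then show "w $ i \<noteq> 0" by (auto simp: affine_piece_def span_single)
next
  assume "w $ i \<noteq> 0"
  then have "w \<noteq> 0" "(1 / w $ i) *s w \<in> vec.span {w}" "((1 / w $ i) *s w) $ i = 1"
    by (auto simp: span_single)
  then show "vec.span {w} \<in> affine_piece i" unfolding affine_piece_def
    using span_in_proj_space by blast
qed

lemma affine_pieceD:
  fixes l :: "(complex^'n) set"
  assumes "l \<in> affine_piece i"
  shows "affine_rep i l \<in> l" "affine_rep i l $ i = 1" "l = vec.span {affine_rep i l}"
proof -
  obtain w where w: "l = vec.span {w}" using assms by (auto simp: affine_piece_def proj_space_def)
  then have nz: "w $ i \<noteq> 0" using assms span_in_affine_piece by blast
  have r: "affine_rep i l = (1 / w $ i) *s w" using affine_rep_span nz w by blast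
  show 1: "affine_rep i l \<in> l" unfolding r unfolding w by (auto simp: span_single)
  show 2: "affine_rep i l $ i = 1" using nz by (simp add: r)
  then have "affine_rep i l \<noteq> 0" by auto
  then show "l = vec.span {affine_rep i l}" using span_eq_of_mem 1 w by metis
qed

text \<open>Divide by a coordinate of largest modulus. The bound lets finitely many closed polydiscs
  cover projective space, which is the source of all compactness below.\<close>

lemma bounded_affine_rep:
  fixes l :: "(complex^'n) set"
  assumes "l \<in> proj_space"
  obtains i where "l \<in> affine_piece i" "\<And>k. cmod (affine_rep i l $ k) \<le> 1"
proof -
  obtain w where w: "l = vec.span {w}" "w \<noteq> 0" using assms by (auto simp: proj_space_def)
  obtain i where i: "\<And>k. cmod (w $ k) \<le> cmod (w $ i)"
  proof -
    have "Max (range (\<lambda>k. cmod (w $ k))) \<in> range (\<lambda>k. cmod (w $ k))" by (intro Max_in) auto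
    then obtain i where "Max (range (\<lambda>k. cmod (w $ k))) = cmod (w $ i)" by (rule imageE)
    then show ?thesis using that[of i] Max_ge[of "range (\<lambda>k. cmod (w $ k))"] by auto
  qed
  have "w $ i \<noteq> 0"
  proof
    assume "w $ i = 0"
    then have "w = 0" using i by (simp add: vec_eq_iff)
    then show False using w by simp
  qed
  then show ?thesis using that[of i] i affine_rep_span[of w i] span_in_affine_piece[of w i]
    by (simp add: w norm_divide divide_simps)
qed

text \<open>The inverse of the \<open>i\<close>-th affine chart, lifted from lines to
  vectors.\<close>

definition affine_point :: "3 \<Rightarrow> complex^2 \<Rightarrow> complex^3" where
  "affine_point i u = (\<chi> k. if k = i then 1 else if k = i + 1 then u $ 1 else u $ 2)"

definition affine_chart :: "3 \<Rightarrow> (complex^3) set \<Rightarrow> complex^2" where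
  "affine_chart i l = vector [affine_rep i l $ (i + 1), affine_rep i l $ (i + 2)]"

lemma projective_plane_eq: "projective_plane = range (\<lambda>i. (affine_piece i, affine_chart i))"
  by (simp add: projective_plane_def affine_chart_def[abs_def])

lemma index3: "(i::3) + 1 \<noteq> i" "i + 2 \<noteq> i" "i + 2 \<noteq> i + 1" "k = i \<or> k = i + 1 \<or> k = i + 2"
proof -
  have "\<forall>i::3. i + 1 \<noteq> i \<and> i + 2 \<noteq> i \<and> i + 2 \<noteq> i + 1 \<and> (\<forall>k. k = i \<or> k = i + 1 \<or> k = i + 2)"
    by (simp add: forall_3)
  then show "(i::3) + 1 \<noteq> i" "i + 2 \<noteq> i" "i + 2 \<noteq> i + 1" "k = i \<or> k = i + 1 \<or> k = i + 2" by blast+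
qed

lemma affine_point_simps [simp]:
  "affine_point i u $ i = 1" "affine_point i u $ (i + 1) = u $ 1" "affine_point i u $ (i + 2) = u $ 2"
  using index3(1-3)[of i] by (simp_all add: affine_point_def)

lemma affine_point_nonzero [simp]: "affine_point i u \<noteq> 0"
  by (metis affine_point_simps(1) zero_index zero_neq_one)

lemma affine_point_chart:
  assumes "l \<in> affine_piece i"
  shows "affine_point i (affine_chart i l) = affine_rep i l"
proof -
  have "affine_point i (affine_chart i l) $ k = affine_rep i l $ k" for k
    using index3(4)[of k i] affine_pieceD(2)[OF assms]
    by (elim disjE) (simp_all add: affine_chart_def)
  then show ?thesis by (simp add: vec_eq_iff)
qed

lemma affine_chart_point: "affine_chart i (vec.span {affine_point i u}) = u"
  by (simp add: affine_chart_def affine_rep_span vec_eq_iff forall_2)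

lemma point_span_in_piece: "vec.span {affine_point i u} \<in> affine_piece i"
  by (simp add: span_in_affine_piece)

lemma bij_affine_chart: "inj_on (affine_chart i) (affine_piece i)" "affine_chart i ` affine_piece i = UNIV"
proof -
  show "inj_on (affine_chart i) (affine_piece i)"
    by (rule inj_on_inverseI[where g = "\<lambda>u. vec.span {affine_point i u}"])
       (simp add: affine_point_chart affine_pieceD(3)[symmetric])
  show "affine_chart i ` affine_piece i = UNIV"
    by (rule UNIV_eq_I[symmetric]) (rule image_eqI, rule affine_chart_point[symmetric], rule point_span_in_piece)
qed

lemma inv_affine_chart: "inv_into (affine_piece i) (affine_chart i) u = vec.span {affine_point i u}"
  by (rule inv_into_f_eq, rule bij_affine_chart(1), rule point_span_in_piece, rule affine_chart_point)

lemma hol_at_affine_point: "hol_at (\<lambda>u. affine_point i u $ k) z"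
  by (cases "k = i"; cases "k = i + 1") (simp_all add: affine_point_def)

lemma hol_map_affine_point: "hol_map_at (affine_point i) z"
  by (simp add: hol_map_at_def hol_at_affine_point)

lemma complex_atlas_projective_plane: "complex_atlas projective_plane"
proof -
  have dom: "affine_chart i ` (affine_piece i \<inter> affine_piece j) = {u. affine_point i u $ j \<noteq> 0}" for i j
  proof (intro equalityI subsetI)
    fix u assume "u \<in> affine_chart i ` (affine_piece i \<inter> affine_piece j)"
    then obtain l where l: "u = affine_chart i l" "l \<in> affine_piece i" "l \<in> affine_piece j" by auto
    then have "vec.span {affine_point i u} \<in> affine_piece j"
      by (simp add: affine_point_chart affine_pieceD(3)[symmetric])
    then show "u \<in> {u. affine_point i u $ j \<noteq> 0}" by (simp add: span_in_affine_piece)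
  next
    fix u assume "u \<in> {u. affine_point i u $ j \<noteq> 0}"
    then have "vec.span {affine_point i u} \<in> affine_piece i \<inter> affine_piece j"
      by (simp add: span_in_affine_piece)
    then show "u \<in> affine_chart i ` (affine_piece i \<inter> affine_piece j)"
      by (rule image_eqI[rotated]) (rule affine_chart_point[symmetric])
  qed
  have op: "open {u. affine_point i u $ j \<noteq> 0}" for i j
  proof -
    have "continuous_on UNIV (\<lambda>u. affine_point i u $ j)"
      by (intro continuous_at_imp_continuous_on ballI hol_at_imp_continuous hol_at_affine_point)
    then show ?thesis by (intro open_Collect_neq) auto
  qed
  have hol: "holomorphic_map_on (affine_chart j \<circ> inv_into (affine_piece i) (affine_chart i))
      {u. affine_point i u $ j \<noteq> 0}" for i j
  proof (rule holomorphic_map_on_cong[OF op])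
    let ?f = "\<lambda>u. vector [affine_point i u $ (j + 1) / affine_point i u $ j,
                 affine_point i u $ (j + 2) / affine_point i u $ j] :: complex^2"
    show "holomorphic_map_on ?f {u. affine_point i u $ j \<noteq> 0}"
      by (auto simp: holomorphic_map_on_iff hol_map_at_def forall_2 intro!: hol_at_divide hol_at_affine_point)
    show "?f u = (affine_chart j \<circ> inv_into (affine_piece i) (affine_chart i)) u"
      if "u \<in> {u. affine_point i u $ j \<noteq> 0}" for u
      using that by (simp add: inv_affine_chart affine_chart_def affine_rep_span vec_eq_iff forall_2)
  qed
  show ?thesis
    unfolding complex_atlas_def projective_plane_eq
    by (auto simp: bij_affine_chart dom op hol)
qed

lemma points_projective_plane: "points projective_plane = proj_space"
proof -
  have "l \<in> proj_space \<Longrightarrow> \<exists>i. l \<in> affine_piece i" for l :: "(complex^3) set"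
    using bounded_affine_rep by blast
  then show ?thesis by (auto simp: points_def projective_plane_eq affine_piece_def)
qed

section \<open>Charts of the local model of the blowing-up\<close>

definition bl_dir :: "'n \<Rightarrow> complex^'n \<Rightarrow> complex^'n" where
  "bl_dir i y = (\<chi> j. if j = i then 1 else y $ j)"

definition bl_proj :: "'n \<Rightarrow> complex^'n \<Rightarrow> complex^'n" where
  "bl_proj i y = y $ i *s bl_dir i y"

definition bl_domain :: "'n \<Rightarrow> ((complex^'n) \<times> (complex^'n) set) set" where
  "bl_domain i = {(z, l). l \<in> affine_piece i \<and> z \<in> l}"

definition bl_chart :: "'n \<Rightarrow> (complex^'n) \<times> (complex^'n) set \<Rightarrow> complex^'n" where
  "bl_chart i = (\<lambda>(z, l). \<chi> j. if j = i then z $ i else affine_rep i l $ j)"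

text \<open>Inverse of the \<open>i\<close>-th chart: the slot \<open>i\<close> of \<open>y\<close>
  is the scale and the other slots are affine coordinates of the line. Thus \<open>bl_dir\<close> is
  the normalised spanning vector of the line and \<open>bl_proj\<close> is the blow-down
  map.\<close>

definition bl_inv :: "'n \<Rightarrow> complex^'n \<Rightarrow> (complex^'n) \<times> (complex^'n) set" where
  "bl_inv i y = (bl_proj i y, vec.span {bl_dir i y})"

lemma blowup_origin_eq: "blowup_origin = range (\<lambda>i. (bl_domain i, bl_chart i))"
  by (simp add: blowup_origin_def bl_chart_def bl_domain_def)

lemma bl_dir_i [simp]: "bl_dir i y $ i = 1"
  by (simp add: bl_dir_def)

lemma bl_inv_in_domain: "bl_inv i y \<in> bl_domain i"
  using span_in_affine_piece[of "bl_dir i y" i] by (auto simp: bl_inv_def bl_domain_def bl_proj_def span_single)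

lemma bl_chart_inv: "bl_chart i (bl_inv i y) = y"
  by (simp add: bl_chart_def bl_inv_def bl_proj_def affine_rep_span vec_eq_iff) (simp add: bl_dir_def)

lemma bl_inv_chart:
  assumes "x \<in> bl_domain i"
  shows "bl_inv i (bl_chart i x) = x"
proof -
  obtain z l where x: "x = (z, l)" "l \<in> affine_piece i" "z \<in> l" using assms by (auto simp: bl_domain_def)
  have d: "bl_dir i (bl_chart i x) = affine_rep i l"
    using affine_pieceD(2)[OF x(2)] by (auto simp: x bl_dir_def bl_chart_def vec_eq_iff)
  obtain c where c: "z = c *s affine_rep i l"
    using x(3) affine_pieceD(3)[OF x(2)] by (metis rangeE span_single)
  then have "z = z $ i *s affine_rep i l" using affine_pieceD(2)[OF x(2)] by simp
  then show ?thesis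
    using d affine_pieceD(3)[OF x(2)] by (simp add: bl_inv_def bl_proj_def) (simp add: x bl_chart_def)
qed

lemma bij_bl_chart: "inj_on (bl_chart i) (bl_domain i)" "bl_chart i ` bl_domain i = UNIV"
proof -
  show "inj_on (bl_chart i) (bl_domain i)" by (rule inj_on_inverseI[where g = "bl_inv i"]) (rule bl_inv_chart)
  show "bl_chart i ` bl_domain i = UNIV" 
    by (rule UNIV_eq_I[symmetric]) (rule image_eqI, rule bl_chart_inv[symmetric], rule bl_inv_in_domain)
qed

lemma inv_bl_chart: "inv_into (bl_domain i) (bl_chart i) y = bl_inv i y"
  by (rule inv_into_f_eq, rule bij_bl_chart(1), rule bl_inv_in_domain, rule bl_chart_inv)

lemma hol_bl_dir: "hol_at (\<lambda>y. bl_dir i y $ k) z"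
  by (cases "k = i") (simp_all add: bl_dir_def)

lemma hol_bl_proj: "hol_map_at (bl_proj i) z"
  by (auto simp: bl_proj_def hol_map_at_def intro!: hol_at_mult hol_bl_dir)

lemma complex_atlas_blowup_origin: "complex_atlas (blowup_origin :: ((complex^'n) \<times> (complex^'n) set, 'n::finite) atlas)"
proof -
  have dom: "bl_chart i ` (bl_domain i \<inter> bl_domain j) = {y. bl_dir i y $ j \<noteq> 0}" for i j :: 'n
  proof (intro equalityI subsetI)
    fix y assume "y \<in> bl_chart i ` (bl_domain i \<inter> bl_domain j)"
    then obtain x where x: "y = bl_chart i x" "x \<in> bl_domain i" "x \<in> bl_domain j" by auto
    then have "bl_inv i y \<in> bl_domain j" by (simp add: bl_inv_chart)
    then show "y \<in> {y. bl_dir i y $ j \<noteq> 0}"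
      by (auto simp: bl_inv_def bl_domain_def span_in_affine_piece)
  next
    fix y assume "y \<in> {y. bl_dir i y $ j \<noteq> 0}"
    then have "bl_inv i y \<in> bl_domain j"
      using span_in_affine_piece[of "bl_dir i y" j] by (auto simp: bl_inv_def bl_domain_def bl_proj_def span_single)
    then have "bl_inv i y \<in> bl_domain i \<inter> bl_domain j" using bl_inv_in_domain by simp
    then show "y \<in> bl_chart i ` (bl_domain i \<inter> bl_domain j)"
      by (rule image_eqI[rotated]) (rule bl_chart_inv[symmetric])
  qed
  have op: "open {y. bl_dir i y $ j \<noteq> 0}" for i j :: 'n
  proof -
    have "continuous_on UNIV (\<lambda>u. bl_dir i u $ j)"
      by (intro continuous_at_imp_continuous_on ballI hol_at_imp_continuous hol_bl_dir)
    then show ?thesis by (intro open_Collect_neq) auto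
  qed
  have hol: "holomorphic_map_on (bl_chart j \<circ> inv_into (bl_domain i) (bl_chart i)) {y. bl_dir i y $ j \<noteq> 0}"
    for i j :: 'n
  proof (rule holomorphic_map_on_cong[OF op])
    let ?f = "\<lambda>y. \<chi> k. if k = j then bl_proj i y $ j else bl_dir i y $ k / bl_dir i y $ j"
    have "hol_at (\<lambda>y. bl_proj i y $ k) z" for k z using hol_bl_proj by (auto simp: hol_map_at_def)
    then have "hol_at (\<lambda>y. if k = j then bl_proj i y $ j else bl_dir i y $ k / bl_dir i y $ j) z"
      if "bl_dir i z $ j \<noteq> 0" for k z
      using that by (cases "k = j") (auto intro!: hol_at_divide hol_bl_dir)
    then show "holomorphic_map_on ?f {y. bl_dir i y $ j \<noteq> 0}"
      by (auto simp: holomorphic_map_on_iff hol_map_at_def)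
    show "?f y = (bl_chart j \<circ> inv_into (bl_domain i) (bl_chart i)) y"
      if "y \<in> {y. bl_dir i y $ j \<noteq> 0}" for y
      using that unfolding o_def inv_bl_chart
      by (simp add: bl_inv_def bl_chart_def affine_rep_span vec_eq_iff)
  qed
  show ?thesis
    unfolding complex_atlas_def blowup_origin_eq
    by (auto simp: bij_bl_chart dom op hol)
qed

lemma points_blowup_origin: "points blowup_origin = {(z, l). l \<in> proj_space \<and> z \<in> l}"
proof -
  have "l \<in> proj_space \<longleftrightarrow> (\<exists>i. l \<in> affine_piece i)" for l :: "(complex^'a) set"
  proof
    assume "l \<in> proj_space"
    then obtain i where "l \<in> affine_piece i" by (rule bounded_affine_rep)
    then show "\<exists>i. l \<in> affine_piece i" ..
  qed (auto simp: affine_piece_def)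
  then have *: "x \<in> points blowup_origin \<longleftrightarrow> x \<in> {(z, l). l \<in> proj_space \<and> z \<in> l}"
    for x :: "(complex^'a) \<times> (complex^'a) set"
    by (simp add: points_def blowup_origin_eq bl_domain_def case_prod_beta)
  show ?thesis by (rule set_eqI) (rule *)
qed

section \<open>Partial derivatives of holomorphic functions, by Cauchy's formula\<close>

lemma norm_axis_smult: "norm (s *s axis i (1::complex)) = cmod s"
proof -
  have "norm (s *s axis i (1::complex)) = sqrt (\<Sum>j\<in>UNIV. if j = i then (cmod s)\<^sup>2 else 0)"
    unfolding norm_vec_def L2_set_def by (rule arg_cong[where f = sqrt]) (intro sum.cong, auto simp: axis_def)
  then show ?thesis by simp
qed

lemma continuous_on_smult [continuous_intros]:
  fixes f :: "'a::topological_space \<Rightarrow> complex"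
  assumes "continuous_on A f"
  shows "continuous_on A (\<lambda>x. f x *s (v :: complex^'n))"
  unfolding vector_scalar_mult_def using assms by (intro continuous_intros)

lemma tendsto_line:
  fixes z \<xi> :: "complex^'n"
  shows "((\<lambda>\<zeta>. z + \<zeta> *s \<xi>) \<longlongrightarrow> z) (at 0)"
proof -
  have "continuous_on UNIV (\<lambda>\<zeta>. z + \<zeta> *s \<xi>)" by (intro continuous_intros)
  then have "((\<lambda>\<zeta>. z + \<zeta> *s \<xi>) \<longlongrightarrow> z + 0 *s \<xi>) (at 0)" unfolding continuous_on_def by blast
  then show ?thesis by simp
qed

text \<open>Cauchy's formula on a circle in the \<open>i\<close>-th coordinate direction. One radius
  serves all \<open>z\<close> near \<open>z0\<close>, so that regularity in \<open>z\<close> can be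
  read off under the integral sign. The factor 3 leaves room for centres within \<open>r\<close> of
  \<open>z0\<close> and for discs of radius \<open>2 * r\<close> around them.\<close>

lemma cpartial_eq_integral:
  fixes h :: "complex^'n \<Rightarrow> complex"
  assumes "open D" and h: "\<And>z. z \<in> D \<Longrightarrow> hol_at h z" and "z0 \<in> D"
  obtains r where "r > 0" "ball z0 (3 * r) \<subseteq> D"
     "\<And>z. z \<in> ball z0 r \<Longrightarrow> cpartial i h z =
        integral (cbox 0 1) (\<lambda>t. h (z + (r * exp (2 * of_real pi * \<i> * of_real t)) *s axis i 1) /
                                   (r * exp (2 * of_real pi * \<i> * of_real t)))"
proof -
  let ?e = "axis i 1 :: complex^'n"
  have rep: "\<exists>r>0. ball z0 (3 * r) \<subseteq> D \<and>
     (\<forall>z\<in>ball z0 r. cpartial i h z =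
        integral (cbox 0 1) (\<lambda>t. h (z + (r * exp (2 * of_real pi * \<i> * of_real t)) *s ?e) /
                                   (r * exp (2 * of_real pi * \<i> * of_real t))))"
  proof -
    obtain e where e: "e > 0" "ball z0 e \<subseteq> D" using \<open>open D\<close> \<open>z0 \<in> D\<close> openE by blast
    define r where "r = e / 3"
    have r: "r > 0" "ball z0 (3 * r) \<subseteq> D" using e by (auto simp: r_def)
    have "cpartial i h z = integral (cbox 0 1) (\<lambda>t. h (z + (r * exp (2 * of_real pi * \<i> * of_real t)) *s ?e) /
              (r * exp (2 * of_real pi * \<i> * of_real t)))" if z: "z \<in> ball z0 r" for z
    proof -
      define F where "F = (\<lambda>s. h (z + s *s ?e))"
      have hd: "(F has_field_derivative cpartial i h (z + s *s ?e)) (at s)" if "cmod s < 2 * r" for s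
      proof -
        have "dist z0 (z + s *s ?e) \<le> dist z0 z + norm (s *s ?e)"
          using dist_triangle[of z0 "z + s *s ?e" z] by (simp add: dist_norm)
        also have "\<dots> < 3 * r" using z that by (simp add: norm_axis_smult)
        finally have "hol_at h (z + s *s ?e)" using h r by auto
        from hol_at_line[OF this]
        show ?thesis unfolding F_def by (simp add: axis_def if_distrib cong: if_cong)
      qed
      have hol: "F holomorphic_on ball 0 (2 * r)"
        unfolding holomorphic_on_def field_differentiable_def
        by (metis hd has_field_derivative_at_within mem_ball_0)
      have "((\<lambda>u. F u / (u - 0) ^ Suc 1) has_contour_integral (2 * pi * \<i>) / fact 1 * (deriv ^^ 1) F 0) (circlepath 0 r)"
      proof (rule Cauchy_has_contour_integral_higher_derivative_circlepath)
        show "continuous_on (cball 0 r) F"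
          by (rule continuous_on_subset[OF holomorphic_on_imp_continuous_on[OF hol]]) (use r in auto)
        show "F holomorphic_on ball 0 r" by (rule holomorphic_on_subset[OF hol]) (use r in auto)
      qed (use r in auto)
      moreover have "deriv F 0 = cpartial i h z" using hd[of 0] r by (simp add: DERIV_imp_deriv)
      ultimately have "((\<lambda>u. F u / u\<^sup>2) has_contour_integral (2 * pi * \<i>) * cpartial i h z) (circlepath 0 r)"
        by (simp add: power2_eq_square)
      then have "((\<lambda>t. F (circlepath 0 r t) / (circlepath 0 r t)\<^sup>2 *
           (2 * pi * \<i> * r * exp (2 * of_real pi * \<i> * t))) has_integral (2 * pi * \<i>) * cpartial i h z) {0..1}"
        by (simp add: has_contour_integral vector_derivative_circlepath)
      \<comment> \<open>On the circle the velocity is \<open>2 * pi * \<i>\<close> times the point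
        itself, which cancels one of the two powers in the denominator.\<close>
      then have "((\<lambda>t. (2 * pi * \<i>) * (F (r * exp (2 * of_real pi * \<i> * of_real t)) / (r * exp (2 * of_real pi * \<i> * of_real t))))
          has_integral (2 * pi * \<i>) * cpartial i h z) {0..1}"
        using r by (simp add: circlepath power2_eq_square field_simps)
      from has_integral_mult_right[OF this, of "1 / (2 * pi * \<i>)"]
      have "((\<lambda>t. F (r * exp (2 * of_real pi * \<i> * of_real t)) / (r * exp (2 * of_real pi * \<i> * of_real t)))
          has_integral cpartial i h z) {0..1}" by (simp add: field_simps)
      then show ?thesis by (simp add: F_def integral_unique cbox_interval)
    qed
    then show ?thesis using r by blast
  qed
  then show thesis using that by blast
qed

lemma circle_in_ball:
  fixes z :: "complex^'n"
  assumes "z \<in> ball z0 r"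
  shows "z + (of_real r * exp (2 * of_real pi * \<i> * of_real t)) *s axis i 1 \<in> ball z0 (3 * r)"
proof -
  let ?v = "(of_real r * exp (2 * of_real pi * \<i> * of_real t)) *s axis i 1 :: complex^'n"
  have r: "r > 0" using assms zero_le_dist[of z0 z] by (simp only: mem_ball)
  have "dist z0 (z + ?v) \<le> dist z0 z + norm ?v"
    using dist_triangle[of z0 "z + ?v" z] by (simp add: dist_norm)
  also have "\<dots> < 3 * r" using assms r by (simp add: norm_axis_smult norm_mult)
  finally show ?thesis by simp
qed

lemma continuous_on_cpartial:
  fixes h :: "complex^'n \<Rightarrow> complex"
  assumes "open D" and h: "\<And>z. z \<in> D \<Longrightarrow> hol_at h z"
  shows "continuous_on D (cpartial i h)"
proof (rule continuous_at_imp_continuous_on, rule ballI)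
  fix z0 assume "z0 \<in> D"
  obtain r where r: "r > 0" "ball z0 (3 * r) \<subseteq> D" and
    eq: "\<And>z. z \<in> ball z0 r \<Longrightarrow> cpartial i h z =
        integral (cbox 0 1) (\<lambda>t. h (z + (r * exp (2 * of_real pi * \<i> * of_real t)) *s axis i 1) /
                                   (r * exp (2 * of_real pi * \<i> * of_real t)))"
    using cpartial_eq_integral[OF assms(1) h \<open>z0 \<in> D\<close>] by blast
  have ch: "continuous_on D h" using h by (intro continuous_at_imp_continuous_on) (auto intro: hol_at_imp_continuous)
  have "continuous_on (ball z0 r) (\<lambda>z. integral (cbox 0 1)
      (\<lambda>t. h (z + (r * exp (2 * of_real pi * \<i> * of_real t)) *s axis i 1) /
           (r * exp (2 * of_real pi * \<i> * of_real t))))"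
    by (rule integral_continuous_on_param, unfold case_prod_beta,
        intro continuous_intros continuous_on_compose2[OF ch])
       (use r circle_in_ball[of _ z0 r] in auto)
  then have "continuous_on (ball z0 r) (cpartial i h)"
    using eq by (subst continuous_on_cong[OF refl eq]) auto
  then show "isCont (cpartial i h) z0" using r by (simp add: continuous_on_eq_continuous_at)
qed

text \<open>Differentiation of the Cauchy integral under the integral sign. The Leibniz rule asks
  for a jointly continuous derivative of the integrand, which is why continuity of the first
  partials comes before this. Complex homogeneity passes through the integral.\<close>

lemma hol_at_cpartial:
  fixes h :: "complex^'n \<Rightarrow> complex"
  assumes "open D" and h: "\<And>z. z \<in> D \<Longrightarrow> hol_at h z" and "z0 \<in> D"
  shows "hol_at (cpartial i h) z0"
proof -
  let ?e = "axis i 1 :: complex^'n"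
  have cont: "continuous_on D (cpartial k h)" for k
    by (rule continuous_on_cpartial[OF assms(1,2)])
  obtain r where r: "r > 0" "ball z0 (3 * r) \<subseteq> D" and
    eq: "\<And>z. z \<in> ball z0 r \<Longrightarrow> cpartial i h z =
        integral (cbox 0 1) (\<lambda>t. h (z + (r * exp (2 * of_real pi * \<i> * of_real t)) *s ?e) /
                                   (r * exp (2 * of_real pi * \<i> * of_real t)))"
    using cpartial_eq_integral[OF assms(1) h \<open>z0 \<in> D\<close>] by blast
  define \<gamma> :: "real \<Rightarrow> complex" where "\<gamma> = (\<lambda>t. r * exp (2 * of_real pi * \<i> * of_real t))"
  \<comment> \<open>The derivative of the integrand as a bounded linear map: the Leibniz rule
    integrates it in the normed space of such maps.\<close>
  define fx where "fx = (\<lambda>z t. \<Sum>k\<in>UNIV. blinfun_mult_right (cpartial k h (z + \<gamma> t *s ?e) / \<gamma> t) o\<^sub>L Blinfun (\<lambda>v::complex^'n. v $ k))"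
  have \<gamma>: "cmod (\<gamma> t) = r" "\<gamma> t \<noteq> 0" for t using r by (auto simp: \<gamma>_def norm_mult)
  have inD: "z + \<gamma> t *s ?e \<in> D" if "z \<in> ball z0 r" for z t
    using circle_in_ball[OF that, of t i] r by (auto simp: \<gamma>_def)
  have nthk: "blinfun_apply (Blinfun (\<lambda>v::complex^'n. v $ k)) v = v $ k" for k v
    by (rule bounded_linear_Blinfun_apply[THEN fun_cong]) (rule bounded_linear_vec_nth)
  have fxa: "blinfun_apply (fx z t) v = (\<Sum>k\<in>UNIV. cpartial k h (z + \<gamma> t *s ?e) / \<gamma> t * v $ k)" for z t v
    by (simp add: fx_def blinfun.sum_left nthk)
  have c\<gamma>: "continuous_on A \<gamma>" for A unfolding \<gamma>_def by (intro continuous_intros)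
  have c1: "continuous_on (ball z0 r \<times> cbox 0 1) (\<lambda>x. fst x + \<gamma> (snd x) *s ?e)"
    by (intro continuous_intros continuous_on_compose2[OF c\<gamma>[of UNIV]]) auto
  have ch: "continuous_on D h" using h by (intro continuous_at_imp_continuous_on) (auto intro: hol_at_imp_continuous)
  have "continuous_on (ball z0 r \<times> cbox 0 1) (\<lambda>x. cpartial k h (fst x + \<gamma> (snd x) *s ?e) / \<gamma> (snd x))" for k
    by (intro continuous_intros continuous_on_compose2[OF cont] c1 continuous_on_compose2[OF c\<gamma>[of UNIV]])
       (use inD \<gamma> in auto)
  then have cfx: "continuous_on (ball z0 r \<times> cbox 0 1) (\<lambda>x. fx (fst x) (snd x))"
    unfolding fx_def
    by (intro continuous_on_sum continuous_on_const bounded_linear.continuous_on[OF bounded_linear_blinfun_mult_right]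
          bounded_bilinear.continuous_on[OF bounded_bilinear_blinfun_compose])
  have "((\<lambda>z. integral (cbox 0 1) (\<lambda>t. h (z + \<gamma> t *s ?e) / \<gamma> t)) has_derivative integral (cbox 0 1) (fx z0))
     (at z0 within ball z0 r)"
  proof (rule leibniz_rule)
    fix z and t :: real assume z: "z \<in> ball z0 r" and t: "t \<in> cbox 0 1"
    have "hol_at h (z + \<gamma> t *s ?e)" using h inD[OF z] by blast
    from hol_at_has_derivative[OF this]
    have "((\<lambda>x. h (x + \<gamma> t *s ?e)) has_derivative (\<lambda>v. \<Sum>k\<in>UNIV. cpartial k h (z + \<gamma> t *s ?e) * v $ k)) (at z)"
      by (rule has_derivative_compose[where f = "\<lambda>x. x + \<gamma> t *s ?e" and f' = "\<lambda>v. v", rotated])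
         (auto intro!: derivative_eq_intros)
    then have "((\<lambda>x. h (x + \<gamma> t *s ?e) / \<gamma> t) has_derivative (\<lambda>v. (\<Sum>k\<in>UNIV. cpartial k h (z + \<gamma> t *s ?e) * v $ k) / \<gamma> t)) (at z)"
      by (rule bounded_linear.has_derivative[OF bounded_linear_divide])
    moreover have "(\<lambda>v. (\<Sum>k\<in>UNIV. cpartial k h (z + \<gamma> t *s ?e) * v $ k) / \<gamma> t) = blinfun_apply (fx z t)"
      by (auto simp: fxa fun_eq_iff sum_divide_distrib)
    ultimately show "((\<lambda>x. h (x + \<gamma> t *s ?e) / \<gamma> t) has_derivative blinfun_apply (fx z t)) (at z within ball z0 r)"
      by (auto intro: has_derivative_at_withinI)
  next
    fix z assume z: "z \<in> ball z0 r"
    have "continuous_on (cbox 0 1) (\<lambda>t. z + \<gamma> t *s ?e)"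
      by (intro continuous_intros c\<gamma>)
    then have "continuous_on (cbox 0 1) (\<lambda>t. h (z + \<gamma> t *s ?e) / \<gamma> t)"
      by (intro continuous_intros continuous_on_compose2[OF ch] c\<gamma>) (use inD[OF z] \<gamma> c\<gamma> in auto)
    then show "(\<lambda>t. h (z + \<gamma> t *s ?e) / \<gamma> t) integrable_on cbox 0 1"
      by (rule integrable_continuous)
  next
    show "continuous_on (ball z0 r \<times> cbox 0 1) (\<lambda>(z, t). fx z t)" using cfx by (simp add: case_prod_beta)
  qed (use r in auto)
  then have "((\<lambda>z. integral (cbox 0 1) (\<lambda>t. h (z + \<gamma> t *s ?e) / \<gamma> t)) has_derivative integral (cbox 0 1) (fx z0))
     (at z0)"
    using r at_within_open[of z0 "ball z0 r"] by simp
  then have D: "(cpartial i h has_derivative integral (cbox 0 1) (fx z0)) (at z0)"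
  proof (rule has_derivative_transform_within_open)
    show "open (ball z0 r)" "z0 \<in> ball z0 r" using r by auto
  qed (use eq in \<open>auto simp: \<gamma>_def\<close>)
  show ?thesis
  proof (rule hol_atI[OF D])
    fix c x
    have "continuous_on (cbox 0 1) (fx z0)"
    proof -
      have "continuous_on (cbox 0 1) (\<lambda>t::real. (z0, t))" by (intro continuous_intros)
      moreover have "(\<lambda>t. (z0, t)) ` cbox 0 1 \<subseteq> ball z0 r \<times> cbox 0 1" using r by auto
      ultimately show ?thesis using continuous_on_compose2[OF cfx] by fastforce
    qed
    then have "fx z0 integrable_on cbox 0 1" by (rule integrable_continuous)
    from blinfun_apply_integral[OF this]
    show "blinfun_apply (integral (cbox 0 1) (fx z0)) (c *s x) = c * blinfun_apply (integral (cbox 0 1) (fx z0)) x"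
      by (simp add: fxa integral_mult_right[symmetric] sum_distrib_left mult.left_commute del: integral_mult_right)
  qed
qed

section \<open>Plane cubics\<close>

text \<open>Gaussian elimination, one equation at a time: if the equation of \<open>s\<close>
  involves some variable \<open>j\<close>, it is solved for that variable, and the remaining
  equations form a system with one unknown fewer.\<close>

lemma homogeneous_system_nontrivial:
  fixes ev :: "'s \<Rightarrow> 'i \<Rightarrow> 'f::field"
  assumes "finite S" "finite I" "card S < card I"
  shows "\<exists>a. (\<exists>i\<in>I. a i \<noteq> 0) \<and> (\<forall>s\<in>S. (\<Sum>i\<in>I. a i * ev s i) = 0)"
  using assms
proof (induction S arbitrary: I ev rule: finite_induct)
  case empty
  then have "I \<noteq> {}" by auto
  then show ?case by (intro exI[of _ "\<lambda>_. 1"]) auto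
next
  case (insert s S)
  show ?case
  proof (cases "\<forall>i\<in>I. ev s i = 0")
    case True
    have "card S < card I" using insert by simp
    then obtain a where "\<exists>i\<in>I. a i \<noteq> 0" "\<forall>s\<in>S. (\<Sum>i\<in>I. a i * ev s i) = 0"
      using insert.IH[of I ev] insert.prems by blast
    then show ?thesis using True by (intro exI[of _ a]) auto
  next
    case False
    then obtain j where j: "j \<in> I" "ev s j \<noteq> 0" by blast
    define J where "J = I - {j}"
    have J: "finite J" "card S < card J" "I = insert j J" "j \<notin> J"
      using insert j by (auto simp: J_def)
    \<comment> \<open>Coefficients of the equation \<open>t\<close> after substituting for the
      variable \<open>j\<close> its value from the equation \<open>s\<close>; below,
      \<open>c\<close> is that value.\<close>
    define ev' where "ev' = (\<lambda>t i. ev t i - ev t j * ev s i / ev s j)"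
    obtain a where a: "\<exists>i\<in>J. a i \<noteq> 0" "\<And>t. t \<in> S \<Longrightarrow> (\<Sum>i\<in>J. a i * ev' t i) = 0"
      using insert.IH[OF J(1,2), of ev'] by blast
    define c where "c = - (\<Sum>i\<in>J. a i * ev s i) / ev s j"
    define b where "b = a(j := c)"
    have sum_b: "(\<Sum>i\<in>I. b i * ev t i) = c * ev t j + (\<Sum>i\<in>J. a i * ev t i)" for t
    proof -
      have "(\<Sum>i\<in>J. b i * ev t i) = (\<Sum>i\<in>J. a i * ev t i)"
        using J by (intro sum.cong) (auto simp: b_def)
      then show ?thesis using J by (simp add: b_def)
    qed
    have "(\<Sum>i\<in>I. b i * ev t i) = 0" if "t \<in> insert s S" for t
    proof (cases "t = s")
      case True
      then show ?thesis using j by (simp add: sum_b c_def)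
    next
      case False
      then have "0 = (\<Sum>i\<in>J. a i * ev' t i)" using a(2) that by simp
      also have "\<dots> = (\<Sum>i\<in>J. a i * ev t i) - ev t j / ev s j * (\<Sum>i\<in>J. a i * ev s i)"
        by (simp add: ev'_def sum_distrib_left sum_subtractf[symmetric] algebra_simps)
      finally show ?thesis using j by (simp add: sum_b c_def)
    qed
    moreover have "\<exists>i\<in>I. b i \<noteq> 0" using a(1) J by (auto simp: b_def)
    ultimately show ?thesis by blast
  qed
qed

text \<open>Two exponents determine a monomial of degree 3. The third is \<open>3 - i - j\<close>,
  and this truncated difference is exact because \<open>i + j \<le> 3\<close>. Ten monomials against
  at most nine points: this is the origin of the bound 10.\<close>

definition cubic_exps :: "(nat \<times> nat) set" where
  "cubic_exps = {(i, j). i + j \<le> 3}"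

definition cubic :: "(nat \<times> nat \<Rightarrow> complex) \<Rightarrow> complex^3 \<Rightarrow> complex" where
  "cubic a x = (\<Sum>(i, j)\<in>cubic_exps. a (i, j) * (x $ 1 ^ i * x $ 2 ^ j * x $ 3 ^ (3 - i - j)))"

lemma cubic_exps_eq:
  "cubic_exps = {(0,0),(0,1),(0,2),(0,3),(1,0),(1,1),(1,2),(2,0),(2,1),(3,0)}"
proof -
  have "i + j \<le> 3 \<longleftrightarrow> (i, j) \<in> {(0,0),(0,1),(0,2),(0,3),(1,0),(1,1),(1,2),(2,0),(2,1),(3,0)}" for i j :: nat
    by simp presburger
  then show ?thesis unfolding cubic_exps_def by auto
qed

lemma finite_cubic_exps [simp]: "finite cubic_exps" and card_cubic_exps: "card cubic_exps = 10"
  by (simp_all add: cubic_exps_eq)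

lemma cubic_smult: "cubic a (c *s x) = c ^ 3 * cubic a x"
proof -
  have "c ^ i * c ^ j * c ^ (3 - i - j) = c ^ 3" if "(i, j) \<in> cubic_exps" for i j
    using that by (simp add: power_add[symmetric] cubic_exps_def)
  then show ?thesis
    unfolding cubic_def sum_distrib_left
    by (intro sum.cong) (auto simp: power_mult_distrib algebra_simps)
qed

lemma hol_at_cubic: "hol_at (cubic a) z"
  unfolding cubic_def[abs_def] case_prod_beta by (intro hol_at_sum hol_at_mult hol_at_power hol_at_const hol_at_component)

text \<open>Kronecker substitution of \<open>(t, t ^ 4, 1)\<close>: since \<open>i \<le> 3\<close>,
  the exponents \<open>i + 4 * j\<close> are pairwise distinct, so no two monomials merge and the
  polynomial in \<open>t\<close> is nonzero.\<close>

lemma cubic_nonzero: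
  assumes "e \<in> cubic_exps" "a e \<noteq> 0"
  shows "\<exists>x. cubic a x \<noteq> 0"
proof -
  define P where "P = (\<Sum>(i, j)\<in>cubic_exps. monom (a (i, j)) (i + 4 * j))"
  obtain i j where e: "e = (i, j)" by (cases e)
  have "Polynomial.coeff P (i + 4 * j) = (\<Sum>(k, l)\<in>cubic_exps. if (k, l) = e then a (k, l) else 0)"
    unfolding P_def Polynomial.coeff_sum case_prod_beta Polynomial.coeff_monom
    using assms(1) by (intro sum.cong refl) (auto simp: e cubic_exps_eq)
  also have "\<dots> = a e" using assms(1) by (simp add: case_prod_beta)
  finally have "P \<noteq> 0" using assms(2) by auto
  then obtain t where "poly P t \<noteq> 0" using poly_all_0_iff_0 by blast
  moreover have "poly P t = cubic a (vector [t, t ^ 4, 1])"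
    by (simp add: P_def cubic_def poly_sum case_prod_beta poly_monom power_add power_mult)
  ultimately show ?thesis by metis
qed

text \<open>The value \<open>cubic a w\<close> is the coefficient of t^3 on the line. Its role is
  seen without expanding: a polynomial without roots is a constant \<open>c\<close>, homogeneity
  then gives \<open>cubic a (w + s *s u) = s ^ 3 * c\<close> for nonzero \<open>s\<close>, and the
  limit at 0 forces \<open>cubic a w = 0\<close>.\<close>

lemma cubic_root_on_line:
  assumes "cubic a w \<noteq> 0"
  shows "\<exists>t. cubic a (u + t *s w) = 0"
proof (rule ccontr)
  assume no: "\<nexists>t. cubic a (u + t *s w) = 0"
  define P where "P = (\<Sum>(i, j)\<in>cubic_exps. smult (a (i, j))
     ([:u $ 1, w $ 1:] ^ i * [:u $ 2, w $ 2:] ^ j * [:u $ 3, w $ 3:] ^ (3 - i - j)))"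
  have P: "poly P t = cubic a (u + t *s w)" for t
    by (simp add: P_def cubic_def poly_sum case_prod_beta)
  have "degree P = 0"
  proof (rule ccontr)
    assume "degree P \<noteq> 0"
    then have "Polynomial.coeff P 0 = 0 \<or> (\<exists>i\<in>{1..degree P}. Polynomial.coeff P i \<noteq> 0)"
      by (intro disjI2 bexI[of _ "degree P"]) auto
    then obtain t where "(\<Sum>i\<le>degree P. Polynomial.coeff P i * t ^ i) = 0"
      by (rule fundamental_theorem_of_algebra)
    then show False using no P by (metis poly_altdef)
  qed
  then obtain c where "P = [:c:]" by (rule degree_eq_zeroE)
  then have c: "cubic a (u + t *s w) = c" for t using P[of t] by simp
  have "cubic a (w + s *s u) = s ^ 3 * c" if "s \<noteq> 0" for s
  proof -
    have "w + s *s u = s *s (u + (1 / s) *s w)"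
      using that by (simp add: vec_eq_iff field_simps)
    then have "cubic a (w + s *s u) = cubic a (s *s (u + (1 / s) *s w))" by (rule arg_cong)
    then show ?thesis by (simp only: cubic_smult c)
  qed
  moreover have "((\<lambda>s. s ^ 3 * c) \<longlongrightarrow> 0) (at 0)" by (auto intro!: tendsto_eq_intros)
  ultimately have "((\<lambda>s. cubic a (w + s *s u)) \<longlongrightarrow> 0) (at 0)"
    by (subst filterlim_cong[OF refl refl, of _ "\<lambda>s. s ^ 3 * c"]) (auto simp: eventually_at_filter)
  moreover have "isCont (\<lambda>s. cubic a (w + s *s u)) 0"
    using hol_at_line[OF hol_at_cubic] DERIV_isCont by blast
  then have "((\<lambda>s. cubic a (w + s *s u)) \<longlongrightarrow> cubic a w) (at 0)" by (simp add: isCont_def)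
  ultimately show False using assms tendsto_unique[OF trivial_limit_at] by blast
qed

section \<open>The strong maximum principle\<close>

lemma second_derivative_local_max:
  fixes \<phi> :: "real \<Rightarrow> real"
  assumes d1: "\<forall>\<^sub>F t in nhds 0. (\<phi> has_real_derivative \<phi>' t) (at t)"
    and d2: "(\<phi>' has_real_derivative D) (at 0)"
    and max: "\<forall>\<^sub>F t in nhds 0. \<phi> t \<le> \<phi> 0"
  shows "D \<le> 0"
proof (rule ccontr)
  assume "\<not> D \<le> 0"
  then have "D > 0" by simp
  obtain e where e: "e > 0" "\<And>t. \<bar>t\<bar> < e \<Longrightarrow> (\<phi> has_real_derivative \<phi>' t) (at t) \<and> \<phi> t \<le> \<phi> 0"
    using eventually_conj[OF d1 max] by (auto simp: eventually_nhds_metric dist_real_def)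
  have "\<phi>' 0 = 0"
    by (rule DERIV_local_max[of \<phi> "\<phi>' 0" 0 e]) (use e in \<open>auto simp: abs_minus_commute\<close>)
  obtain d where d: "d > 0" "\<And>t. 0 < t \<Longrightarrow> t < d \<Longrightarrow> \<phi>' 0 < \<phi>' (0 + t)"
    using DERIV_pos_inc_right[OF d2 \<open>D > 0\<close>] by blast
  define t where "t = min d e / 2"
  have t: "0 < t" "t < d" "t < e" using d e by (auto simp: t_def min_def)
  have "\<phi> 0 < \<phi> t"
  proof (rule DERIV_pos_imp_increasing_open[OF t(1)])
    show "\<exists>y. (\<phi> has_real_derivative y) (at x) \<and> 0 < y" if "0 < x" "x < t" for x
      using e(2)[of x] d(2)[of x] that t \<open>\<phi>' 0 = 0\<close> by auto
    show "continuous_on {0..t} \<phi>"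
      using e(2) t by (intro continuous_at_imp_continuous_on ballI) (metis DERIV_isCont abs_of_nonneg atLeastAtMost_iff le_less_trans)
  qed
  then show False using e(2)[of t] t by auto
qed

text \<open>
  The hypothesis \<open>visc\<close> says that \<open>ln f\<close> is, in the viscosity sense, a subsolution of
  the elliptic operator whose symbol is \<open>\<bar>\<langle>\<xi>, \<eta>\<rangle>\<bar>\<^sup>2 + d * \<bar>\<xi>\<^sub>2\<bar>\<^sup>2\<close>, tested only on the barriers
  \<open>exp (- \<alpha> * \<bar>z - p\<bar>\<^sup>2)\<close> that the Hopf argument uses.
\<close>

lemma strong_maximum_principle:
  fixes f d :: "complex^2 \<Rightarrow> real" and \<eta> :: "complex^2 \<Rightarrow> complex^2"
  assumes "open \<Omega>" and f: "continuous_on \<Omega> f" and le: "\<And>z. z \<in> \<Omega> \<Longrightarrow> f z \<le> M" and "0 < M"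
    and z0: "z0 \<in> \<Omega>" "f z0 = M"
    and \<eta>: "continuous_on \<Omega> \<eta>" "\<And>z. z \<in> \<Omega> \<Longrightarrow> \<eta> z $ 1 \<noteq> 0"
    and d: "continuous_on \<Omega> d" "\<And>z. z \<in> \<Omega> \<Longrightarrow> d z > 0"
    and visc: "\<And>z p \<alpha> \<epsilon>. z \<in> \<Omega> \<Longrightarrow> f z > 0 \<Longrightarrow> 0 < \<epsilon> \<Longrightarrow> 0 < \<alpha> \<Longrightarrow>
       \<forall>\<^sub>F y in nhds z. f y * exp (\<epsilon> * exp (- \<alpha> * (dist y p)\<^sup>2)) \<le> f z * exp (\<epsilon> * exp (- \<alpha> * (dist z p)\<^sup>2)) \<Longrightarrow>
       \<alpha> * ((cmod (\<Sum>k\<in>UNIV. (z - p) $ k * cnj (\<eta> z $ k)))\<^sup>2 + d z * (cmod ((z - p) $ 2))\<^sup>2)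
         \<le> (norm (\<eta> z))\<^sup>2 + d z"
  shows "\<forall>\<^sub>F z in nhds z0. f z = M"
proof -
  obtain R where R: "R > 0" "cball z0 R \<subseteq> \<Omega>"
    using \<open>open \<Omega>\<close> z0 open_contains_cball by blast
  \<comment> \<open>With the radius \<open>R / 2\<close>, the point of \<open>K\<close> nearest to
    \<open>z1\<close>, being no farther away than \<open>z0\<close>, lies in the open ball of radius
    \<open>R\<close>.\<close>
  have "f z1 = M" if z1: "z1 \<in> ball z0 (R / 2)" for z1
  proof (rule ccontr)
    assume "f z1 \<noteq> M"
    define K where "K = {z \<in> cball z0 R. f z = M}"
    have cK: "continuous_on (cball z0 R) f" using f R continuous_on_subset by blast
    have "closed K" unfolding K_def
      using continuous_closed_preimage[OF cK closed_cball, of "{M}"] by (simp add: vimage_def Int_def)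
    moreover have "z0 \<in> K" using z0 R by (simp add: K_def)
    ultimately obtain y where y: "y \<in> K" "\<And>z. z \<in> K \<Longrightarrow> dist z1 y \<le> dist z1 z"
      using distance_attains_inf[of K z1] by blast
    define \<rho> where "\<rho> = dist z1 y / 2"
    have "z1 \<notin> K" using \<open>f z1 \<noteq> M\<close> by (simp add: K_def)
    then have "\<rho> > 0" using y by (auto simp: \<rho>_def)
    have y0: "y \<in> ball z0 R"
      using y(2)[OF \<open>z0 \<in> K\<close>] z1 dist_triangle[of z0 y z1] by (simp add: dist_commute)
    have fy: "f y = M" using y by (simp add: K_def)
    \<comment> \<open>Midpoint of \<open>z1\<close> and \<open>y\<close>. The ball of radius
      \<open>2 * \<rho>\<close> around \<open>z1\<close> has no point of \<open>K\<close> in its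
      interior, and the closed ball of radius \<open>\<rho>\<close> around \<open>p\<close> touches
      its boundary only at \<open>y\<close>. So \<open>y\<close> is the only maximum point of
      \<open>f\<close> in the smaller ball.\<close>
    define p where "p = (1/2) *\<^sub>R (z1 + y)"
    have py: "p - z1 = y - p" "norm (y - p) = \<rho>"
    proof -
      have "p + p = z1 + y" unfolding p_def by (metis scaleR_add_right scaleR_half_double)
      then show "p - z1 = y - p" by (simp add: algebra_simps)
      then have "y - z1 = 2 *\<^sub>R (y - p)" by (simp add: scaleR_2 algebra_simps)
      then show "norm (y - p) = \<rho>" by (simp add: \<rho>_def dist_norm norm_minus_commute)
    qed
    have touch: "f z < M" if z: "z \<in> cball z0 R" "dist z p \<le> \<rho>" "z \<noteq> y" for z
    proof (rule ccontr)
      assume "\<not> f z < M"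
      then have "z \<in> K" using le[of z] z R by (force simp: K_def)
      then have ge: "2 * \<rho> \<le> norm (z - z1)" using y(2)[of z] by (simp add: \<rho>_def dist_norm norm_minus_commute[of z1])
      have np: "norm (p - z1) = \<rho>" unfolding py(1) by (rule py(2))
      have nz: "norm (z - p) \<le> \<rho>" using z by (simp add: dist_norm)
      have sum: "(z - p) + (p - z1) = z - z1" by simp
      have "norm (z - z1) \<le> norm (z - p) + norm (p - z1)"
        using norm_triangle_ineq[of "z - p" "p - z1"] by simp
      then have n: "norm (z - p) = \<rho>" and "norm ((z - p) + (p - z1)) = norm (z - p) + norm (p - z1)"
        using ge nz np unfolding sum by linarith+
      then have "norm (z - p) *\<^sub>R (p - z1) = norm (p - z1) *\<^sub>R (z - p)"
        by (intro norm_triangle_eq[THEN iffD1])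
      then have "\<rho> *\<^sub>R (p - z1) = \<rho> *\<^sub>R (z - p)" by (simp only: n np)
      then have "z - p = y - p" using \<open>\<rho> > 0\<close> by (simp add: py(1))
      then have "z = y" by simp
      then show False using z by simp
    qed
    \<comment> \<open>\<open>A\<close> is the symbol of the operator at \<open>z - p\<close> and
      \<open>B\<close> its trace term: \<open>visc\<close> yields
      \<open>\<alpha> * A z \<le> B z\<close> wherever the barrier lets \<open>f\<close> have a
      local maximum.\<close>
    define A where "A = (\<lambda>z. (cmod (\<Sum>k\<in>UNIV. (z - p) $ k * cnj (\<eta> z $ k)))\<^sup>2 + d z * (cmod ((z - p) $ 2))\<^sup>2)"
    define B where "B = (\<lambda>z. (norm (\<eta> z))\<^sup>2 + d z)"
    have y\<Omega>: "y \<in> \<Omega>" using y0 R by auto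
    have "A y > 0"
    proof (cases "(y - p) $ 2 = 0")
      case False
      then show ?thesis using d(2)[OF y\<Omega>] by (auto simp: A_def intro!: add_nonneg_pos)
    next
      case True
      have "y \<noteq> p" using py \<open>\<rho> > 0\<close> by auto
      then have "(y - p) $ 1 \<noteq> 0" using True by (auto simp: vec_eq_iff forall_2)
      then have "(\<Sum>k\<in>UNIV. (y - p) $ k * cnj (\<eta> y $ k)) \<noteq> 0"
        using True \<eta>(2)[OF y\<Omega>] by (simp add: sum_2)
      then show ?thesis using d(2)[OF y\<Omega>] unfolding A_def
        by (intro add_pos_nonneg) auto
    qed
    have "B y > 0" using d(2)[OF y\<Omega>] by (simp add: B_def add_nonneg_pos)
    \<comment> \<open>Chosen so that \<open>\<alpha> * A y - B y = 1\<close>, against the conclusion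
      of \<open>visc\<close> at \<open>y\<close>; by continuity the strict inequality survives on a
      small ball around \<open>y\<close>.\<close>
    define \<alpha> where "\<alpha> = (B y + 1) / A y"
    have \<alpha>: "\<alpha> > 0" "\<alpha> * A y - B y > 0" using \<open>A y > 0\<close> \<open>B y > 0\<close> by (auto simp: \<alpha>_def)
    have "continuous_on \<Omega> (\<lambda>z. \<alpha> * A z - B z)"
      unfolding A_def B_def by (intro continuous_intros \<eta> d)
    then have "open {z \<in> \<Omega>. \<alpha> * A z - B z > 0}"
      using continuous_open_preimage[OF _ \<open>open \<Omega>\<close>, of "\<lambda>z. \<alpha> * A z - B z" "{0<..}"]
      by (simp add: vimage_def Int_def)
    then have "open ({z \<in> \<Omega>. \<alpha> * A z - B z > 0} \<inter> ball z0 R)" by (intro open_Int open_ball)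
    moreover have "y \<in> {z \<in> \<Omega>. \<alpha> * A z - B z > 0} \<inter> ball z0 R" using \<alpha> y0 y\<Omega> by simp
    ultimately obtain \<delta> where \<delta>: "\<delta> > 0" "cball y \<delta> \<subseteq> {z \<in> \<Omega>. \<alpha> * A z - B z > 0} \<inter> ball z0 R"
      using open_contains_cball by meson
    have \<delta>\<Omega>: "cball y \<delta> \<subseteq> \<Omega>" using \<delta> by auto
    \<comment> \<open>The part of the small sphere on which the barrier may be positive. It omits
      \<open>y\<close>, so there \<open>f < M\<close>, and compactness gives a bound
      \<open>M'\<close> below \<open>M\<close>.\<close>
    define T where "T = sphere y \<delta> \<inter> cball p \<rho>"
    have TM: "f z < M" if "z \<in> T" for z
      using that \<delta> by (intro touch) (auto simp: T_def dist_commute subset_iff)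
    obtain M' where M': "0 < M'" "M' < M" "\<And>z. z \<in> T \<Longrightarrow> f z \<le> M'"
    proof (cases "T = {}")
      case True
      then show ?thesis using that[of "M / 2"] \<open>0 < M\<close> by auto
    next
      case False
      have "compact T" by (auto simp: T_def intro!: compact_Int_closed)
      moreover have "continuous_on T f"
        by (rule continuous_on_subset[OF f]) (use \<delta>\<Omega> in \<open>auto simp: T_def\<close>)
      ultimately obtain x where "x \<in> T" "\<And>z. z \<in> T \<Longrightarrow> f z \<le> f x"
        using continuous_attains_sup[OF _ False] by blast
      then show ?thesis using that[of "max (f x) (M / 2)"] TM[of x] \<open>0 < M\<close> by fastforce
    qed
    \<comment> \<open>Half the logarithm makes \<open>M' * exp \<epsilon>\<close> the geometric mean
      of \<open>M'\<close> and \<open>M\<close>. The barrier is at most 1, so on \<open>T\<close> it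
      cannot lift \<open>f\<close> to \<open>M\<close>.\<close>
    define \<epsilon> where "\<epsilon> = ln (M / M') / 2"
    have \<epsilon>: "\<epsilon> > 0" "M' * exp \<epsilon> < M"
    proof -
      have "ln (M / M') > 0" using M' by simp
      then show "\<epsilon> > 0" by (simp add: \<epsilon>_def)
      then have "exp \<epsilon> < exp (2 * \<epsilon>)" by simp
      also have "exp (2 * \<epsilon>) = M / M'" using M' by (simp add: \<epsilon>_def)
      finally show "M' * exp \<epsilon> < M" using M' by (simp add: field_simps)
    qed
    \<comment> \<open>Normalised to vanish at distance \<open>\<rho>\<close> from \<open>p\<close>.
      Hence \<open>g y = M\<close>, while on the small sphere \<open>g < M\<close>, by the choice of
      \<open>\<epsilon>\<close> on \<open>T\<close> and by the sign of \<open>b\<close> elsewhere.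
      The maximum of \<open>g\<close> is therefore interior.\<close>
    define b where "b = (\<lambda>z. exp (- \<alpha> * (dist z p)\<^sup>2) - exp (- \<alpha> * \<rho>\<^sup>2))"
    define g where "g = (\<lambda>z. f z * exp (\<epsilon> * b z))"
    have "continuous_on (cball y \<delta>) g"
      unfolding g_def b_def by (intro continuous_intros continuous_on_subset[OF f \<delta>\<Omega>])
    then obtain z where z: "z \<in> cball y \<delta>" "\<And>x. x \<in> cball y \<delta> \<Longrightarrow> g x \<le> g z"
      using continuous_attains_sup[OF compact_cball, of y \<delta> g] \<delta>(1) by auto
    have "g y = M" using py by (simp add: g_def b_def fy dist_norm)
    then have gz: "g z \<ge> M" using z(2)[of y] \<delta> by simp
    have "z \<in> \<Omega>" using z \<delta>\<Omega> by auto
    have fz: "f z > 0" using gz \<open>0 < M\<close> by (auto simp: g_def zero_less_mult_iff dest: less_le_trans)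
    have "z \<notin> sphere y \<delta>"
    proof
      assume s: "z \<in> sphere y \<delta>"
      show False
      proof (cases "dist z p \<le> \<rho>")
        case True
        then have "z \<in> T" using s by (simp add: T_def dist_commute)
        have "b z \<le> 1"
        proof -
          have "exp (- \<alpha> * (dist z p)\<^sup>2) \<le> 1" using \<alpha> by simp
          moreover have "exp (- \<alpha> * \<rho>\<^sup>2) \<ge> 0" by simp
          ultimately show ?thesis unfolding b_def by linarith
        qed
        then have "exp (\<epsilon> * b z) \<le> exp \<epsilon>" using \<epsilon> by simp
        then have "g z \<le> M' * exp \<epsilon>"
          unfolding g_def using M'(3)[OF \<open>z \<in> T\<close>] fz by (intro mult_mono) auto
        then show False using gz \<epsilon> by simp
      next
        case False
        then have "\<rho>\<^sup>2 < (dist z p)\<^sup>2" using \<open>\<rho> > 0\<close> by (intro power_strict_mono) auto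
        then have "b z < 0" using \<alpha> by (simp add: b_def)
        then have "exp (\<epsilon> * b z) < 1" using \<epsilon> by (simp add: mult_pos_neg)
        then have "g z < f z * 1" unfolding g_def using fz by (intro mult_strict_left_mono)
        then show False using gz le[OF \<open>z \<in> \<Omega>\<close>] by simp
      qed
    qed
    then have "z \<in> ball y \<delta>" using z by auto
    then have "\<forall>\<^sub>F x in nhds z. x \<in> ball y \<delta>" using eventually_nhds_in_open by blast
    then have "\<forall>\<^sub>F x in nhds z. f x * exp (\<epsilon> * exp (- \<alpha> * (dist x p)\<^sup>2)) \<le> f z * exp (\<epsilon> * exp (- \<alpha> * (dist z p)\<^sup>2))"
    proof eventually_elim
      case (elim x)
      \<comment> \<open>The barrier in \<open>visc\<close> is not normalised; the two products
        differ by a constant positive factor.\<close>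
      have "f u * exp (\<epsilon> * exp (- \<alpha> * (dist u p)\<^sup>2)) = g u * exp (\<epsilon> * exp (- \<alpha> * \<rho>\<^sup>2))" for u
        by (simp add: g_def b_def right_diff_distrib exp_diff)
      moreover have "g x \<le> g z" using z(2) elim by simp
      ultimately show ?case by simp
    qed
    from visc[OF \<open>z \<in> \<Omega>\<close> fz \<epsilon>(1) \<alpha>(1) this]
    have "\<alpha> * A z \<le> B z" by (simp add: A_def B_def)
    then show False using z \<delta> by force
  qed
  moreover have "\<forall>\<^sub>F z in nhds z0. z \<in> ball z0 (R / 2)" using R by (intro eventually_nhds_in_open) auto
  ultimately show ?thesis by (auto elim: eventually_mono)
qed

section \<open>The complex Hessian and maxima along complex lines\<close>

definition twice_diff_on :: "'a::real_normed_vector set \<Rightarrow> ('a \<Rightarrow> real) \<Rightarrow> bool" where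
  "twice_diff_on \<Omega> v \<longleftrightarrow> (\<forall>z\<in>\<Omega>. v differentiable at z \<and>
     (\<forall>a. (\<lambda>x. frechet_derivative v (at x) a) differentiable at z))"

definition second_deriv :: "('a::real_normed_vector \<Rightarrow> real) \<Rightarrow> 'a \<Rightarrow> 'a \<Rightarrow> 'a \<Rightarrow> real" where
  "second_deriv v z a b = frechet_derivative (\<lambda>x. frechet_derivative v (at x) a) (at z) b"

context
  fixes \<Omega> :: "'a::real_normed_vector set" and v :: "'a \<Rightarrow> real"
  assumes op: "open \<Omega>" and tw: "twice_diff_on \<Omega> v"
begin

lemma D1_has_derivative:
  "z \<in> \<Omega> \<Longrightarrow> (v has_derivative frechet_derivative v (at z)) (at z)"
  using tw frechet_derivative_works by (auto simp: twice_diff_on_def)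

lemma D2_has_derivative:
  "z \<in> \<Omega> \<Longrightarrow> ((\<lambda>x. frechet_derivative v (at x) a) has_derivative second_deriv v z a) (at z)"
  using tw frechet_derivative_works unfolding second_deriv_def[abs_def] by (auto simp: twice_diff_on_def)

lemma D1_linear: "z \<in> \<Omega> \<Longrightarrow> linear (frechet_derivative v (at z))"
  using D1_has_derivative has_derivative_linear by blast

lemma D2_linear: "z \<in> \<Omega> \<Longrightarrow> linear (second_deriv v z a)"
  using D2_has_derivative has_derivative_linear by blast

text \<open>First derivatives are linear at every point of the open set, and this identity can be
  differentiated at \<open>z\<close>.\<close>

lemma D2_linear_left:
  assumes z: "z \<in> \<Omega>"
  shows "linear (\<lambda>a. second_deriv v z a b)"
proof (rule linearI)
  have *: "second_deriv v z a = L" if L: "(g has_derivative L) (at z)" and eq: "\<And>x. x \<in> \<Omega> \<Longrightarrow> g x = frechet_derivative v (at x) a"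
    for a g L
  proof -
    have "((\<lambda>x. frechet_derivative v (at x) a) has_derivative L) (at z)"
      using has_derivative_transform_within_open[OF L op z eq] .
    then show ?thesis using D2_has_derivative[OF z] has_derivative_unique by blast
  qed
  fix a a' :: 'a and r :: real
  have "second_deriv v z (a + a') = (\<lambda>b. second_deriv v z a b + second_deriv v z a' b)"
    by (rule *[where g = "\<lambda>x. frechet_derivative v (at x) a + frechet_derivative v (at x) a'"])
       (auto intro!: has_derivative_add D2_has_derivative z simp: linear_add[OF D1_linear])
  then show "second_deriv v z (a + a') b = second_deriv v z a b + second_deriv v z a' b" by simp
  have "second_deriv v z (r *\<^sub>R a) = (\<lambda>b. r *\<^sub>R second_deriv v z a b)"
    by (rule *[where g = "\<lambda>x. r *\<^sub>R frechet_derivative v (at x) a"])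
       (auto intro!: has_derivative_mult_right D2_has_derivative z simp: linear_scale[OF D1_linear])
  then show "second_deriv v z (r *\<^sub>R a) b = r *\<^sub>R second_deriv v z a b" by simp
qed

lemma D1_line:
  assumes "z + t *\<^sub>R w \<in> \<Omega>"
  shows "((\<lambda>t. v (z + t *\<^sub>R w)) has_real_derivative frechet_derivative v (at (z + t *\<^sub>R w)) w) (at t)"
proof -
  have "((\<lambda>t. z + t *\<^sub>R w) has_derivative (\<lambda>s. s *\<^sub>R w)) (at t)" by (auto intro!: derivative_eq_intros)
  from has_derivative_compose[OF this D1_has_derivative[OF assms]] show ?thesis
    by (simp add: has_field_derivative_def linear_scale[OF D1_linear[OF assms]] mult.commute[of _ "frechet_derivative _ _ _"])
qed

lemma D2_line:
  assumes "z \<in> \<Omega>"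
  shows "((\<lambda>t. frechet_derivative v (at (z + t *\<^sub>R w)) a) has_real_derivative second_deriv v z a w) (at 0)"
proof -
  have "((\<lambda>t. z + t *\<^sub>R w) has_derivative (\<lambda>s. s *\<^sub>R w)) (at 0)" by (auto intro!: derivative_eq_intros)
  then have "((\<lambda>t. frechet_derivative v (at (z + t *\<^sub>R w)) a) has_derivative (\<lambda>s. second_deriv v z a (s *\<^sub>R w))) (at 0)"
    by (rule has_derivative_compose) (use D2_has_derivative[OF assms] in simp)
  then show ?thesis
    by (simp add: has_field_derivative_def linear_scale[OF D2_linear[OF assms]] mult.commute[of _ "second_deriv _ _ _ _"])
qed

end

text \<open>The complex Hessian as a Hermitian form. The factor 4 makes it, for twice differentiable
  \<open>v\<close>, the Laplacian at 0 of \<open>v\<close> along the complex line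
  \<open>z + \<zeta> *s \<xi>\<close>.\<close>

definition levi :: "(complex^'n \<Rightarrow> real) \<Rightarrow> complex^'n \<Rightarrow> complex^'n \<Rightarrow> real" where
  "levi v z \<xi> = Re (\<Sum>i\<in>UNIV. \<Sum>j\<in>UNIV.
     4 * d_hol i (d_antihol j (\<lambda>u. of_real (v u))) z * \<xi> $ i * cnj (\<xi> $ j))"

lemma d_hol_d_antihol:
  fixes v :: "complex^'n \<Rightarrow> real"
  assumes op: "open \<Omega>" and tw: "twice_diff_on \<Omega> v" and z: "z \<in> \<Omega>"
  shows "4 * d_hol i (d_antihol j (\<lambda>u. of_real (v u))) z =
    of_real (second_deriv v z (axis j 1) (axis i 1) + second_deriv v z (axis j \<i>) (axis i \<i>)) +
    \<i> * of_real (second_deriv v z (axis j \<i>) (axis i 1) - second_deriv v z (axis j 1) (axis i \<i>))"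
proof -
  let ?D = "\<lambda>a x. frechet_derivative v (at x) a"
  have a: "d_antihol j (\<lambda>u. of_real (v u)) x = (of_real (?D (axis j 1) x) + \<i> * of_real (?D (axis j \<i>) x)) / 2"
    if "x \<in> \<Omega>" for x
  proof -
    have "((\<lambda>u. of_real (v u) :: complex) has_derivative (\<lambda>h. of_real (frechet_derivative v (at x) h))) (at x)"
      by (rule has_derivative_of_real[OF D1_has_derivative[OF op tw that]])
    then show ?thesis unfolding d_antihol_def by (simp flip: frechet_derivative_at)
  qed
  have "((\<lambda>x. (of_real (?D (axis j 1) x) + \<i> * of_real (?D (axis j \<i>) x)) / 2) has_derivative
     (\<lambda>h. (of_real (second_deriv v z (axis j 1) h) + \<i> * of_real (second_deriv v z (axis j \<i>) h)) / 2)) (at z)"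
    by (intro bounded_linear.has_derivative[OF bounded_linear_divide] has_derivative_add has_derivative_mult_right has_derivative_of_real
        D2_has_derivative[OF op tw z])
  from has_derivative_transform_within_open[OF this op z, of "d_antihol j (\<lambda>u. of_real (v u))"]
  have "(d_antihol j (\<lambda>u. of_real (v u)) has_derivative
     (\<lambda>h. (of_real (second_deriv v z (axis j 1) h) + \<i> * of_real (second_deriv v z (axis j \<i>) h)) / 2)) (at z)"
    using a by simp
  from frechet_derivative_at[OF this]
  have "frechet_derivative (d_antihol j (\<lambda>u. of_real (v u))) (at z) =
     (\<lambda>h. (of_real (second_deriv v z (axis j 1) h) + \<i> * of_real (second_deriv v z (axis j \<i>) h)) / 2)" by simp
  then show ?thesis by (simp add: d_hol_def field_simps)
qed

text \<open>With every coordinate direction split into its parts along \<open>axis i 1\<close> and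
  \<open>axis i \<i>\<close>, the identity holds term by term in the pair of indices.\<close>

lemma levi_eq:
  fixes v :: "complex^'n \<Rightarrow> real"
  assumes op: "open \<Omega>" and tw: "twice_diff_on \<Omega> v" and z: "z \<in> \<Omega>"
  shows "levi v z \<xi> = second_deriv v z \<xi> \<xi> + second_deriv v z (\<i> *s \<xi>) (\<i> *s \<xi>)"
proof -
  let ?B = "second_deriv v z"
  have lr: "linear (?B a)" for a by (rule D2_linear[OF op tw z])
  have ll: "linear (\<lambda>a. ?B a b)" for b by (rule D2_linear_left[OF op tw z])
  have ax: "axis i c = Re c *\<^sub>R axis i 1 + Im c *\<^sub>R axis i \<i>" for i :: 'n and c
    by (auto simp: vec_eq_iff axis_def complex_eq_iff)
  have B: "?B (axis j a) (axis i b) = Re a * Re b * ?B (axis j 1) (axis i 1) + Re a * Im b * ?B (axis j 1) (axis i \<i>)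
     + Im a * Re b * ?B (axis j \<i>) (axis i 1) + Im a * Im b * ?B (axis j \<i>) (axis i \<i>)" for i j a b
  proof -
    have "?B (axis j a) (axis i b) = ?B (Re a *\<^sub>R axis j 1 + Im a *\<^sub>R axis j \<i>) (Re b *\<^sub>R axis i 1 + Im b *\<^sub>R axis i \<i>)"
      by (simp flip: ax)
    also have "\<dots> = Re a * ?B (axis j 1) (Re b *\<^sub>R axis i 1 + Im b *\<^sub>R axis i \<i>) +
                    Im a * ?B (axis j \<i>) (Re b *\<^sub>R axis i 1 + Im b *\<^sub>R axis i \<i>)"
      using linear_add[OF ll] linear_scale[OF ll] by simp
    also have "\<dots> = Re a * (Re b * ?B (axis j 1) (axis i 1) + Im b * ?B (axis j 1) (axis i \<i>)) +
                    Im a * (Re b * ?B (axis j \<i>) (axis i 1) + Im b * ?B (axis j \<i>) (axis i \<i>))"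
      using linear_add[OF lr] linear_scale[OF lr] by simp
    finally show ?thesis by (simp add: algebra_simps)
  qed
  have expand: "w = (\<Sum>i\<in>UNIV. axis i (w $ i))" for w :: "complex^'n"
    by (simp add: vec_eq_iff axis_def if_distrib cong: if_cong)
  have BB: "?B w w = (\<Sum>i\<in>UNIV. \<Sum>j\<in>UNIV. ?B (axis j (w $ j)) (axis i (w $ i)))" for w
  proof -
    have "?B w w = ?B w (\<Sum>i\<in>UNIV. axis i (w $ i))" by (simp flip: expand)
    also have "\<dots> = (\<Sum>i\<in>UNIV. ?B w (axis i (w $ i)))" by (rule linear_sum[OF lr])
    also have "\<dots> = (\<Sum>i\<in>UNIV. ?B (\<Sum>j\<in>UNIV. axis j (w $ j)) (axis i (w $ i)))" by (simp flip: expand)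
    also have "\<dots> = (\<Sum>i\<in>UNIV. \<Sum>j\<in>UNIV. ?B (axis j (w $ j)) (axis i (w $ i)))"
      by (intro sum.cong refl linear_sum[OF ll])
    finally show ?thesis .
  qed
  have "Re (4 * d_hol i (d_antihol j (\<lambda>u. of_real (v u))) z * \<xi> $ i * cnj (\<xi> $ j)) =
      ?B (axis j (\<xi> $ j)) (axis i (\<xi> $ i)) + ?B (axis j ((\<i> *s \<xi>) $ j)) (axis i ((\<i> *s \<xi>) $ i))" for i j
    unfolding d_hol_d_antihol[OF op tw z] B[where a = "\<xi> $ j" and b = "\<xi> $ i"]
      B[where a = "(\<i> *s \<xi>) $ j" and b = "(\<i> *s \<xi>) $ i"]
    by (simp add: algebra_simps)
  then show ?thesis
    by (simp only: levi_def BB[of \<xi>] BB[of "\<i> *s \<xi>"] Re_sum sum.distrib)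
qed

text \<open>The real inner products with \<open>\<xi>\<close> and \<open>\<i> *s \<xi>\<close> are
  the real and the imaginary part of the Hermitian product.\<close>

lemma inner_smult_sum:
  fixes x \<xi> :: "complex^'n"
  shows "(x \<bullet> \<xi>)\<^sup>2 + (x \<bullet> (\<i> *s \<xi>))\<^sup>2 = (cmod (\<Sum>k\<in>UNIV. x $ k * cnj (\<xi> $ k)))\<^sup>2"
proof -
  have "x \<bullet> \<xi> = Re (\<Sum>k\<in>UNIV. x $ k * cnj (\<xi> $ k))"
    by (simp add: inner_vec_def inner_complex_def)
  moreover have "x \<bullet> (\<i> *s \<xi>) = Im (\<Sum>k\<in>UNIV. x $ k * cnj (\<xi> $ k))"
    by (simp add: inner_vec_def inner_complex_def algebra_simps)
  ultimately show ?thesis by (simp add: cmod_power2)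
qed

lemma norm_smult_i: "norm (\<i> *s (\<xi> :: complex^'n)) = norm \<xi>"
  by (simp add: norm_vec_def norm_mult)

lemma barrier_derivatives:
  fixes z p w :: "'a::real_inner" and \<alpha> \<epsilon> :: real
  defines "b \<equiv> \<lambda>t. \<epsilon> * exp (- \<alpha> * (dist (z + t *\<^sub>R w) p)\<^sup>2)"
  shows "(b has_real_derivative b t * (- \<alpha> * (2 * ((z - p) \<bullet> w) + 2 * t * (norm w)\<^sup>2))) (at t)"
    and "((\<lambda>t. b t * (- \<alpha> * (2 * ((z - p) \<bullet> w) + 2 * t * (norm w)\<^sup>2))) has_real_derivative
       b 0 * (4 * \<alpha>\<^sup>2 * ((z - p) \<bullet> w)\<^sup>2 - 2 * \<alpha> * (norm w)\<^sup>2)) (at 0)"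
proof -
  have b: "b = (\<lambda>t. \<epsilon> * exp (- \<alpha> * ((norm (z - p))\<^sup>2 + 2 * t * ((z - p) \<bullet> w) + t\<^sup>2 * (norm w)\<^sup>2)))"
  proof -
    have "(dist (z + t *\<^sub>R w) p)\<^sup>2 = (norm (z - p))\<^sup>2 + 2 * t * ((z - p) \<bullet> w) + t\<^sup>2 * (norm w)\<^sup>2" for t
    proof -
      have "z + t *\<^sub>R w - p = (z - p) + t *\<^sub>R w" by simp
      then show ?thesis
        by (simp only: dist_norm power2_norm_eq_inner)
           (simp add: inner_add_left inner_add_right inner_commute power2_eq_square algebra_simps)
    qed
    then show ?thesis by (simp add: b_def)
  qed
  show *: "(b has_real_derivative b t * (- \<alpha> * (2 * ((z - p) \<bullet> w) + 2 * t * (norm w)\<^sup>2))) (at t)" for t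
    unfolding b by (auto intro!: derivative_eq_intros simp: algebra_simps)
  show "((\<lambda>t. b t * (- \<alpha> * (2 * ((z - p) \<bullet> w) + 2 * t * (norm w)\<^sup>2))) has_real_derivative
       b 0 * (4 * \<alpha>\<^sup>2 * ((z - p) \<bullet> w)\<^sup>2 - 2 * \<alpha> * (norm w)\<^sup>2)) (at 0)"
    by (rule derivative_eq_intros * refl)+ (simp add: algebra_simps power2_eq_square)
qed


text \<open>
  Along a complex line, \<open>ln f\<close> differs from \<open>v\<close> by the harmonic function \<open>ln (|H|\<^sup>2)\<close>, so
  only the Hessians of \<open>v\<close> and of the barrier enter the condition at a maximum.
\<close>

lemma levi_at_line_max:
  fixes f v :: "complex^'n \<Rightarrow> real" and \<xi> :: "complex^'n"
  assumes op: "open \<Omega>" and tw: "twice_diff_on \<Omega> v" and z: "z \<in> \<Omega>" and cf: "isCont f z" and fz: "f z > 0"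
    and r: "r > 0" and H: "H holomorphic_on (ball 0 r - {0})"
    and fH: "\<And>\<zeta>. \<zeta> \<in> ball 0 r - {0} \<Longrightarrow> f (z + \<zeta> *s \<xi>) = (cmod (H \<zeta>))\<^sup>2 * exp (v (z + \<zeta> *s \<xi>))"
    and max: "\<forall>\<^sub>F y in nhds z. f y * exp (\<epsilon> * exp (- \<alpha> * (dist y p)\<^sup>2)) \<le> f z * exp (\<epsilon> * exp (- \<alpha> * (dist z p)\<^sup>2))"
  shows "levi v z \<xi> + \<epsilon> * exp (- \<alpha> * (dist z p)\<^sup>2) *
      (4 * \<alpha>\<^sup>2 * (cmod (\<Sum>k\<in>UNIV. (z - p) $ k * cnj (\<xi> $ k)))\<^sup>2 - 4 * \<alpha> * (norm \<xi>)\<^sup>2) \<le> 0"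
proof -
  have cv: "isCont v z" using D1_has_derivative[OF op tw z] has_derivative_continuous by blast
  define c0 where "c0 = f z * exp (- v z)"
  have "c0 > 0" using fz by (simp add: c0_def)
  have "((\<lambda>\<zeta>. f (z + \<zeta> *s \<xi>) * exp (- v (z + \<zeta> *s \<xi>))) \<longlongrightarrow> c0) (at 0)"
    unfolding c0_def by (intro tendsto_intros isCont_tendsto_compose[OF cf tendsto_line] isCont_tendsto_compose[OF cv tendsto_line])
  moreover have "\<forall>\<^sub>F \<zeta> in at 0. f (z + \<zeta> *s \<xi>) * exp (- v (z + \<zeta> *s \<xi>)) = (cmod (H \<zeta>))\<^sup>2"
  proof -
    have "\<forall>\<^sub>F \<zeta> in at 0. \<zeta> \<in> ball 0 r - {0}"
      using r eventually_at_ball'[of r 0 UNIV] by (simp add: dist_commute)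
    then show ?thesis by eventually_elim (simp add: fH exp_minus)
  qed
  ultimately have limH: "((\<lambda>\<zeta>. (cmod (H \<zeta>))\<^sup>2) \<longlongrightarrow> c0) (at 0)"
    by (rule Lim_transform_eventually)
  \<comment> \<open>Continuity of \<open>f\<close> at \<open>z\<close> is all that is known there.
    It bounds \<open>H\<close> near 0, and so the isolated singularity of \<open>H\<close> is
    removable.\<close>
  have "\<forall>\<^sub>F \<zeta> in at 0. (cmod (H \<zeta>))\<^sup>2 < c0 + 1"
    using order_tendstoD(2)[OF limH, of "c0 + 1"] by simp
  then have "\<forall>\<^sub>F \<zeta> in at 0. cmod (H \<zeta>) \<le> sqrt (c0 + 1)"
    by eventually_elim (simp add: real_le_rsqrt)
  then obtain g where g: "g holomorphic_on ball 0 r" "\<And>\<zeta>. \<zeta> \<in> ball 0 r - {0} \<Longrightarrow> g \<zeta> = H \<zeta>"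
    using holomorphic_on_extend_bounded[OF H] r by auto
  have cg: "isCont g 0" using g(1) r
    by (metis centre_in_ball continuous_on_eq_continuous_at holomorphic_on_imp_continuous_on open_ball)
  have g0: "(cmod (g 0))\<^sup>2 = c0"
  proof -
    have "((\<lambda>\<zeta>. (cmod (g \<zeta>))\<^sup>2) \<longlongrightarrow> (cmod (g 0))\<^sup>2) (at 0)"
      using cg by (intro tendsto_intros) (simp add: isCont_def)
    moreover have "\<forall>\<^sub>F \<zeta> in at 0. (cmod (g \<zeta>))\<^sup>2 = (cmod (H \<zeta>))\<^sup>2"
      using r eventually_at_ball'[of r 0 UNIV] by (auto simp: dist_commute g(2) elim: eventually_mono)
    ultimately have "((\<lambda>\<zeta>. (cmod (H \<zeta>))\<^sup>2) \<longlongrightarrow> (cmod (g 0))\<^sup>2) (at 0)" by (rule Lim_transform_eventually)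
    then show ?thesis using limH tendsto_unique[OF trivial_limit_at] by blast
  qed
  have fg: "f (z + \<zeta> *s \<xi>) = (cmod (g \<zeta>))\<^sup>2 * exp (v (z + \<zeta> *s \<xi>))" if "\<zeta> \<in> ball 0 r" for \<zeta>
  proof (cases "\<zeta> = 0")
    case True
    then show ?thesis by (simp add: g0 c0_def exp_minus)
  qed (use that fH g(2) in simp)
  have "g 0 \<noteq> 0" using g0 \<open>c0 > 0\<close> by auto
  then obtain r1 where r1: "r1 > 0" "\<And>\<zeta>. \<zeta> \<in> ball 0 r1 \<Longrightarrow> g \<zeta> \<noteq> 0"
    using continuous_at_avoid[OF cg, of 0] by auto
  define r2 where "r2 = min r r1"
  have r2: "r2 > 0" "r2 \<le> r" "\<And>\<zeta>. \<zeta> \<in> ball 0 r2 \<Longrightarrow> g \<zeta> \<noteq> 0" using r r1 by (auto simp: r2_def)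
  have "g holomorphic_on ball 0 r2" by (rule holomorphic_on_subset[OF g(1)]) (use r2 in auto)
  \<comment> \<open>A zero-free holomorphic function on a disc has a logarithm, and the logarithm of
    its squared modulus is the harmonic function \<open>2 * Re (k \<zeta>)\<close>.\<close>
  then obtain k where k: "k holomorphic_on ball 0 r2" "\<And>\<zeta>. \<zeta> \<in> ball 0 r2 \<Longrightarrow> g \<zeta> = exp (k \<zeta>)"
    using contractible_imp_holomorphic_log[OF _ convex_imp_contractible[OF convex_ball]] r2(3) by metis
  define k' where "k' = deriv k"
  have k': "(k has_field_derivative k' \<zeta>) (at \<zeta>)" "(k' has_field_derivative deriv k' \<zeta>) (at \<zeta>)" if "\<zeta> \<in> ball 0 r2" for \<zeta>
    using k(1) that unfolding k'_def by (auto intro!: holomorphic_derivI holomorphic_deriv)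
  define \<Phi> where "\<Phi> = (\<lambda>y \<zeta>. 2 * Re (k \<zeta>) + v y + \<epsilon> * exp (- \<alpha> * (dist y p)\<^sup>2))"
  \<comment> \<open>The second derivative test on the real line of direction
    \<open>u *s \<xi>\<close>. It is used for \<open>u = 1\<close> and \<open>u = \<i>\<close>:
    there \<open>u\<^sup>2\<close> is 1 and -1, so the terms with \<open>deriv k' 0\<close> cancel
    in the sum. This is the harmonicity of \<open>Re k\<close>.\<close>
  have key: "2 * Re (deriv k' 0 * u\<^sup>2) + second_deriv v z (u *s \<xi>) (u *s \<xi>) +
       \<epsilon> * exp (- \<alpha> * (dist z p)\<^sup>2) * (4 * \<alpha>\<^sup>2 * ((z - p) \<bullet> (u *s \<xi>))\<^sup>2 - 2 * \<alpha> * (norm (u *s \<xi>))\<^sup>2) \<le> 0"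
    if u: "cmod u = 1" for u
  proof -
    define w where "w = u *s \<xi>"
    have zw: "z + (of_real t * u) *s \<xi> = z + t *\<^sub>R w" for t :: real
      by (simp add: w_def vec_eq_iff) (simp add: scaleR_conv_of_real)
    define \<phi> where "\<phi> = (\<lambda>t. 2 * Re (k (of_real t * u)) + v (z + t *\<^sub>R w) + \<epsilon> * exp (- \<alpha> * (dist (z + t *\<^sub>R w) p)\<^sup>2))"
    have zl: "((\<lambda>t. z + t *\<^sub>R w) \<longlongrightarrow> z) (nhds 0)"
      using tendsto_add[OF tendsto_const tendsto_scaleR[OF filterlim_ident tendsto_const], of z w 0] by simp
    have ev\<Omega>: "\<forall>\<^sub>F t in nhds 0. z + t *\<^sub>R w \<in> \<Omega>"
      using topological_tendstoD[OF zl op z] .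
    have evball: "\<forall>\<^sub>F t in nhds 0. of_real t * u \<in> ball 0 r2"
      unfolding eventually_nhds_metric using r2(1) u by (auto simp: norm_mult intro!: exI[of _ r2])
    have ul: "((\<lambda>t. of_real t * u) has_vector_derivative u) (at t)" for t
      using has_vector_derivative_mult_left[OF has_vector_derivative_of_real[OF DERIV_ident], where a = u] by simp
    have \<phi>1: "\<forall>\<^sub>F t in nhds 0. (\<phi> has_real_derivative
        2 * Re (k' (of_real t * u) * u) + frechet_derivative v (at (z + t *\<^sub>R w)) w +
        \<epsilon> * exp (- \<alpha> * (dist (z + t *\<^sub>R w) p)\<^sup>2) * (- \<alpha> * (2 * ((z - p) \<bullet> w) + 2 * t * (norm w)\<^sup>2))) (at t)"
      using ev\<Omega> evball
    proof eventually_elim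
      case (elim t)
      have "((\<lambda>t. k (of_real t * u)) has_vector_derivative u * k' (of_real t * u)) (at t)"
        using field_vector_diff_chain_at[OF ul k'(1)[OF elim(2)]] by (simp add: o_def)
      then have "((\<lambda>t. Re (k (of_real t * u))) has_real_derivative Re (u * k' (of_real t * u))) (at t)"
        unfolding has_real_derivative_iff_has_vector_derivative
        by (rule bounded_linear.has_vector_derivative[OF bounded_linear_Re])
      then show ?case unfolding \<phi>_def
        by (intro DERIV_add DERIV_cmult D1_line[OF op tw elim(1)] barrier_derivatives(1)) (simp add: mult.commute)
    qed
    have kd: "((\<lambda>t. Re (k' (of_real t * u) * u)) has_real_derivative Re (deriv k' 0 * u\<^sup>2)) (at 0)"
    proof -
      have "((\<lambda>t. k' (of_real t * u)) has_vector_derivative u * deriv k' 0) (at 0)"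
        using field_vector_diff_chain_at[OF ul, of k' "deriv k' 0" 0] k'(2)[of 0] r2 by (simp add: o_def)
      then have "((\<lambda>t. k' (of_real t * u) * u) has_vector_derivative u * deriv k' 0 * u) (at 0)"
        by (rule bounded_linear.has_vector_derivative[OF bounded_linear_mult_left])
      then have "((\<lambda>t. Re (k' (of_real t * u) * u)) has_real_derivative Re (u * deriv k' 0 * u)) (at 0)"
        unfolding has_real_derivative_iff_has_vector_derivative
        by (rule bounded_linear.has_vector_derivative[OF bounded_linear_Re])
      then show ?thesis by (simp add: power2_eq_square algebra_simps)
    qed
    have \<phi>2: "((\<lambda>t. 2 * Re (k' (of_real t * u) * u) + frechet_derivative v (at (z + t *\<^sub>R w)) w +
        \<epsilon> * exp (- \<alpha> * (dist (z + t *\<^sub>R w) p)\<^sup>2) * (- \<alpha> * (2 * ((z - p) \<bullet> w) + 2 * t * (norm w)\<^sup>2)))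
       has_real_derivative 2 * Re (deriv k' 0 * u\<^sup>2) + second_deriv v z w w +
         \<epsilon> * exp (- \<alpha> * (dist (z + 0 *\<^sub>R w) p)\<^sup>2) * (4 * \<alpha>\<^sup>2 * ((z - p) \<bullet> w)\<^sup>2 - 2 * \<alpha> * (norm w)\<^sup>2)) (at 0)"
      by (intro DERIV_add DERIV_cmult D2_line[OF op tw z] barrier_derivatives(2) kd)
    have fexp: "f (z + t *\<^sub>R w) * exp (\<epsilon> * exp (- \<alpha> * (dist (z + t *\<^sub>R w) p)\<^sup>2)) = exp (\<phi> t)"
      if t: "of_real t * u \<in> ball 0 r2" for t
    proof -
      have "f (z + t *\<^sub>R w) = (cmod (exp (k (of_real t * u))))\<^sup>2 * exp (v (z + t *\<^sub>R w))"
        using fg[of "of_real t * u"] k(2)[OF t] t r2 zw[of t] by (simp add: subset_iff)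
      also have "(cmod (exp (k (of_real t * u))))\<^sup>2 = exp (2 * Re (k (of_real t * u)))"
        by (simp add: power2_eq_square flip: exp_add)
      finally show ?thesis by (simp add: \<phi>_def flip: exp_add)
    qed
    have "\<forall>\<^sub>F t in nhds 0. \<phi> t \<le> \<phi> 0"
    proof -
      have "\<forall>\<^sub>F t in nhds 0. f (z + t *\<^sub>R w) * exp (\<epsilon> * exp (- \<alpha> * (dist (z + t *\<^sub>R w) p)\<^sup>2))
         \<le> f z * exp (\<epsilon> * exp (- \<alpha> * (dist z p)\<^sup>2))"
        using eventually_compose_filterlim[OF max zl] .
      then show ?thesis using evball
      proof eventually_elim
        case (elim t)
        then show ?case using fexp[of t] fexp[of 0] r2(1) by simp
      qed
    qed
    from second_derivative_local_max[OF \<phi>1 \<phi>2 this] show ?thesis by (simp add: w_def)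
  qed
  let ?E = "\<epsilon> * exp (- \<alpha> * (dist z p)\<^sup>2)"
  let ?B = "\<lambda>w. ?E * (4 * \<alpha>\<^sup>2 * ((z - p) \<bullet> w)\<^sup>2 - 2 * \<alpha> * (norm \<xi>)\<^sup>2)"
  have "2 * Re (deriv k' 0) + second_deriv v z \<xi> \<xi> + ?B \<xi> \<le> 0"
    using key[of 1] by simp
  moreover have "- 2 * Re (deriv k' 0) + second_deriv v z (\<i> *s \<xi>) (\<i> *s \<xi>) + ?B (\<i> *s \<xi>) \<le> 0"
    using key[of \<i>] by (simp add: norm_smult_i)
  moreover have "?B \<xi> + ?B (\<i> *s \<xi>) = ?E *
      (4 * \<alpha>\<^sup>2 * (cmod (\<Sum>k\<in>UNIV. (z - p) $ k * cnj (\<xi> $ k)))\<^sup>2 - 4 * \<alpha> * (norm \<xi>)\<^sup>2)"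
    unfolding inner_smult_sum[symmetric] by (simp add: algebra_simps)
  ultimately show ?thesis unfolding levi_eq[OF op tw z] by linarith
qed

section \<open>Scalar-flat metrics and the maximum principle\<close>

lemma hermitian_pos_def_2:
  fixes G :: "complex^2^2"
  assumes "hermitian_pos_def G"
  shows "cnj (G $ 1 $ 1) = G $ 1 $ 1" "cnj (G $ 2 $ 2) = G $ 2 $ 2" "cnj (G $ 1 $ 2) = G $ 2 $ 1"
    and "Re (G $ 2 $ 2) > 0" "Re (det G) > 0" "det G = of_real (Re (det G))"
proof -
  have h: "\<And>i j. G $ j $ i = cnj (G $ i $ j)"
    and pos: "\<And>v. v \<noteq> 0 \<Longrightarrow> Re (\<Sum>i\<in>UNIV. \<Sum>j\<in>UNIV. G $ i $ j * v $ i * cnj (v $ j)) > 0"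
    using assms unfolding hermitian_pos_def_def by blast+
  show 1: "cnj (G $ 1 $ 1) = G $ 1 $ 1" "cnj (G $ 2 $ 2) = G $ 2 $ 2" "cnj (G $ 1 $ 2) = G $ 2 $ 1"
    by (rule h[symmetric])+
  have 2: "Im (G $ 1 $ 1) = 0" "Im (G $ 2 $ 2) = 0"
    using 1(1,2) by (simp_all add: complex_eq_iff)
  have "axis 2 1 \<noteq> (0 :: complex^2)" by (simp add: axis_eq_0_iff)
  from pos[OF this] show p22: "Re (G $ 2 $ 2) > 0" by (simp add: sum_2 axis_def)
  have "cnj (G $ 2 $ 1) = G $ 1 $ 2" by (rule h[symmetric])
  then have cdet: "cnj (det G) = det G" using 1 by (simp add: det_2 mult.commute)
  then have "Im (det G) = 0" by (simp add: complex_eq_iff)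
  then show rdet: "det G = of_real (Re (det G))" by (simp add: complex_eq_iff)
  \<comment> \<open>On this vector the form takes the value \<open>G $ 2 $ 2 * det G\<close>. The
    same vector returns as \<open>\<eta>\<close> when the square is completed in the trace.\<close>
  define v :: "complex^2" where "v = vector [G $ 2 $ 2, - (G $ 1 $ 2)]"
  have "v $ 1 \<noteq> 0" using p22 by (auto simp: v_def)
  then have "v \<noteq> 0" by auto
  have "(\<Sum>i\<in>UNIV. \<Sum>j\<in>UNIV. G $ i $ j * v $ i * cnj (v $ j)) = G $ 2 $ 2 * det G"
    using 1 by (simp add: sum_2 v_def det_2 algebra_simps)
  then have "Re (G $ 2 $ 2 * det G) > 0" using pos[OF \<open>v \<noteq> 0\<close>] by simp
  then have "Re (G $ 2 $ 2) * Re (det G) > 0" using 2 by simp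
  then show "Re (det G) > 0" using p22 by (simp add: zero_less_mult_iff)
qed

lemma trace_matrix_inv_2:
  fixes G R :: "complex^2^2"
  assumes "det G \<noteq> 0"
  shows "det G * trace (matrix_inv G ** R) =
    G $ 2 $ 2 * R $ 1 $ 1 - G $ 1 $ 2 * R $ 2 $ 1 - G $ 2 $ 1 * R $ 1 $ 2 + G $ 1 $ 1 * R $ 2 $ 2"
proof -
  define N where "N = matrix_inv G"
  have "\<exists>A. G ** A = mat 1 \<and> A ** G = mat 1"
    using assms unfolding invertible_det_nz[symmetric] invertible_def .
  then have "N ** G = mat 1" unfolding N_def matrix_inv_def by (rule someI_ex[THEN conjunct2])
  then have "(N ** G) $ i $ j = (if i = j then 1 else 0)" for i j by (simp add: mat_def)
  from this[of 1 1] this[of 1 2] this[of 2 1] this[of 2 2]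
  have e: "N $ 1 $ 1 * G $ 1 $ 1 + N $ 1 $ 2 * G $ 2 $ 1 = 1" "N $ 1 $ 1 * G $ 1 $ 2 + N $ 1 $ 2 * G $ 2 $ 2 = 0"
    "N $ 2 $ 1 * G $ 1 $ 1 + N $ 2 $ 2 * G $ 2 $ 1 = 0" "N $ 2 $ 1 * G $ 1 $ 2 + N $ 2 $ 2 * G $ 2 $ 2 = 1"
    by (simp_all add: matrix_matrix_mult_def sum_2)
  \<comment> \<open>Cramer's rule: the four scalar equations of \<open>N ** G = mat 1\<close>
    identify \<open>det G\<close> times \<open>N\<close> with the adjugate.\<close>
  have "det G * N $ 1 $ 1 = G $ 2 $ 2" "det G * N $ 1 $ 2 = - G $ 1 $ 2"
    "det G * N $ 2 $ 1 = - G $ 2 $ 1" "det G * N $ 2 $ 2 = G $ 1 $ 1"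
    using e unfolding det_2 by algebra+
  moreover have "det G * trace (N ** R) = (det G * N $ 1 $ 1) * R $ 1 $ 1 + (det G * N $ 1 $ 2) * R $ 2 $ 1 +
      (det G * N $ 2 $ 1) * R $ 1 $ 2 + (det G * N $ 2 $ 2) * R $ 2 $ 2"
    by (simp add: trace_def matrix_matrix_mult_def sum_2 algebra_simps)
  ultimately show ?thesis by (simp add: N_def)
qed

text \<open>
  Completing the square writes \<open>tr (G\<^sup>-\<^sup>1 H)\<close>, up to a positive factor, as a sum of two values
  of the Hermitian form of \<open>H\<close>.
\<close>

lemma scalar_flat_levi:
  fixes G :: "complex^2 \<Rightarrow> complex^2^2"
  assumes G: "hermitian_pos_def (G z)" and flat: "chern_scalar G z = 0"
  defines "v \<equiv> \<lambda>u. ln (Re (det (G u)))"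
  shows "levi v z (vector [G z $ 2 $ 2, - (G z $ 1 $ 2)]) + Re (det (G z)) * levi v z (axis 2 1) = 0"
proof -
  define H where "H = (\<lambda>i j. d_hol i (d_antihol j (\<lambda>u. of_real (v u))) z)"
  note g = hermitian_pos_def_2[OF G]
  have nz: "det (G z) \<noteq> 0" using g(5) by auto
  have R: "chern_ricci G z $ i $ j = - H i j" for i j by (simp add: chern_ricci_def H_def v_def)
  have "0 = det (G z) * trace (matrix_inv (G z) ** chern_ricci G z)" using flat by (simp add: chern_scalar_def)
  then have "G z $ 2 $ 2 * H 1 1 - G z $ 1 $ 2 * H 2 1 - G z $ 2 $ 1 * H 1 2 + G z $ 1 $ 1 * H 2 2 = 0"
    unfolding trace_matrix_inv_2[OF nz] R by (simp add: algebra_simps)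
  \<comment> \<open>The 4 matches the normalisation of \<open>levi\<close>. The factor
    \<open>G z $ 2 $ 2\<close> completes the square: it turns the trace against the adjugate into
    the form on the vector \<open>\<eta>\<close> plus \<open>det (G z)\<close> times the form on
    \<open>axis 2 1\<close>.\<close>
  then have "4 * G z $ 2 $ 2 * (G z $ 2 $ 2 * H 1 1 - G z $ 1 $ 2 * H 2 1 - G z $ 2 $ 1 * H 1 2 + G z $ 1 $ 1 * H 2 2) = 0"
    by simp
  also have "4 * G z $ 2 $ 2 * (G z $ 2 $ 2 * H 1 1 - G z $ 1 $ 2 * H 2 1 - G z $ 2 $ 1 * H 1 2 + G z $ 1 $ 1 * H 2 2) =
     (4 * H 1 1 * G z $ 2 $ 2 * G z $ 2 $ 2 - 4 * H 1 2 * G z $ 2 $ 2 * G z $ 2 $ 1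
      - 4 * H 2 1 * G z $ 1 $ 2 * G z $ 2 $ 2 + 4 * H 2 2 * G z $ 1 $ 2 * G z $ 2 $ 1) + det (G z) * (4 * H 2 2)"
    by (simp add: det_2 algebra_simps)
  finally have "Re ((4 * H 1 1 * G z $ 2 $ 2 * G z $ 2 $ 2 - 4 * H 1 2 * G z $ 2 $ 2 * G z $ 2 $ 1
      - 4 * H 2 1 * G z $ 1 $ 2 * G z $ 2 $ 2 + 4 * H 2 2 * G z $ 1 $ 2 * G z $ 2 $ 1) +
      of_real (Re (det (G z))) * (4 * H 2 2)) = 0"
    using g(6) by simp
  moreover have levi: "levi v z \<xi> = Re (\<Sum>i\<in>UNIV. \<Sum>j\<in>UNIV. 4 * H i j * \<xi> $ i * cnj (\<xi> $ j))" for \<xi>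
    by (simp add: levi_def H_def)
  have "levi v z (vector [G z $ 2 $ 2, - (G z $ 1 $ 2)]) =
     Re (4 * H 1 1 * G z $ 2 $ 2 * G z $ 2 $ 2 - 4 * H 1 2 * G z $ 2 $ 2 * G z $ 2 $ 1
      - 4 * H 2 1 * G z $ 1 $ 2 * G z $ 2 $ 2 + 4 * H 2 2 * G z $ 1 $ 2 * G z $ 2 $ 1)"
    unfolding levi by (rule arg_cong[where f = Re]) (simp add: sum_2 g(1-3))
  moreover have "levi v z (axis 2 1) = Re (4 * H 2 2)"
    unfolding levi by (rule arg_cong[where f = Re]) (simp add: sum_2 axis_def)
  ultimately show ?thesis by simp
qed

text \<open>The derivative of \<open>det G\<close> is an explicit polynomial \<open>D\<rho>\<close>
  in the entries of \<open>G\<close> and of its first derivative, so a second differentiation only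
  meets functions known to be differentiable.\<close>

lemma twice_diff_ln_det:
  fixes G :: "complex^2 \<Rightarrow> complex^2^2"
  assumes op: "open \<Omega>" and sm: "smooth_on \<Omega> G" and pd: "\<And>z. z \<in> \<Omega> \<Longrightarrow> hermitian_pos_def (G z)"
  shows "twice_diff_on \<Omega> (\<lambda>u. ln (Re (det (G u))))"
proof -
  define D where "D = (\<lambda>a x. frechet_derivative G (at x) a)"
  have "Ck_on 2 \<Omega> G" using sm by (simp add: smooth_on_def)
  then have d1: "\<And>z. z \<in> \<Omega> \<Longrightarrow> G differentiable at z" and d2: "\<And>z a. z \<in> \<Omega> \<Longrightarrow> D a differentiable at z"
    by (auto simp: numeral_2_eq_2 D_def)
  have comp: "(\<lambda>x. F x $ i $ j) differentiable at z" if F: "F differentiable at z" for F :: "complex^2 \<Rightarrow> complex^2^2" and i j z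
  proof -
    obtain L where "(F has_derivative L) (at z)" using F unfolding differentiable_def by blast
    then have "((\<lambda>x. F x $ i $ j) has_derivative (\<lambda>h. L h $ i $ j)) (at z)"
      by (intro bounded_linear.has_derivative[OF bounded_linear_vec_nth])
    then show ?thesis unfolding differentiable_def by blast
  qed
  define \<rho> where "\<rho> = (\<lambda>x. Re (det (G x)))"
  define D\<rho> where "D\<rho> = (\<lambda>a x. Re (G x $ 1 $ 1 * D a x $ 2 $ 2 + D a x $ 1 $ 1 * G x $ 2 $ 2 -
     (G x $ 1 $ 2 * D a x $ 2 $ 1 + D a x $ 1 $ 2 * G x $ 2 $ 1)))"
  have \<rho>pos: "\<rho> x > 0" if "x \<in> \<Omega>" for x using hermitian_pos_def_2(5)[OF pd[OF that]] by (simp add: \<rho>_def)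
  have \<rho>d: "(\<rho> has_derivative (\<lambda>a. D\<rho> a x)) (at x)" if x: "x \<in> \<Omega>" for x
  proof -
    have "(G has_derivative (\<lambda>a. D a x)) (at x)"
      using d1[OF x] frechet_derivative_works by (auto simp: D_def)
    then have c: "((\<lambda>x. G x $ i $ j) has_derivative (\<lambda>a. D a x $ i $ j)) (at x)" for i j
      by (intro bounded_linear.has_derivative[OF bounded_linear_vec_nth])
    show ?thesis unfolding \<rho>_def det_2 D\<rho>_def
      by (intro has_derivative_Re has_derivative_diff has_derivative_mult c)
  qed
  have vd: "((\<lambda>x. ln (\<rho> x)) has_derivative (\<lambda>a. D\<rho> a x / \<rho> x)) (at x)" if x: "x \<in> \<Omega>" for x
    using has_derivative_ln[OF \<rho>pos[OF x] \<rho>d[OF x]] by (simp add: divide_inverse)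
  have "(\<lambda>x. frechet_derivative (\<lambda>x. ln (\<rho> x)) (at x) a) differentiable at z" if z: "z \<in> \<Omega>" for a z
  proof -
    have Red: "(\<lambda>x. Re (F x)) differentiable at z" if "F differentiable at z" for F :: "complex^2 \<Rightarrow> complex"
      using that unfolding differentiable_def by (blast intro: has_derivative_Re)
    have "(\<lambda>x. D\<rho> a x / \<rho> x) differentiable at z"
    proof (rule differentiable_divide)
      show "D\<rho> a differentiable at z" unfolding D\<rho>_def
        by (intro Red differentiable_diff differentiable_add differentiable_mult comp d1 d2 z)
      show "\<rho> differentiable at z" using \<rho>d[OF z] unfolding differentiable_def by blast
      show "\<rho> z \<noteq> 0" using \<rho>pos[OF z] by simp
    qed
    then obtain L where L: "((\<lambda>x. D\<rho> a x / \<rho> x) has_derivative L) (at z)" unfolding differentiable_def by blast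
    have "((\<lambda>x. frechet_derivative (\<lambda>x. ln (\<rho> x)) (at x) a) has_derivative L) (at z)"
      by (rule has_derivative_transform_within_open[OF L op z]) (simp add: frechet_derivative_at[OF vd, symmetric])
    then show ?thesis unfolding differentiable_def by blast
  qed
  moreover have "(\<lambda>x. ln (\<rho> x)) differentiable at z" if "z \<in> \<Omega>" for z
    using vd[OF that] unfolding differentiable_def by blast
  ultimately show ?thesis unfolding twice_diff_on_def \<rho>_def by blast
qed

text \<open>Up to a positive factor, the trace of the complex Hessian with respect to
  \<open>G\<close> is the operator of the strong maximum principle with \<open>\<eta>\<close> and
  \<open>d\<close> taken from the completed square. The hypothesis \<open>lines\<close> gives the
  form of \<open>f\<close> on punctured lines only, for a dense set of directions at each point, and
  this covers points on an exceptional curve.\<close>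

lemma scalar_flat_max_principle:
  fixes f :: "complex^2 \<Rightarrow> real" and G :: "complex^2 \<Rightarrow> complex^2^2"
  assumes op: "open \<Omega>" and sm: "smooth_on \<Omega> G" and pd: "\<And>z. z \<in> \<Omega> \<Longrightarrow> hermitian_pos_def (G z)"
    and flat: "\<And>z. z \<in> \<Omega> \<Longrightarrow> chern_scalar G z = 0"
    and cf: "continuous_on \<Omega> f" and le: "\<And>z. z \<in> \<Omega> \<Longrightarrow> f z \<le> M" and "0 < M"
    and z0: "z0 \<in> \<Omega>" "f z0 = M"
    and lines: "\<And>z. z \<in> \<Omega> \<Longrightarrow> \<exists>X. closure X = UNIV \<and> (\<forall>\<xi>\<in>X. \<exists>r>0. \<exists>H. H holomorphic_on (ball 0 r - {0}) \<and>
      (\<forall>\<zeta>\<in>ball 0 r - {0}. f (z + \<zeta> *s \<xi>) = (cmod (H \<zeta>))\<^sup>2 * Re (det (G (z + \<zeta> *s \<xi>)))))"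
  shows "\<forall>\<^sub>F z in nhds z0. f z = M"
proof -
  define v where "v = (\<lambda>u. ln (Re (det (G u))))"
  have tw: "twice_diff_on \<Omega> v" unfolding v_def by (rule twice_diff_ln_det[OF op sm pd])
  define \<eta> :: "complex^2 \<Rightarrow> complex^2" where "\<eta> = (\<lambda>z. vector [G z $ 2 $ 2, - (G z $ 1 $ 2)])"
  define d where "d = (\<lambda>z. Re (det (G z)))"
  have dpos: "d z > 0" if "z \<in> \<Omega>" for z using hermitian_pos_def_2(5)[OF pd[OF that]] by (simp add: d_def)
  have "Ck_on 0 \<Omega> G" using sm unfolding smooth_on_def by blast
  then have cG: "continuous_on \<Omega> G" by simp
  have \<eta>eq: "\<eta> z = (\<chi> i. if i = 1 then G z $ 2 $ 2 else - (G z $ 1 $ 2))" for z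
    by (simp add: \<eta>_def vec_eq_iff forall_2)
  have c\<eta>: "continuous_on \<Omega> \<eta>"
  proof -
    have "continuous_on \<Omega> (\<lambda>z. if i = 1 then G z $ 2 $ 2 else - (G z $ 1 $ 2))" for i :: 2
      by (cases "i = 1") (auto intro!: continuous_intros cG)
    then show ?thesis unfolding \<eta>eq[abs_def] by (intro continuous_intros)
  qed
  have cd: "continuous_on \<Omega> d" unfolding d_def det_2 by (intro continuous_intros cG)
  have \<eta>1: "\<eta> z $ 1 \<noteq> 0" if "z \<in> \<Omega>" for z
    using hermitian_pos_def_2(4)[OF pd[OF that]] by (auto simp: \<eta>_def)
  show ?thesis
  proof (rule strong_maximum_principle[OF op cf le \<open>0 < M\<close> z0 c\<eta> \<eta>1 cd dpos])
    fix z p \<alpha> \<epsilon> assume z: "z \<in> \<Omega>" and fz: "f z > 0" and \<epsilon>: "0 < \<epsilon>" and \<alpha>: "0 < \<alpha>"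
      and max: "\<forall>\<^sub>F y in nhds z. f y * exp (\<epsilon> * exp (- \<alpha> * (dist y p)\<^sup>2)) \<le> f z * exp (\<epsilon> * exp (- \<alpha> * (dist z p)\<^sup>2))"
    obtain X where X: "closure X = UNIV" "\<And>\<xi>. \<xi> \<in> X \<Longrightarrow> \<exists>r>0. \<exists>H. H holomorphic_on (ball 0 r - {0}) \<and>
      (\<forall>\<zeta>\<in>ball 0 r - {0}. f (z + \<zeta> *s \<xi>) = (cmod (H \<zeta>))\<^sup>2 * Re (det (G (z + \<zeta> *s \<xi>))))"
      using lines[OF z] by blast
    define \<Psi> where "\<Psi> = (\<lambda>\<xi>. levi v z \<xi> + \<epsilon> * exp (- \<alpha> * (dist z p)\<^sup>2) *
      (4 * \<alpha>\<^sup>2 * (cmod (\<Sum>k\<in>UNIV. (z - p) $ k * cnj (\<xi> $ k)))\<^sup>2 - 4 * \<alpha> * (norm \<xi>)\<^sup>2))"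
    have "\<Psi> \<xi> \<le> 0" if \<xi>: "\<xi> \<in> X" for \<xi>
    proof -
      obtain r H where r: "r > 0" "H holomorphic_on (ball 0 r - {0})"
        "\<And>\<zeta>. \<zeta> \<in> ball 0 r - {0} \<Longrightarrow> f (z + \<zeta> *s \<xi>) = (cmod (H \<zeta>))\<^sup>2 * Re (det (G (z + \<zeta> *s \<xi>)))"
        using X(2)[OF \<xi>] by blast
      have "continuous_on UNIV (\<lambda>\<zeta>. z + \<zeta> *s \<xi>)" by (intro continuous_intros)
      then have "open ((\<lambda>\<zeta>. z + \<zeta> *s \<xi>) -` \<Omega>)" using op by (simp add: continuous_on_open_vimage)
      moreover have "0 \<in> (\<lambda>\<zeta>. z + \<zeta> *s \<xi>) -` \<Omega>" using z by simp
      ultimately obtain r' where r': "r' > 0" "ball 0 r' \<subseteq> (\<lambda>\<zeta>. z + \<zeta> *s \<xi>) -` \<Omega>" using openE by blast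
      show ?thesis unfolding \<Psi>_def
      proof (rule levi_at_line_max[where \<Omega> = \<Omega> and v = v and z = z and f = f and r = "min r r'" and H = H])
        show "isCont f z" using cf z op by (simp add: continuous_on_eq_continuous_at)
        show "min r r' > 0" using r r' by simp
        show "H holomorphic_on ball 0 (min r r') - {0}" by (rule holomorphic_on_subset[OF r(2)]) auto
        fix \<zeta> :: complex assume \<zeta>: "\<zeta> \<in> ball 0 (min r r') - {0}"
        then have "z + \<zeta> *s \<xi> \<in> \<Omega>" using r'(2) by auto
        then have "exp (v (z + \<zeta> *s \<xi>)) = Re (det (G (z + \<zeta> *s \<xi>)))"
          using dpos by (simp add: v_def d_def)
        then show "f (z + \<zeta> *s \<xi>) = (cmod (H \<zeta>))\<^sup>2 * exp (v (z + \<zeta> *s \<xi>))" using r(3) \<zeta> by simp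
      qed (fact op tw z fz max)+
    qed
    \<comment> \<open>\<open>\<Psi>\<close> is a polynomial in the real coordinates of
      \<open>\<xi>\<close>, so its sign on the dense set \<open>X\<close> holds in all directions.
      In particular it holds for \<open>\<eta> z\<close> and \<open>axis 2 1\<close>, which need not
      be generic.\<close>
    moreover have "continuous_on (closure X) \<Psi>"
      unfolding \<Psi>_def levi_def by (intro continuous_intros)
    ultimately have \<Psi>: "\<Psi> \<xi> \<le> 0" for \<xi>
      using continuous_le_on_closure[of X \<Psi> \<xi> 0] X(1) by auto
    define c where "c = 4 * \<alpha> * (\<epsilon> * exp (- \<alpha> * (dist z p)\<^sup>2))"
    have c: "c > 0" using \<alpha> \<epsilon> by (simp add: c_def)
    have flat': "levi v z (\<eta> z) + d z * levi v z (axis 2 1) = 0"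
      using scalar_flat_levi[OF pd[OF z] flat[OF z]] by (simp add: v_def \<eta>_def d_def)
    \<comment> \<open>In this combination the Levi terms cancel by flatness. What remains is the
      contribution of the barrier, which is \<open>c\<close> times the inequality demanded by
      \<open>visc\<close>.\<close>
    have "\<Psi> (\<eta> z) + d z * \<Psi> (axis 2 1) \<le> 0"
      using \<Psi>[of "\<eta> z"] \<Psi>[of "axis 2 1"] dpos[OF z] by (smt (verit) mult_nonneg_nonpos)
    moreover have "\<Psi> (\<eta> z) + d z * \<Psi> (axis 2 1) = levi v z (\<eta> z) + d z * levi v z (axis 2 1) +
      c * (\<alpha> * ((cmod (\<Sum>k\<in>UNIV. (z - p) $ k * cnj (\<eta> z $ k)))\<^sup>2 + d z * (cmod ((z - p) $ 2))\<^sup>2) - ((norm (\<eta> z))\<^sup>2 + d z))"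
    proof -
      have a: "(\<Sum>k\<in>UNIV. (z - p) $ k * cnj (axis 2 1 $ k)) = (z - p) $ 2" by (simp add: sum_2 axis_def)
      have b: "norm (axis 2 1 :: complex^2) = 1" using norm_axis_smult[of 1 2] by simp
      show ?thesis unfolding \<Psi>_def a b c_def by (simp add: algebra_simps power2_eq_square)
    qed
    ultimately have "c * (\<alpha> * ((cmod (\<Sum>k\<in>UNIV. (z - p) $ k * cnj (\<eta> z $ k)))\<^sup>2 + d z * (cmod ((z - p) $ 2))\<^sup>2) - ((norm (\<eta> z))\<^sup>2 + d z)) \<le> 0"
      using flat' by linarith
    then show "\<alpha> * ((cmod (\<Sum>k\<in>UNIV. (z - p) $ k * cnj (\<eta> z $ k)))\<^sup>2 + d z * (cmod ((z - p) $ 2))\<^sup>2)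
         \<le> (norm (\<eta> z))\<^sup>2 + d z"
      using c by (simp add: mult_le_0_iff)
  qed
qed

section \<open>Lifts to homogeneous coordinates\<close>

text \<open>
  For a lift \<open>\<Lambda>\<close> of a map to the projective plane, \<open>cubic a (\<Lambda> z) / lift_det \<Lambda> z\<close> is the coefficient
  of the section of the anticanonical bundle given by the cubic form: the numerator and the
  denominator are both homogeneous of degree 3 under rescaling of \<open>\<Lambda>\<close>.
\<close>

definition lift_det :: "(complex^2 \<Rightarrow> complex^3) \<Rightarrow> complex^2 \<Rightarrow> complex" where
  "lift_det \<Lambda> z = det (\<chi> i k. if k = 1 then \<Lambda> z $ i else if k = 2 then cderiv \<Lambda> z $ i $ 1 else cderiv \<Lambda> z $ i $ 2)"

lemma lift_det_expand:
  "lift_det \<Lambda> z =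
    \<Lambda> z $ 1 * (cderiv \<Lambda> z $ 2 $ 1 * cderiv \<Lambda> z $ 3 $ 2 - cderiv \<Lambda> z $ 3 $ 1 * cderiv \<Lambda> z $ 2 $ 2) -
    \<Lambda> z $ 2 * (cderiv \<Lambda> z $ 1 $ 1 * cderiv \<Lambda> z $ 3 $ 2 - cderiv \<Lambda> z $ 3 $ 1 * cderiv \<Lambda> z $ 1 $ 2) +
    \<Lambda> z $ 3 * (cderiv \<Lambda> z $ 1 $ 1 * cderiv \<Lambda> z $ 2 $ 2 - cderiv \<Lambda> z $ 2 $ 1 * cderiv \<Lambda> z $ 1 $ 2)"
  unfolding lift_det_def det_3 by (simp add: algebra_simps)

lemma lift_det_cong:
  assumes "\<forall>\<^sub>F x in nhds z. \<Lambda> x = \<Lambda>' x"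
  shows "lift_det \<Lambda> z = lift_det \<Lambda>' z"
  using cderiv_cong[OF assms] eventually_nhds_x_imp_x[OF assms] by (simp add: lift_det_expand)

lemma lift_det_compose:
  assumes "hol_map_at \<theta> z" "hol_map_at \<Lambda> (\<theta> z)"
  shows "lift_det (\<Lambda> \<circ> \<theta>) z = lift_det \<Lambda> (\<theta> z) * det (cderiv \<theta> z)"
  unfolding lift_det_expand cderiv_compose[OF assms] det_2
  by (simp add: matrix_matrix_mult_def sum_2 algebra_simps)

lemma cpartial_mult:
  fixes f h :: "complex^'n \<Rightarrow> complex"
  assumes "hol_at f z" "hol_at h z"
  shows "cpartial i (\<lambda>x. f x * h x) z = f z * cpartial i h z + cpartial i f z * h z"
proof -
  have "((\<lambda>x. f x * h x) has_derivative (\<lambda>v. f z * (\<Sum>i\<in>UNIV. cpartial i h z * v $ i) +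
      (\<Sum>i\<in>UNIV. cpartial i f z * v $ i) * h z)) (at z)"
    by (intro has_derivative_mult hol_at_has_derivative assms)
  from frechet_derivative_at[OF this, symmetric] show ?thesis
    unfolding cpartial_def[of i "\<lambda>x. f x * h x"] by (simp add: axis_def if_distrib cong: if_cong)
qed

lemma hol_map_at_smult:
  assumes "hol_at c z" "hol_map_at \<Lambda> z"
  shows "hol_map_at (\<lambda>x. c x *s \<Lambda> x) z"
  using assms by (auto simp: hol_map_at_def)

text \<open>Differentiating the factor \<open>c\<close> adds multiples of the column
  \<open>\<Lambda> z\<close> to the other two columns, which does not affect the determinant. Each
  of the three columns contributes one factor \<open>c z\<close>.\<close>

lemma lift_det_smult:
  assumes "hol_at c z" "hol_map_at \<Lambda> z"
  shows "lift_det (\<lambda>x. c x *s \<Lambda> x) z = c z ^ 3 * lift_det \<Lambda> z"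
proof -
  have "cderiv (\<lambda>x. c x *s \<Lambda> x) z $ k $ j = c z * cderiv \<Lambda> z $ k $ j + cpartial j c z * \<Lambda> z $ k" for k j
    using assms unfolding cderiv_component[OF hol_map_at_smult[OF assms]] cderiv_component[OF assms(2)]
    by (simp add: hol_map_at_def cpartial_mult)
  then show ?thesis by (simp add: lift_det_expand algebra_simps power3_eq_cube)
qed

text \<open>The cyclic order \<open>i\<close>, \<open>i + 1\<close>, \<open>i + 2\<close> is an even
  permutation of 1, 2, 3, so the sign is the same in all three charts.\<close>

lemma lift_det_affine_point: "lift_det (affine_point i) u = 1"
proof -
  define A :: "complex^2^3" where "A = (\<chi> k j. if k = i then 0 else if k = i + 1 then (if j = 1 then 1 else 0) else (if j = 2 then 1 else 0))"
  have "affine_point i = (\<lambda>u. affine_point i 0 + A *v u)"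
    by (auto simp: fun_eq_iff vec_eq_iff affine_point_def A_def matrix_vector_mult_def sum_2)
  moreover have "((\<lambda>u. affine_point i 0 + A *v u) has_derivative (\<lambda>v. A *v v)) (at u)"
  proof -
    have "linear (\<lambda>u. A *v u)"
      by (rule linearI) (auto simp: vec_eq_iff matrix_vector_mult_def sum_2 algebra_simps)
    then have "bounded_linear (\<lambda>u. A *v u)" by (simp add: linear_conv_bounded_linear)
    then show ?thesis by (auto intro!: derivative_eq_intros bounded_linear_imp_has_derivative)
  qed
  ultimately have "cderiv (affine_point i) u = A" using hol_map_at_unique by metis
  moreover have "\<forall>i::3. i = 1 \<or> i = 2 \<or> i = 3" by (simp add: forall_3)
  then have "i = 1 \<or> i = 2 \<or> i = 3" by blast
  ultimately show ?thesis
    unfolding lift_det_expand by (elim disjE) (simp_all add: A_def affine_point_def)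
qed

lemma hol_at_cderiv:
  assumes "open D" "\<And>z. z \<in> D \<Longrightarrow> hol_map_at f z" "z \<in> D"
  shows "hol_at (\<lambda>x. cderiv f x $ k $ i) z"
proof -
  have "hol_at (cpartial i (\<lambda>x. f x $ k)) z"
    using assms by (intro hol_at_cpartial[of D]) (auto simp: hol_map_at_def)
  moreover have "\<forall>\<^sub>F x in nhds z. x \<in> D" using assms eventually_nhds_in_open by blast
  then have "\<forall>\<^sub>F x in nhds z. cderiv f x $ k $ i = cpartial i (\<lambda>x. f x $ k) x"
    by eventually_elim (use assms cderiv_component in blast)
  ultimately show ?thesis by (simp add: hol_at_cong)
qed

lemma hol_at_lift_det:
  assumes "open D" "\<And>z. z \<in> D \<Longrightarrow> hol_map_at \<Lambda> z" "z \<in> D"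
  shows "hol_at (lift_det \<Lambda>) z"
proof -
  have "hol_at (\<lambda>x. \<Lambda> x $ k) z" for k using assms by (auto simp: hol_map_at_def)
  moreover have "hol_at (\<lambda>x. cderiv \<Lambda> x $ k $ i) z" for k i by (rule hol_at_cderiv[OF assms])
  ultimately show ?thesis unfolding lift_det_expand[abs_def]
    by (intro hol_at_add hol_at_diff hol_at_mult)
qed

definition lift_ratio :: "(nat \<times> nat \<Rightarrow> complex) \<Rightarrow> (complex^2 \<Rightarrow> complex^3) \<Rightarrow> complex^2 \<Rightarrow> complex" where
  "lift_ratio a \<Lambda> z = cubic a (\<Lambda> z) / lift_det \<Lambda> z"

definition is_lift :: "(complex^2 \<Rightarrow> (complex^3) set) \<Rightarrow> (complex^2) set \<Rightarrow> (complex^2 \<Rightarrow> complex^3) \<Rightarrow> bool" where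
  "is_lift P N \<Lambda> \<longleftrightarrow> open N \<and> (\<forall>z\<in>N. hol_map_at \<Lambda> z \<and> \<Lambda> z \<noteq> 0 \<and> P z = vec.span {\<Lambda> z})"

text \<open>Two lifts differ by a holomorphic factor without zeros near \<open>z\<close>, found as
  the quotient of a nonvanishing coordinate. Its cube cancels, so the coefficient depends only on
  the map to the plane.\<close>

lemma lift_ratio_unique:
  assumes L: "is_lift P N \<Lambda>" and L': "is_lift P N' \<Lambda>'" and z: "z \<in> N" "z \<in> N'"
  shows "lift_ratio a \<Lambda> z = lift_ratio a \<Lambda>' z"
proof -
  have h: "hol_map_at \<Lambda> z" "hol_map_at \<Lambda>' z" "\<Lambda> z \<noteq> 0" "\<Lambda>' z \<noteq> 0"
    using L L' z by (auto simp: is_lift_def)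
  obtain k where k: "\<Lambda> z $ k \<noteq> 0" using h(3) by (auto simp: vec_eq_iff)
  define c where "c = (\<lambda>x. \<Lambda>' x $ k / \<Lambda> x $ k)"
  have hc: "hol_at c z" unfolding c_def using h k by (auto simp: hol_map_at_def)
  have "isCont (\<lambda>x. \<Lambda> x $ k) z" using h(1) hol_at_imp_continuous by (auto simp: hol_map_at_def)
  then obtain e where "e > 0" "\<forall>y. dist z y < e \<longrightarrow> \<Lambda> y $ k \<noteq> 0"
    using continuous_at_avoid k by blast
  then have "\<forall>\<^sub>F x in nhds z. \<Lambda> x $ k \<noteq> 0" by (auto simp: eventually_nhds_metric dist_commute)
  moreover have "\<forall>\<^sub>F x in nhds z. x \<in> N \<inter> N'"
    using L L' z by (intro eventually_nhds_in_open) (auto simp: is_lift_def)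
  ultimately have ev: "\<forall>\<^sub>F x in nhds z. \<Lambda>' x = c x *s \<Lambda> x"
  proof eventually_elim
    case (elim x)
    then have "vec.span {\<Lambda>' x} = vec.span {\<Lambda> x}" using L L' by (auto simp: is_lift_def)
    then have "\<Lambda>' x \<in> range (\<lambda>b. b *s \<Lambda> x)" using vec.span_superset[of "{\<Lambda>' x}"] by (auto simp: span_single)
    then obtain b where "\<Lambda>' x = b *s \<Lambda> x" by blast
    then show ?case using elim by (simp add: c_def)
  qed
  have "lift_det \<Lambda>' z = c z ^ 3 * lift_det \<Lambda> z"
    using lift_det_cong[OF ev] lift_det_smult[OF hc h(1)] by simp
  moreover have e: "\<Lambda>' z = c z *s \<Lambda> z" using eventually_nhds_x_imp_x[OF ev] .
  moreover have "c z \<noteq> 0" using e h(4) by auto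
  ultimately show ?thesis by (simp add: lift_ratio_def cubic_smult)
qed

lemma is_lift_compose:
  assumes L: "is_lift P N \<Lambda>" and "open N'" and \<theta>: "\<And>z. z \<in> N' \<Longrightarrow> hol_map_at \<theta> z"
    and in_N: "\<And>z. z \<in> N' \<Longrightarrow> \<theta> z \<in> N" and P': "\<And>z. z \<in> N' \<Longrightarrow> P' z = P (\<theta> z)"
  shows "is_lift P' N' (\<Lambda> \<circ> \<theta>)"
  unfolding is_lift_def using assms hol_map_at_compose by (fastforce simp: is_lift_def)

text \<open>Division by the Jacobian determinant is the transformation law for coefficients of an
  anticanonical section.\<close>

lemma lift_ratio_compose:
  assumes "hol_map_at \<theta> z" "hol_map_at \<Lambda> (\<theta> z)"
  shows "lift_ratio a (\<Lambda> \<circ> \<theta>) z = lift_ratio a \<Lambda> (\<theta> z) / det (cderiv \<theta> z)"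
  by (simp add: lift_ratio_def lift_det_compose[OF assms])

lemma hol_at_lift_ratio:
  assumes "is_lift P N \<Lambda>" "z \<in> N" "lift_det \<Lambda> z \<noteq> 0"
  shows "hol_at (lift_ratio a \<Lambda>) z"
proof -
  have "hol_at (\<lambda>x. cubic a (\<Lambda> x)) z"
    by (rule hol_at_compose[where g = "cubic a", OF _ hol_at_cubic]) (use assms in \<open>auto simp: is_lift_def\<close>)
  moreover have "hol_at (lift_det \<Lambda>) z" using assms by (intro hol_at_lift_det[of N]) (auto simp: is_lift_def)
  ultimately show ?thesis unfolding lift_ratio_def[abs_def] using assms(3) by (rule hol_at_divide)
qed

text \<open>The blow-down is ramified to first order along the exceptional curve
  \<open>y $ i = 0\<close>. In the coefficient of the section this becomes a simple pole, and the
  cubic has to vanish at the centre to compensate for it.\<close>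

lemma det_bl_proj: "det (cderiv (bl_proj i) y) = (y :: complex^2) $ i"
proof -
  have i: "i = 1 \<or> i = 2" by (rule exhaust_2)
  have h: "hol_at (\<lambda>y. bl_dir i y $ k) y" for k by (rule hol_bl_dir)
  have bp: "(\<lambda>x. bl_proj i x $ k) = (\<lambda>x. x $ i * bl_dir i x $ k)" for k by (simp add: bl_proj_def)
  have cc: "cpartial j (\<lambda>x. x $ k) y = (if j = k then 1 else 0)" for j k :: 2
  proof -
    have "((\<lambda>x::complex^2. x $ k) has_derivative (\<lambda>x. x $ k)) (at y)"
      by (rule bounded_linear_imp_has_derivative) (rule bounded_linear_vec_nth)
    from frechet_derivative_at[OF this, symmetric] show ?thesis by (auto simp: cpartial_def axis_def)
  qed
  have c1: "cpartial j (\<lambda>x::complex^2. 1) y = 0" for j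
    by (simp add: cpartial_def frechet_derivative_const)
  have "cderiv (bl_proj i) y $ k $ j = y $ i * (if j = k \<and> k \<noteq> i then 1 else 0) + (if j = i then 1 else 0) * bl_dir i y $ k" for k j
  proof -
    have "cpartial j (\<lambda>x. bl_dir i x $ k) y = (if j = k \<and> k \<noteq> i then 1 else 0)"
      by (cases "k = i") (simp_all add: bl_dir_def cc c1)
    then show ?thesis
      unfolding cderiv_component[OF hol_bl_proj] bp by (simp add: cpartial_mult[OF hol_at_component h] cc)
  qed
  then show ?thesis using i unfolding det_2 by (elim disjE) (simp_all add: bl_dir_def)
qed

section \<open>The blown-up plane in coordinates\<close>

lemma openin_preimage:
  assumes A: "complex_atlas A" and f: "continuous_map (atlas_topology A) Y f" and V: "openin Y (topspace Y \<inter> V)"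
  shows "openin (atlas_topology A) (points A \<inter> f -` V)"
proof -
  have "openin (atlas_topology A) {x \<in> points A. f x \<in> topspace Y \<inter> V}"
    using openin_continuous_map_preimage[OF f V] by (simp add: topspace_atlas_topology[OF A])
  moreover have "{x \<in> points A. f x \<in> topspace Y \<inter> V} = points A \<inter> f -` V"
    using continuous_map_funspace[OF f] by (auto simp: topspace_atlas_topology[OF A])
  ultimately show ?thesis by simp
qed

lemma holomorphic_between_cong:
  assumes A: "complex_atlas A" and B: "complex_atlas B" and f: "holomorphic_between A B f"
    and eq: "\<And>x. x \<in> points A \<Longrightarrow> f x = g x"
  shows "holomorphic_between A B g"
  unfolding holomorphic_between_def
proof (intro conjI, safe)
  have cf: "continuous_map (atlas_topology A) (atlas_topology B) f" using f by (simp add: holomorphic_between_def)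
  show "continuous_map (atlas_topology A) (atlas_topology B) g"
    by (rule continuous_map_eq[OF cf]) (simp add: topspace_atlas_topology[OF A] eq)
  fix U \<phi> V \<psi> assume U: "(U, \<phi>) \<in> A" and V: "(V, \<psi>) \<in> B"
  have UA: "U \<subseteq> points A" by (rule complex_atlasD(3)[OF A U])
  have D: "U \<inter> g -` V = U \<inter> f -` V" using UA eq by auto
  show "holomorphic_map_on (\<psi> \<circ> g \<circ> inv_into U \<phi>) (\<phi> ` (U \<inter> g -` V))"
    unfolding D
  proof (rule holomorphic_map_on_cong)
    show "open (\<phi> ` (U \<inter> f -` V))" by (rule open_chart_preimage[OF A U cf openin_chart_domain[OF B V]])
    show "holomorphic_map_on (\<psi> \<circ> f \<circ> inv_into U \<phi>) (\<phi> ` (U \<inter> f -` V))"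
      using f U V by (auto simp: holomorphic_between_def)
    show "(\<psi> \<circ> f \<circ> inv_into U \<phi>) z = (\<psi> \<circ> g \<circ> inv_into U \<phi>) z" if "z \<in> \<phi> ` (U \<inter> f -` V)" for z
    proof -
      have "inv_into U \<phi> z \<in> U" using that by (auto intro: inv_into_into)
      then show ?thesis using eq UA by auto
    qed
  qed
qed

lemma biholomorphism_sym:
  assumes A: "complex_atlas A" and B: "complex_atlas B" and f: "biholomorphism A B f"
  shows "biholomorphism B A (inv_into (points A) f)"
proof -
  have bij: "bij_betw f (points A) (points B)" using f by (simp add: biholomorphism_def)
  have "holomorphic_between A B (inv_into (points B) (inv_into (points A) f))"
  proof (rule holomorphic_between_cong[OF A B])
    show "holomorphic_between A B f" using f by (simp add: biholomorphism_def)
    show "f x = inv_into (points B) (inv_into (points A) f) x" if "x \<in> points A" for x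
      using bij that by (simp add: inv_into_inv_into_eq)
  qed
  then show ?thesis using f bij_betw_inv_into[OF bij] by (simp add: biholomorphism_def)
qed

lemma complex_atlas_single: "open V \<Longrightarrow> complex_atlas {(V, id)}"
proof -
  assume V: "open V"
  have "holomorphic_map_on (id \<circ> inv_into V id) V"
  proof (rule holomorphic_map_on_cong[OF V])
    show "holomorphic_map_on (\<lambda>x. x) V" by (auto simp: holomorphic_map_on_iff hol_map_at_def)
  qed (metis comp_apply f_inv_into_f id_apply image_id)
  then show ?thesis using V by (simp add: complex_atlas_def)
qed

lemma eventually_inv_into_restrict:
  assumes "inj_on \<phi> U" and op: "open D" "D \<subseteq> \<phi> ` (U \<inter> W)" and z: "z \<in> D"
  shows "\<forall>\<^sub>F x in nhds z. (h \<circ> inv_into (U \<inter> W) \<phi>) x = (h \<circ> inv_into U \<phi>) x"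
proof -
  have "\<forall>\<^sub>F x in nhds z. x \<in> D" using op z eventually_nhds_in_open by blast
  then show ?thesis
    by eventually_elim (use assms inv_into_restrict[OF assms(1)] in auto)
qed

locale blown_up_plane =
  fixes S :: "(complex^3) set set" and X :: "('a, 2) atlas" and p :: "'a \<Rightarrow> (complex^3) set"
  assumes blowup: "is_blowup projective_plane S X p"
begin

lemma finite_S: "finite S" and S_points: "S \<subseteq> proj_space" and atlas_X: "complex_atlas X"
  and hol_p: "holomorphic_between X projective_plane p"
  using blowup by (auto simp: is_blowup_def complex_manifold_def points_projective_plane)

abbreviation "TX \<equiv> atlas_topology X"
abbreviation "TP \<equiv> atlas_topology projective_plane"

lemma cont_p: "continuous_map TX TP p"
  using hol_p by (simp add: holomorphic_between_def)

lemmas atlas_P = complex_atlas_projective_plane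

lemma topspace_P: "topspace TP = proj_space"
  by (simp add: topspace_atlas_topology[OF atlas_P] points_projective_plane)

lemma topspace_X: "topspace TX = points X"
  by (rule topspace_atlas_topology[OF atlas_X])

lemma p_in: "x \<in> points X \<Longrightarrow> p x \<in> proj_space"
  using continuous_map_funspace[OF cont_p] by (auto simp: topspace_P topspace_X)

lemma affine_chart_in_atlas: "(affine_piece i, affine_chart i) \<in> projective_plane"
  by (auto simp: projective_plane_eq)

lemma openin_piece: "openin TP (affine_piece i)"
  by (rule openin_chart_domain[OF atlas_P affine_chart_in_atlas])

lemma openin_diff_S: "finite S' \<Longrightarrow> openin TP (points projective_plane - S')"
  by (rule openin_diff_finite[OF atlas_P])

lemma openin_off_S: "openin TX (points X \<inter> p -` (- S))"
proof (rule openin_preimage[OF atlas_X cont_p])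
  have "topspace TP \<inter> - S = points projective_plane - S"
    by (auto simp: topspace_P points_projective_plane)
  then show "openin TP (topspace TP \<inter> - S)" using openin_diff_S[OF finite_S] by simp
qed

definition std_lift :: "'a set \<Rightarrow> ('a \<Rightarrow> complex^2) \<Rightarrow> 3 \<Rightarrow> complex^2 \<Rightarrow> complex^3" where
  "std_lift U \<phi> i = affine_point i \<circ> (affine_chart i \<circ> p \<circ> inv_into U \<phi>)"

lemma open_std: "(U, \<phi>) \<in> X \<Longrightarrow> open (\<phi> ` (U \<inter> p -` affine_piece i))"
  by (rule open_chart_preimage[OF atlas_X _ cont_p openin_piece])

lemma hol_chart_p:
  assumes "(U, \<phi>) \<in> X" "z \<in> \<phi> ` (U \<inter> p -` affine_piece i)"
  shows "hol_map_at (affine_chart i \<circ> p \<circ> inv_into U \<phi>) z"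
  using hol_p assms affine_chart_in_atlas[of i] unfolding holomorphic_between_def holomorphic_map_on_iff by fast

lemma is_lift_std:
  assumes U: "(U, \<phi>) \<in> X"
  shows "is_lift (p \<circ> inv_into U \<phi>) (\<phi> ` (U \<inter> p -` affine_piece i)) (std_lift U \<phi> i)"
  unfolding is_lift_def
proof (intro conjI ballI)
  show "open (\<phi> ` (U \<inter> p -` affine_piece i))" by (rule open_std[OF U])
  fix z assume z: "z \<in> \<phi> ` (U \<inter> p -` affine_piece i)"
  show "hol_map_at (std_lift U \<phi> i) z"
    unfolding std_lift_def by (intro hol_map_at_compose hol_chart_p[OF U z] hol_map_affine_point)
  show "std_lift U \<phi> i z \<noteq> 0" by (simp add: std_lift_def)
  have "p (inv_into U \<phi> z) \<in> affine_piece i" using z complex_atlasD(1)[OF atlas_X U] by auto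
  from affine_pieceD(3)[OF this] affine_point_chart[OF this]
  show "(p \<circ> inv_into U \<phi>) z = vec.span {std_lift U \<phi> i z}"
    unfolding std_lift_def o_def by metis
qed

text \<open>\<open>lift_det (affine_point i)\<close> is 1, so only the Jacobian of \<open>p\<close>
  in coordinates is left, and off \<open>S\<close> the map \<open>p\<close> is
  biholomorphic.\<close>

lemma lift_det_std:
  assumes U: "(U, \<phi>) \<in> X" and z: "z \<in> \<phi> ` (U \<inter> p -` affine_piece i)" and off: "p (inv_into U \<phi> z) \<notin> S"
  shows "lift_det (std_lift U \<phi> i) z \<noteq> 0"
proof -
  let ?A = "restrict_atlas X (p -` (- S))" and ?B = "restrict_atlas projective_plane (- S)"
  have A: "complex_atlas ?A" by (rule complex_atlas_restrict[OF atlas_X openin_off_S])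
  have "points projective_plane \<inter> - S = points projective_plane - S" by auto
  then have B: "complex_atlas ?B" using openin_diff_S[OF finite_S] by (intro complex_atlas_restrict[OF atlas_P]) simp
  have bi: "biholomorphism ?A ?B p" using blowup by (simp add: is_blowup_def)
  define h where "h = affine_chart i \<circ> p \<circ> inv_into (U \<inter> p -` (- S)) \<phi>"
  define D where "D = \<phi> ` ((U \<inter> p -` (- S)) \<inter> p -` (affine_piece i \<inter> - S))"
  note bc = biholomorphism_chart[OF A B bi restrict_atlasI[OF U] restrict_atlasI[OF affine_chart_in_atlas[of i]],
      folded h_def D_def]
  have inj: "inj_on \<phi> U" by (rule complex_atlasD(1)[OF atlas_X U])
  have zD: "z \<in> D" using z off inj by (auto simp: D_def)
  have ev: "\<forall>\<^sub>F x in nhds z. h x = (affine_chart i \<circ> p \<circ> inv_into U \<phi>) x"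
    unfolding h_def by (rule eventually_inv_into_restrict[OF inj bc(1) _ zD]) (auto simp: D_def)
  have "lift_det (std_lift U \<phi> i) z = det (cderiv (affine_chart i \<circ> p \<circ> inv_into U \<phi>) z)"
    unfolding std_lift_def
    using lift_det_compose[OF hol_chart_p[OF U z] hol_map_affine_point] by (simp add: lift_det_affine_point)
  also have "\<dots> = det (cderiv h z)" by (rule arg_cong[where f = det, OF cderiv_cong[OF ev, symmetric]])
  finally show ?thesis using bc(3)[OF zD] by simp
qed

lemma local_model:
  assumes s: "s \<in> S"
  obtains W and \<tau> :: "(complex^3) set \<Rightarrow> complex^2" and F where "openin TP W" "s \<in> W" "W \<subseteq> proj_space" "\<tau> s = 0" "open (\<tau> ` W)"
    "inj_on \<tau> W" "points (restrict_atlas projective_plane W) = W"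
    "biholomorphism (restrict_atlas projective_plane W) {(\<tau> ` W, id)} \<tau>"
    "biholomorphism (restrict_atlas X (p -` W)) (restrict_atlas blowup_origin (fst -` (\<tau> ` W))) F"
    "\<forall>x\<in>points X. p x \<in> W \<longrightarrow> fst (F x) = \<tau> (p x)"
    "complex_atlas (restrict_atlas projective_plane W)"
    "complex_atlas {(\<tau> ` W, id)}"
    "complex_atlas (restrict_atlas X (p -` W))" "openin TX (points X \<inter> p -` W)"
    "complex_atlas (restrict_atlas blowup_origin (fst -` (\<tau> ` W)))"
proof -
  obtain W and \<tau> :: "(complex^3) set \<Rightarrow> complex^2" and F where W: "openin TP W" "s \<in> W" "\<tau> s = 0" "open (\<tau> ` W)"
    and b1: "biholomorphism (restrict_atlas projective_plane W) {(\<tau> ` W, id)} \<tau>"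
    and b2: "biholomorphism (restrict_atlas X (p -` W)) (restrict_atlas blowup_origin (fst -` (\<tau> ` W))) F"
    and F: "\<forall>x\<in>points X. p x \<in> W \<longrightarrow> fst (F x) = \<tau> (p x)"
    using blowup s unfolding is_blowup_def by blast
  have WP: "W \<subseteq> proj_space" using openin_subset[OF W(1)] by (simp add: topspace_P)
  have WP': "points projective_plane \<inter> W = W" using WP by (auto simp: points_projective_plane)
  have aP: "complex_atlas (restrict_atlas projective_plane W)"
    by (rule complex_atlas_restrict[OF atlas_P]) (simp add: WP' W)
  have ptsP: "points (restrict_atlas projective_plane W) = W" by (simp add: points_restrict_atlas WP')
  have bij\<tau>: "bij_betw \<tau> W (\<tau> ` W)" 
    using b1 unfolding biholomorphism_def ptsP by (simp add: points_def)
  have inj\<tau>: "inj_on \<tau> W" using bij\<tau> by (rule bij_betw_imp_inj_on)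
  have aV: "complex_atlas {(\<tau> ` W, id)}" by (rule complex_atlas_single[OF W(4)])
  have oX: "openin TX (points X \<inter> p -` W)"
    by (rule openin_preimage[OF atlas_X cont_p]) (use WP' W(1) in \<open>simp add: topspace_P points_projective_plane\<close>)
  have aX: "complex_atlas (restrict_atlas X (p -` W))"
    by (rule complex_atlas_restrict[OF atlas_X oX])
  have aB: "complex_atlas (restrict_atlas blowup_origin (fst -` (\<tau> ` W)))"
  proof (rule complex_atlas_restrict[OF complex_atlas_blowup_origin])
    have "continuous_on UNIV (bl_proj i :: complex^2 \<Rightarrow> _)" for i
      by (intro continuous_at_imp_continuous_on ballI hol_map_at_imp_continuous hol_bl_proj)
    then have "open ((bl_proj i :: complex^2 \<Rightarrow> _) -` (\<tau> ` W))" for i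
      using W(4) by (simp add: continuous_on_open_vimage)
    moreover have "bl_chart i ` (points blowup_origin \<inter> fst -` (\<tau> ` W) \<inter> bl_domain i) = bl_proj i -` (\<tau> ` W)" for i :: 2
    proof (intro equalityI subsetI)
      fix y assume "y \<in> bl_chart i ` (points blowup_origin \<inter> fst -` (\<tau> ` W) \<inter> bl_domain i)"
      then obtain x where x: "y = bl_chart i x" "x \<in> bl_domain i" "fst x \<in> \<tau> ` W" by auto
      then have "bl_inv i y = x" by (simp add: bl_inv_chart)
      then show "y \<in> bl_proj i -` (\<tau> ` W)" using x(3) by (auto simp: bl_inv_def)
    next
      fix y assume y: "y \<in> bl_proj i -` (\<tau> ` W)"
      have "bl_inv i y \<in> points blowup_origin"
        using bl_inv_in_domain[of i y] by (auto simp: points_def blowup_origin_eq)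
      then have "bl_inv i y \<in> points blowup_origin \<inter> fst -` (\<tau> ` W) \<inter> bl_domain i"
        using y bl_inv_in_domain[of i y] by (auto simp: bl_inv_def)
      then show "y \<in> bl_chart i ` (points blowup_origin \<inter> fst -` (\<tau> ` W) \<inter> bl_domain i)"
        by (rule image_eqI[rotated]) (simp add: bl_chart_inv)
    qed
    ultimately show "openin (atlas_topology blowup_origin) (points blowup_origin \<inter> fst -` (\<tau> ` W))"
      unfolding openin_atlas_topology[OF complex_atlas_blowup_origin] by (auto simp: blowup_origin_eq)
  qed
  show thesis
    by (rule that[OF W(1,2) WP W(3,4) inj\<tau> ptsP b1 b2 F aP aV aX oX aB])
qed

text \<open>Near an exceptional point \<open>p\<close> factors, in the given chart, as
  \<open>P0\<close> after \<open>bl_proj i\<close> after \<open>\<kappa>\<close>. Here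
  \<open>\<kappa>\<close> changes to coordinates of the local model, in which the exceptional curve
  is a coordinate axis, and \<open>P0\<close> is the inverse of a coordinate map of the plane with a
  nondegenerate lift \<open>\<Lambda>0\<close>. The ramification sits entirely in
  \<open>bl_proj i\<close>.\<close>

lemma exceptional_chart:
  assumes U: "(U, \<phi>) \<in> X" and q: "q \<in> U" "p q \<in> S"
  obtains N \<kappa> i P0 D0 \<Lambda>0 where "open N" "\<phi> q \<in> N" "N \<subseteq> \<phi> ` U"
    "\<And>z. z \<in> N \<Longrightarrow> hol_map_at \<kappa> z" "\<And>z. z \<in> N \<Longrightarrow> det (cderiv \<kappa> z) \<noteq> 0" "\<kappa> (\<phi> q) $ i = 0"
    "\<And>z. z \<in> N \<Longrightarrow> \<kappa> z $ i = 0 \<longleftrightarrow> p (inv_into U \<phi> z) \<in> S"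
    "is_lift P0 D0 \<Lambda>0" "\<And>z. z \<in> N \<Longrightarrow> bl_proj i (\<kappa> z) \<in> D0"
    "\<And>z. z \<in> N \<Longrightarrow> P0 (bl_proj i (\<kappa> z)) = p (inv_into U \<phi> z)" "\<And>w. w \<in> D0 \<Longrightarrow> lift_det \<Lambda>0 w \<noteq> 0"
proof -
  have inj: "inj_on \<phi> U" and UX: "U \<subseteq> points X"
    using complex_atlasD(1,3)[OF atlas_X U] .
  define s where "s = p q"
  have "s \<in> S" using q by (simp add: s_def)
  then obtain W and \<tau> :: "(complex^3) set \<Rightarrow> complex^2" and F
    where W12: "openin TP W" "s \<in> W" and WP: "W \<subseteq> proj_space" and W34: "\<tau> s = 0" "open (\<tau> ` W)"
    and inj\<tau>: "inj_on \<tau> W" and ptsP: "points (restrict_atlas projective_plane W) = W"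
    and b1: "biholomorphism (restrict_atlas projective_plane W) {(\<tau> ` W, id)} \<tau>"
    and b2: "biholomorphism (restrict_atlas X (p -` W)) (restrict_atlas blowup_origin (fst -` (\<tau> ` W))) F"
    and F: "\<forall>x\<in>points X. p x \<in> W \<longrightarrow> fst (F x) = \<tau> (p x)"
    and aP: "complex_atlas (restrict_atlas projective_plane W)"
    and aV: "complex_atlas {(\<tau> ` W, id)}"
    and aX: "complex_atlas (restrict_atlas X (p -` W))"
    and "openin TX (points X \<inter> p -` W)"
    and aB: "complex_atlas (restrict_atlas blowup_origin (fst -` (\<tau> ` W)))"
    by (rule local_model) (rule that)
  note W = W12 W34
  have bijF: "bij_betw F (points X \<inter> p -` W) (points blowup_origin \<inter> fst -` (\<tau> ` W))"
    using b2 by (simp add: biholomorphism_def points_restrict_atlas)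
  have qX: "q \<in> points X \<inter> p -` W" using q UX W by (auto simp: s_def)
  then have "F q \<in> points blowup_origin \<inter> fst -` (\<tau> ` W)" using bijF bij_betwE by blast
  then obtain i where i: "F q \<in> bl_domain i \<inter> fst -` (\<tau> ` W)"
    by (auto simp: points_def blowup_origin_eq)
  have Bi: "(bl_domain i, bl_chart i) \<in> blowup_origin" by (auto simp: blowup_origin_eq)
  define \<kappa> where "\<kappa> = bl_chart i \<circ> F \<circ> inv_into (U \<inter> p -` W) \<phi>"
  define N1 where "N1 = \<phi> ` ((U \<inter> p -` W) \<inter> F -` (bl_domain i \<inter> fst -` (\<tau> ` W)))"
  note bc = biholomorphism_chart[OF aX aB b2 restrict_atlasI[OF U] restrict_atlasI[OF Bi], folded \<kappa>_def N1_def]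
  have N1: "inv_into U \<phi> z \<in> U" "p (inv_into U \<phi> z) \<in> W" "bl_proj i (\<kappa> z) = \<tau> (p (inv_into U \<phi> z))" if "z \<in> N1" for z
  proof -
    obtain x where x: "x \<in> U" "p x \<in> W" "F x \<in> bl_domain i" "z = \<phi> x" using \<open>z \<in> N1\<close> unfolding N1_def by blast
    have iz: "inv_into U \<phi> z = x" "inv_into (U \<inter> p -` W) \<phi> z = x"
      using x inj inj_on_subset[OF inj, of "U \<inter> p -` W"] by auto
    have "bl_inv i (\<kappa> z) = F x" using x(3) by (simp add: \<kappa>_def iz bl_inv_chart)
    then have "bl_proj i (\<kappa> z) = fst (F x)" by (metis bl_inv_def fst_conv)
    also have "\<dots> = \<tau> (p x)" using F x UX by auto
    finally show "inv_into U \<phi> z \<in> U" "p (inv_into U \<phi> z) \<in> W" "bl_proj i (\<kappa> z) = \<tau> (p (inv_into U \<phi> z))"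
      using x(1,2) by (simp_all only: iz)
  qed
  have "s \<in> proj_space" using W WP by auto
  then obtain j where j: "s \<in> affine_piece j" using bounded_affine_rep by blast
  define P0 where "P0 = inv_into W \<tau>"
  have P0: "P0 (\<tau> l) = l" if "l \<in> W" for l using inj\<tau> that by (simp add: P0_def)
  define h where "h = affine_chart j \<circ> P0 \<circ> inv_into (\<tau> ` W) id"
  define D0 where "D0 = id ` (\<tau> ` W \<inter> P0 -` (affine_piece j \<inter> W))"
  note bc0 = biholomorphism_chart[OF aV aP biholomorphism_sym[OF aP aV b1] insertI1 restrict_atlasI[OF affine_chart_in_atlas[of j]],
      unfolded ptsP, folded P0_def, folded h_def, folded D0_def]
  have oD0: "open D0" by (rule bc0(1))
  have D0: "w \<in> D0 \<longleftrightarrow> w \<in> \<tau> ` W \<and> P0 w \<in> affine_piece j \<inter> W" for w by (auto simp: D0_def)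
  have inv_id: "inv_into (\<tau> ` W) id w = w" if "w \<in> \<tau> ` W" for w
    using that by (metis f_inv_into_f id_apply image_id)
  define \<Lambda>0 where "\<Lambda>0 = affine_point j \<circ> h"
  have lift0: "is_lift P0 D0 \<Lambda>0"
    unfolding is_lift_def
  proof (intro conjI ballI)
    fix w assume w: "w \<in> D0"
    show "hol_map_at \<Lambda>0 w" unfolding \<Lambda>0_def by (intro hol_map_at_compose bc0(2)[OF w] hol_map_affine_point)
    show "\<Lambda>0 w \<noteq> 0" by (simp add: \<Lambda>0_def)
    have "P0 w \<in> affine_piece j" "inv_into (\<tau> ` W) id w = w" using w inv_id by (auto simp: D0)
    then show "P0 w = vec.span {\<Lambda>0 w}"
      using affine_pieceD(3) affine_point_chart by (metis \<Lambda>0_def comp_apply h_def)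
  qed (rule oD0)
  have ld0: "lift_det \<Lambda>0 w \<noteq> 0" if "w \<in> D0" for w
    using lift_det_compose[OF bc0(2)[OF that] hol_map_affine_point] bc0(3)[OF that]
    by (simp add: \<Lambda>0_def lift_det_affine_point)
  \<comment> \<open>The second set keeps \<open>p\<close> in one affine piece. The third keeps it
    away from the other centres, so that in \<open>N\<close> being mapped into \<open>S\<close>
    means being mapped to \<open>s\<close>.\<close>
  define N where "N = N1 \<inter> \<phi> ` (U \<inter> p -` (affine_piece j)) \<inter> \<phi> ` (U \<inter> p -` (points projective_plane - (S - {s})))"
  show thesis
  proof (rule that)
    have "open (\<phi> ` (U \<inter> p -` (points projective_plane - (S - {s}))))"
      by (rule open_chart_preimage[OF atlas_X U cont_p]) (simp add: openin_diff_S finite_S)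
    then show "open N" unfolding N_def using bc(1) open_std[OF U, of j] by (intro open_Int)
    have "p q \<in> points projective_plane - (S - {s})"
      using q S_points by (auto simp: s_def points_projective_plane)
    then show "\<phi> q \<in> N" using q qX i j by (auto simp: N_def N1_def s_def)
    show "N \<subseteq> \<phi> ` U" by (auto simp: N_def)
    have NN: "z \<in> N1" if "z \<in> N" for z using that by (simp add: N_def)
    show "hol_map_at \<kappa> z" if "z \<in> N" for z by (rule bc(2)[OF NN[OF that]])
    show "det (cderiv \<kappa> z) \<noteq> 0" if "z \<in> N" for z by (rule bc(3)[OF NN[OF that]])
    have zero: "\<kappa> z $ i = 0 \<longleftrightarrow> p (inv_into U \<phi> z) = s" if "z \<in> N" for z
    proof -
      have "\<kappa> z $ i = 0 \<longleftrightarrow> bl_proj i (\<kappa> z) = 0"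
        by (auto simp: bl_proj_def vec_eq_iff dest!: spec[of _ i])
      also have "\<dots> \<longleftrightarrow> \<tau> (p (inv_into U \<phi> z)) = \<tau> s" using N1(3)[OF NN[OF that]] W(3) by simp
      also have "\<dots> \<longleftrightarrow> p (inv_into U \<phi> z) = s"
        using inj\<tau> N1(2)[OF NN[OF that]] W(2) by (meson inj_onD)
      finally show ?thesis .
    qed
    show "\<kappa> (\<phi> q) $ i = 0" using zero[OF \<open>\<phi> q \<in> N\<close>] inj q by (simp add: s_def)
    show "\<kappa> z $ i = 0 \<longleftrightarrow> p (inv_into U \<phi> z) \<in> S" if "z \<in> N" for z
    proof -
      have "z \<in> \<phi> ` (U \<inter> p -` (points projective_plane - (S - {s})))" using that by (simp add: N_def)
      then have "p (inv_into U \<phi> z) \<notin> S - {s}" using inj by auto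
      then show ?thesis using zero[OF that] q by (auto simp: s_def)
    qed
    show "is_lift P0 D0 \<Lambda>0" by (rule lift0)
    show pz: "P0 (bl_proj i (\<kappa> z)) = p (inv_into U \<phi> z)" if "z \<in> N" for z
      using N1[OF NN[OF that]] P0 by simp
    show "bl_proj i (\<kappa> z) \<in> D0" if "z \<in> N" for z
    proof -
      have "z \<in> \<phi> ` (U \<inter> p -` affine_piece j)" using that by (simp add: N_def)
      then have "p (inv_into U \<phi> z) \<in> affine_piece j" using inj by auto
      then show ?thesis using N1[OF NN[OF that]] pz[OF that] by (simp add: D0)
    qed
    show "lift_det \<Lambda>0 w \<noteq> 0" if "w \<in> D0" for w by (rule ld0[OF that])
  qed
qed

end

section \<open>The norm of the anticanonical section\<close>

lemma limitin_chart:
  fixes f :: "'a \<Rightarrow> real"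
  assumes A: "complex_atlas A" and U: "(U, \<phi>) \<in> A" and q: "q \<in> U"
    and lim: "((\<lambda>z. f (inv_into U \<phi> z)) \<longlongrightarrow> l) (at (\<phi> q) within \<phi> ` (U \<inter> B))"
  shows "limitin euclideanreal f l (atin_within (atlas_topology A) q B)"
  unfolding limitin_def
proof (intro conjI allI impI)
  fix V :: "real set" assume V: "openin euclideanreal V \<and> l \<in> V"
  have inj: "inj_on \<phi> U" by (rule complex_atlasD(1)[OF A U])
  have "\<forall>\<^sub>F z in at (\<phi> q) within \<phi> ` (U \<inter> B). f (inv_into U \<phi> z) \<in> V"
    using topological_tendstoD[OF lim, of V] V by simp
  then obtain T where T: "open T" "\<phi> q \<in> T"
      "\<And>z. z \<in> T \<Longrightarrow> z \<noteq> \<phi> q \<Longrightarrow> z \<in> \<phi> ` (U \<inter> B) \<Longrightarrow> f (inv_into U \<phi> z) \<in> V"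
    unfolding eventually_at_topological by blast
  define T' where "T' = {x \<in> U. \<phi> x \<in> T}"
  have "\<phi> ` T' = \<phi> ` U \<inter> T" by (auto simp: T'_def)
  then have "open (\<phi> ` T')" using complex_atlasD(2)[OF A U] T(1) by auto
  then have "openin (atlas_topology A) T'"
    by (subst openin_atlas_chart[OF A U]) (auto simp: T'_def)
  moreover have "q \<in> T'" using q T by (simp add: T'_def)
  moreover have "f x \<in> V" if x: "x \<in> T'" "x \<in> B" "x \<noteq> q" for x
  proof -
    have "\<phi> x \<noteq> \<phi> q" using inj x q by (auto simp: T'_def inj_on_eq_iff)
    then show ?thesis using T(3)[of "\<phi> x"] x inj by (auto simp: T'_def)
  qed
  ultimately show "\<forall>\<^sub>F x in atin_within (atlas_topology A) q B. f x \<in> V"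
    unfolding eventually_atin_within by blast
qed simp

text \<open>A row of an invertible matrix is a nonzero functional. A small step along a vector
  \<open>v\<close> on which it is 1 leaves its kernel; the 1 added to \<open>norm v\<close> in the
  step length excludes division by zero.\<close>

lemma dense_nonzero_functional:
  fixes A :: "complex^'n^'n"
  assumes "det A \<noteq> 0"
  shows "closure {\<xi>. (A *v \<xi>) $ i \<noteq> 0} = UNIV"
proof -
  obtain B where "A ** B = mat 1" using assms invertible_det_nz invertible_def by blast
  then have "(A *v (B *v axis i 1)) $ i = 1" by (simp add: matrix_vector_mul_assoc axis_def)
  then obtain v where v: "(A *v v) $ i = 1" by blast
  have "\<xi> \<in> closure {\<xi>. (A *v \<xi>) $ i \<noteq> 0}" for \<xi>
    unfolding closure_approachable
  proof (intro allI impI)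
    fix e :: real assume e: "e > 0"
    define t where "t = e / (2 * (norm v + 1))"
    have t: "t > 0" using e by (simp add: t_def add_nonneg_pos)
    have nv: "norm (c *\<^sub>R v) < e" if "\<bar>c\<bar> \<le> t" for c
    proof -
      have "norm (c *\<^sub>R v) \<le> t * norm v" using that by (simp add: mult_right_mono)
      also have "\<dots> < t * (2 * (norm v + 1))" using t by (intro mult_strict_left_mono) (auto simp: add_nonneg_pos intro: add_strict_increasing2)
      also have "\<dots> = e" unfolding t_def by (simp add: add_nonneg_eq_0_iff)
      finally show ?thesis .
    qed
    have lin: "(A *v (\<xi> + c *\<^sub>R v)) $ i = (A *v \<xi>) $ i + of_real c" for c
    proof -
      have "c *\<^sub>R v = of_real c *s v" by (simp add: vec_eq_iff) (simp add: scaleR_conv_of_real)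
      then show ?thesis using v by (simp add: matrix_vector_right_distrib vector_scalar_commute)
    qed
    show "\<exists>y\<in>{\<xi>. (A *v \<xi>) $ i \<noteq> 0}. dist y \<xi> < e"
    proof (cases "(A *v \<xi>) $ i = 0")
      case True
      then have "(A *v (\<xi> + t *\<^sub>R v)) $ i \<noteq> 0" unfolding lin using t by simp
      then show ?thesis using nv[of t] t by (intro bexI[of _ "\<xi> + t *\<^sub>R v"]) (auto simp: dist_norm)
    next
      case False
      then show ?thesis using e by (intro bexI[of _ \<xi>]) auto
    qed
  qed
  then show ?thesis by blast
qed

lemma det_map_cnj_2: "det (map_matrix cnj (J :: complex^2^2)) = cnj (det J)"
  by (simp add: det_2 map_matrix_def)

locale anticanonical_section = blown_up_plane S X p
  for S :: "(complex^3) set set" and X :: "('a, 2) atlas" and p :: "'a \<Rightarrow> (complex^3) set" +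
  fixes g :: "('a, 2) chart \<Rightarrow> complex^2 \<Rightarrow> complex^2^2" and a :: "nat \<times> nat \<Rightarrow> complex"
  assumes metric: "hermitian_metric X g"
    and vanish: "\<And>l w. l \<in> S \<Longrightarrow> w \<in> l \<Longrightarrow> cubic a w = 0"
begin

lemma smooth_g: "(U, \<phi>) \<in> X \<Longrightarrow> smooth_on (\<phi> ` U) (g (U, \<phi>))"
  and posdef_g: "(U, \<phi>) \<in> X \<Longrightarrow> z \<in> \<phi> ` U \<Longrightarrow> hermitian_pos_def (g (U, \<phi>) z)"
  using metric unfolding hermitian_metric_def by blast+

lemma cont_g:
  assumes "(U, \<phi>) \<in> X" "z \<in> \<phi> ` U"
  shows "isCont (\<lambda>z. Re (det (g (U, \<phi>) z))) z"
proof -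
  have "Ck_on 0 (\<phi> ` U) (g (U, \<phi>))" using smooth_g[OF assms(1)] unfolding smooth_on_def by blast
  then have "continuous_on (\<phi> ` U) (\<lambda>z. Re (det (g (U, \<phi>) z)))"
    unfolding det_2 by (intro continuous_intros) simp_all
  then show ?thesis using assms(2) unfolding continuous_on_eq_continuous_at[OF complex_atlasD(2)[OF atlas_X assms(1)]] by blast
qed

text \<open>Squared norm of the section with coefficient \<open>lift_ratio a \<Lambda>\<close>:
  \<open>det\<close> of the metric is the weight that the metric induces on the anticanonical
  bundle.\<close>

definition density :: "'a set \<Rightarrow> ('a \<Rightarrow> complex^2) \<Rightarrow> (complex^2 \<Rightarrow> complex^3) \<Rightarrow> complex^2 \<Rightarrow> real" where
  "density U \<phi> \<Lambda> z = (cmod (lift_ratio a \<Lambda> z))\<^sup>2 * Re (det (g (U, \<phi>) z))"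

text \<open>A change of chart divides the coefficient by \<open>det J\<close> and multiplies the
  determinant of the metric by its squared modulus, so the product is invariant. That
  \<open>det J\<close> is nonzero follows from the positivity of the determinant of the
  metric.\<close>

lemma density_unique:
  assumes U: "(U, \<phi>) \<in> X" and V: "(V, \<psi>) \<in> X" and x: "x \<in> U" "x \<in> V"
    and L: "is_lift (p \<circ> inv_into U \<phi>) N \<Lambda>" "\<phi> x \<in> N"
    and L': "is_lift (p \<circ> inv_into V \<psi>) N' \<Lambda>'" "\<psi> x \<in> N'"
  shows "density U \<phi> \<Lambda> (\<phi> x) = density V \<psi> \<Lambda>' (\<psi> x)"
proof -
  have inj: "inj_on \<phi> U" "inj_on \<psi> V" using complex_atlasD(1)[OF atlas_X] U V by auto
  define \<theta> where "\<theta> = \<psi> \<circ> inv_into U \<phi>"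
  define D where "D = \<phi> ` (U \<inter> V)"
  have oD: "open D" unfolding D_def by (rule complex_atlasD(4)[OF atlas_X U V])
  have h\<theta>: "hol_map_at \<theta> z" if "z \<in> D" for z
    using complex_atlasD(5)[OF atlas_X U V] that unfolding D_def \<theta>_def holomorphic_map_on_iff by blast
  define N2 where "N2 = D \<inter> \<theta> -` N'"
  have "continuous_on D \<theta>" using h\<theta> by (intro continuous_at_imp_continuous_on) (auto intro: hol_map_at_imp_continuous)
  then have oN2: "open N2" unfolding N2_def using L'(1) by (intro continuous_open_preimage oD) (auto simp: is_lift_def)
  have \<theta>x: "\<theta> (\<phi> x) = \<psi> x" using x inj by (simp add: \<theta>_def)
  have xD: "\<phi> x \<in> D" "\<phi> x \<in> N2" using x L'(2) by (auto simp: D_def N2_def \<theta>x)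
  have L2: "is_lift (p \<circ> inv_into U \<phi>) N2 (\<Lambda>' \<circ> \<theta>)"
  proof (rule is_lift_compose[OF L'(1) oN2])
    show "(p \<circ> inv_into U \<phi>) z = (p \<circ> inv_into V \<psi>) (\<theta> z)" if z: "z \<in> N2" for z
    proof -
      obtain y where "y \<in> U" "y \<in> V" "z = \<phi> y" using z by (auto simp: N2_def D_def)
      then show ?thesis using inj by (simp add: \<theta>_def)
    qed
  qed (auto simp: N2_def h\<theta>)
  have hL': "hol_map_at \<Lambda>' (\<theta> (\<phi> x))" using L' by (auto simp: is_lift_def \<theta>x)
  define J where "J = cderiv \<theta> (\<phi> x)"
  have r: "lift_ratio a \<Lambda> (\<phi> x) = lift_ratio a \<Lambda>' (\<psi> x) / det J"
    using lift_ratio_unique[OF L(1) L2 L(2) xD(2)] lift_ratio_compose[OF h\<theta>[OF xD(1)] hL'] by (simp add: \<theta>x J_def)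
  have "g (U, \<phi>) (\<phi> x) = transpose J ** g (V, \<psi>) (\<psi> x) ** map_matrix cnj J"
    using metric U V x unfolding hermitian_metric_def Let_def J_def cderiv_def \<theta>_def by fast
  then have "det (g (U, \<phi>) (\<phi> x)) = det J * cnj (det J) * det (g (V, \<psi>) (\<psi> x))"
    by (simp add: det_mul det_map_cnj_2)
  then have d: "Re (det (g (U, \<phi>) (\<phi> x))) = (cmod (det J))\<^sup>2 * Re (det (g (V, \<psi>) (\<psi> x)))"
    by (simp add: complex_norm_square[symmetric] del: of_real_power flip: of_real_power)
  have "Re (det (g (U, \<phi>) (\<phi> x))) > 0" using hermitian_pos_def_2(5)[OF posdef_g[OF U]] x by blast
  then have "det J \<noteq> 0" using d by auto
  then show ?thesis unfolding density_def r d by (simp add: norm_divide power_divide)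
qed

text \<open>All admissible charts and lifts give the same value. On the exceptional curves
  \<open>lift_det\<close> vanishes, and division by zero makes this value 0; the meaningful value
  there is a limit from outside, supplied by \<open>section_norm_exists\<close>.\<close>

definition section_norm :: "'a \<Rightarrow> real" where
  "section_norm x = (SOME r. \<exists>U \<phi> N \<Lambda>. (U, \<phi>) \<in> X \<and> x \<in> U \<and> is_lift (p \<circ> inv_into U \<phi>) N \<Lambda> \<and> \<phi> x \<in> N \<and> r = density U \<phi> \<Lambda> (\<phi> x))"

lemma section_norm_eq:
  assumes "(U, \<phi>) \<in> X" "x \<in> U" "is_lift (p \<circ> inv_into U \<phi>) N \<Lambda>" "\<phi> x \<in> N"
  shows "section_norm x = density U \<phi> \<Lambda> (\<phi> x)"
  unfolding section_norm_def
proof (rule some_equality)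
  show "\<exists>U' \<phi>' N \<Lambda>'. (U', \<phi>') \<in> X \<and> x \<in> U' \<and> is_lift (p \<circ> inv_into U' \<phi>') N \<Lambda>' \<and> \<phi>' x \<in> N \<and>
      density U \<phi> \<Lambda> (\<phi> x) = density U' \<phi>' \<Lambda>' (\<phi>' x)"
    using assms by blast
qed (use assms density_unique in metis)

lemma section_norm_chart:
  assumes U: "(U, \<phi>) \<in> X" and "is_lift (p \<circ> inv_into U \<phi>) N \<Lambda>" "z \<in> N" "z \<in> \<phi> ` U"
  shows "section_norm (inv_into U \<phi> z) = density U \<phi> \<Lambda> z"
  using section_norm_eq[OF U, of "inv_into U \<phi> z" N \<Lambda>] assms by (simp add: inv_into_into f_inv_into_f)

lemma piece_exists:
  assumes "x \<in> points X"
  obtains i where "p x \<in> affine_piece i"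
  using bounded_affine_rep[OF p_in[OF assms]] by metis

lemma isCont_density:
  assumes U: "(U, \<phi>) \<in> X" and L: "is_lift P N \<Lambda>" "z \<in> N" "z \<in> \<phi> ` U" and nz: "lift_det \<Lambda> z \<noteq> 0"
  shows "isCont (density U \<phi> \<Lambda>) z"
  unfolding density_def[abs_def]
  using hol_at_imp_continuous[OF hol_at_lift_ratio[OF L(1,2) nz, of a]] cont_g[OF U L(3)]
  by (intro continuous_intros)

lemma section_norm_limit_regular:
  assumes x: "x \<in> points X" "p x \<notin> S"
  shows "limitin euclideanreal section_norm (section_norm x) (atin_within TX x B)"
proof -
  obtain U \<phi> where U: "(U, \<phi>) \<in> X" "x \<in> U" using x by (auto simp: points_def)
  obtain i where i: "p x \<in> affine_piece i" by (rule piece_exists[OF x(1)])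
  have inj: "inj_on \<phi> U" by (rule complex_atlasD(1)[OF atlas_X U(1)])
  define N where "N = \<phi> ` (U \<inter> p -` affine_piece i)"
  define \<Lambda> where "\<Lambda> = std_lift U \<phi> i"
  have L: "is_lift (p \<circ> inv_into U \<phi>) N \<Lambda>" unfolding N_def \<Lambda>_def by (rule is_lift_std[OF U(1)])
  have xN: "\<phi> x \<in> N" "\<phi> x \<in> \<phi> ` U" using U i by (auto simp: N_def)
  have "lift_det \<Lambda> (\<phi> x) \<noteq> 0" unfolding \<Lambda>_def
    by (rule lift_det_std[OF U(1)]) (use xN x U inj in \<open>auto simp: N_def\<close>)
  then have "isCont (density U \<phi> \<Lambda>) (\<phi> x)" by (rule isCont_density[OF U(1) L xN])
  then have "(density U \<phi> \<Lambda> \<longlongrightarrow> section_norm x) (at (\<phi> x))"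
    using section_norm_eq[OF U L xN(1)] by (simp add: isCont_def)
  moreover have "\<forall>\<^sub>F z in at (\<phi> x). z \<in> N"
    using L xN eventually_at_in_open'[of N "\<phi> x"] by (auto simp: is_lift_def)
  then have "\<forall>\<^sub>F z in at (\<phi> x). density U \<phi> \<Lambda> z = section_norm (inv_into U \<phi> z)"
    by eventually_elim (use section_norm_chart[OF U(1) L] in \<open>auto simp: N_def\<close>)
  ultimately have "((\<lambda>z. section_norm (inv_into U \<phi> z)) \<longlongrightarrow> section_norm x) (at (\<phi> x))"
    by (rule Lim_transform_eventually)
  then show ?thesis
    by (rule limitin_chart[OF atlas_X U Lim_at_imp_Lim_at_within])
qed

text \<open>The cubic, as a function \<open>h\<close> near the centre, vanishes at 0, and
  \<open>\<pi> z\<close> is \<open>\<kappa> z $ i\<close> times the direction \<open>d z\<close>.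
  Hence \<open>h (\<pi> z) / \<kappa> z $ i\<close> tends to the derivative of \<open>h\<close> in
  the direction that the exceptional point represents: the zero of the cubic cancels the simple zero
  of the Jacobian.\<close>

lemma section_norm_limit_exceptional:
  assumes q: "q \<in> points X" "p q \<in> S"
  shows "\<exists>l. limitin euclideanreal section_norm l (atin_within TX q (points X \<inter> p -` (- S)))"
proof -
  obtain U \<phi> where U: "(U, \<phi>) \<in> X" "q \<in> U" using q by (auto simp: points_def)
  have inj: "inj_on \<phi> U" by (rule complex_atlasD(1)[OF atlas_X U(1)])
  obtain N \<kappa> i P0 D0 \<Lambda>0 where N: "open N" "\<phi> q \<in> N" "N \<subseteq> \<phi> ` U"
    and \<kappa>: "\<And>z. z \<in> N \<Longrightarrow> hol_map_at \<kappa> z" "\<And>z. z \<in> N \<Longrightarrow> det (cderiv \<kappa> z) \<noteq> 0" "\<kappa> (\<phi> q) $ i = 0"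
    and E: "\<And>z. z \<in> N \<Longrightarrow> \<kappa> z $ i = 0 \<longleftrightarrow> p (inv_into U \<phi> z) \<in> S"
    and L0: "is_lift P0 D0 \<Lambda>0" and inD: "\<And>z. z \<in> N \<Longrightarrow> bl_proj i (\<kappa> z) \<in> D0"
    and P0: "\<And>z. z \<in> N \<Longrightarrow> P0 (bl_proj i (\<kappa> z)) = p (inv_into U \<phi> z)" and ld: "\<And>w. w \<in> D0 \<Longrightarrow> lift_det \<Lambda>0 w \<noteq> 0"
    by (rule exceptional_chart[OF U q(2)]) blast
  define \<pi> where "\<pi> = (\<lambda>z. bl_proj i (\<kappa> z))"
  have h\<pi>: "hol_map_at (bl_proj i \<circ> \<kappa>) z" if "z \<in> N" for z
    by (intro hol_map_at_compose \<kappa>(1) hol_bl_proj that)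
  have L: "is_lift (p \<circ> inv_into U \<phi>) N (\<Lambda>0 \<circ> (bl_proj i \<circ> \<kappa>))"
    by (rule is_lift_compose[OF L0 N(1)]) (use h\<pi> inD P0 in auto)
  have \<pi>0: "\<pi> (\<phi> q) = 0" by (simp add: \<pi>_def bl_proj_def \<kappa>(3))
  have D0: "0 \<in> D0" using inD[OF N(2)] by (simp add: \<pi>0[unfolded \<pi>_def])
  define h where "h = (\<lambda>w. cubic a (\<Lambda>0 w))"
  have h\<Lambda>0: "hol_map_at \<Lambda>0 0" and span0: "P0 0 = vec.span {\<Lambda>0 0}" using L0 D0 by (auto simp: is_lift_def)
  have h0: "h 0 = 0" unfolding h_def
  proof (rule vanish)
    show "P0 0 \<in> S" using P0[OF N(2)] q(2) inj U by (simp add: \<pi>0[unfolded \<pi>_def])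
    show "\<Lambda>0 0 \<in> P0 0" unfolding span0 by (simp add: vec.span_base)
  qed
  have hh: "hol_at h 0" unfolding h_def
    by (rule hol_at_compose[where g = "cubic a", OF h\<Lambda>0 hol_at_cubic])
  obtain dh where "(h has_derivative dh) (at 0) \<and> (\<forall>c x. dh (c *s x) = c * dh x)"
    using hh unfolding hol_at_def by (rule exE)
  then have dh: "(h has_derivative dh) (at 0)" "\<And>c x. dh (c *s x) = c * dh x" by simp_all
  \<comment> \<open>Normalised remainder of the first-order expansion of \<open>h\<close>. At the
    origin division by zero gives 0, the right value for continuity.\<close>
  define e where "e = (\<lambda>w. (h w - dh w) /\<^sub>R norm w)"
  have elim: "(e \<longlongrightarrow> 0) (at 0)"
  proof (rule tendsto_norm_zero_cancel)
    have "(\<lambda>w. norm (h (0 + w) - h 0 - dh w) / norm w) \<midarrow>0\<rightarrow> 0"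
      using dh(1) unfolding has_derivative_at by blast
    then show "((\<lambda>w. norm (e w)) \<longlongrightarrow> 0) (at 0)"
      by (simp add: e_def h0 divide_inverse mult.commute)
  qed
  have e0: "e 0 = 0" by (simp add: e_def)
  have ce: "isCont e 0" using elim by (simp add: isCont_def e0)
  have he: "h w = dh w + norm w *\<^sub>R e w" for w
  proof (cases "w = 0")
    case True
    then show ?thesis using dh(2)[of 0 0] by (simp add: h0)
  qed (simp add: e_def)
  define d where "d = (\<lambda>z. bl_dir i (\<kappa> z))"
  have c\<kappa>: "isCont \<kappa> (\<phi> q)" by (rule hol_map_at_imp_continuous[OF \<kappa>(1)[OF N(2)]])
  have cd: "isCont d (\<phi> q)" unfolding d_def
  proof (rule isCont_o2[OF c\<kappa>])
    have "hol_map_at (bl_dir i) (\<kappa> (\<phi> q))" unfolding hol_map_at_def using hol_bl_dir by blast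
    then show "isCont (bl_dir i) (\<kappa> (\<phi> q))" by (rule hol_map_at_imp_continuous)
  qed
  have c\<pi>: "isCont \<pi> (\<phi> q)"
    using hol_map_at_imp_continuous[OF h\<pi>[OF N(2)]] by (simp add: \<pi>_def o_def)
  have cdh: "isCont dh w" for w using has_derivative_bounded_linear[OF dh(1)] by (simp add: linear_continuous_at)
  have ratio_lim: "((\<lambda>z. h (\<pi> z) / \<kappa> z $ i) \<longlongrightarrow> dh (d (\<phi> q))) (at (\<phi> q) within {z. \<kappa> z $ i \<noteq> 0})"
  proof -
    have "((\<lambda>z. norm (d z) * norm (e (\<pi> z))) \<longlongrightarrow> norm (d (\<phi> q)) * norm (e (\<pi> (\<phi> q)))) (at (\<phi> q))"
      using cd c\<pi> ce by (intro tendsto_intros isCont_tendsto_compose[where g = e and F = "at (\<phi> q)" and f = \<pi>])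
        (simp_all add: isCont_def \<pi>0)
    then have "((\<lambda>z. norm (d z) * norm (e (\<pi> z))) \<longlongrightarrow> 0) (at (\<phi> q) within {z. \<kappa> z $ i \<noteq> 0})"
      unfolding \<pi>0 e0 norm_zero mult_zero_right by (rule Lim_at_imp_Lim_at_within)
    moreover have "\<forall>\<^sub>F z in at (\<phi> q) within {z. \<kappa> z $ i \<noteq> 0}.
        norm (h (\<pi> z) / \<kappa> z $ i - dh (d z)) \<le> norm (d z) * norm (e (\<pi> z))"
    proof -
      have "norm (h (\<pi> z) / \<kappa> z $ i - dh (d z)) \<le> norm (d z) * norm (e (\<pi> z))" if nz: "\<kappa> z $ i \<noteq> 0" for z
      proof -
        have \<pi>: "\<pi> z = \<kappa> z $ i *s d z" by (simp add: \<pi>_def d_def bl_proj_def)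
        have "h (\<pi> z) / \<kappa> z $ i - dh (d z) = (norm (\<pi> z) *\<^sub>R e (\<pi> z)) / \<kappa> z $ i"
          unfolding he[of "\<pi> z"] using nz by (simp add: \<pi> dh(2) add_divide_distrib)
        also have "norm \<dots> = norm (d z) * norm (e (\<pi> z))"
        proof -
          have "norm (\<pi> z) = cmod (\<kappa> z $ i) * norm (d z)"
            unfolding \<pi> norm_vec_def by (simp add: norm_mult L2_set_right_distrib)
          then show ?thesis using nz by (simp add: norm_divide)
        qed
        finally show ?thesis by simp
      qed
      then show ?thesis by (auto simp: eventually_at_filter)
    qed
    ultimately have "((\<lambda>z. h (\<pi> z) / \<kappa> z $ i - dh (d z)) \<longlongrightarrow> 0) (at (\<phi> q) within {z. \<kappa> z $ i \<noteq> 0})"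
      by (rule Lim_null_comparison[rotated])
    moreover have "((\<lambda>z. dh (d z)) \<longlongrightarrow> dh (d (\<phi> q))) (at (\<phi> q) within {z. \<kappa> z $ i \<noteq> 0})"
      by (rule isCont_tendsto_compose[OF cdh Lim_at_imp_Lim_at_within[OF cd[unfolded isCont_def]]])
    ultimately show ?thesis by (rule Lim_transform[rotated])
  qed
  define D where "D = (\<lambda>z. lift_det \<Lambda>0 (\<pi> z) * det (cderiv \<kappa> z))"
  have cD: "isCont D (\<phi> q)" unfolding D_def
  proof (intro continuous_mult)
    have "isCont (lift_det \<Lambda>0) (\<pi> (\<phi> q))"
      by (rule hol_at_imp_continuous[OF hol_at_lift_det[of D0]]) (use L0 D0 \<pi>0 in \<open>auto simp: is_lift_def\<close>)
    then show "isCont (\<lambda>z. lift_det \<Lambda>0 (\<pi> z)) (\<phi> q)" by (rule isCont_o2[OF c\<pi>])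
    have "hol_at (\<lambda>z. cderiv \<kappa> z $ k $ j) (\<phi> q)" for k j by (rule hol_at_cderiv[OF N(1) \<kappa>(1) N(2)])
    then show "isCont (\<lambda>z. det (cderiv \<kappa> z)) (\<phi> q)"
      unfolding det_2 by (intro continuous_intros hol_at_imp_continuous)
  qed
  have D0': "D (\<phi> q) \<noteq> 0" using ld[OF D0] \<kappa>(2)[OF N(2)] by (simp add: D_def \<pi>0)
  define l where "l = (cmod (dh (d (\<phi> q)) / D (\<phi> q)))\<^sup>2 * Re (det (g (U, \<phi>) (\<phi> q)))"
  have lim1: "((\<lambda>z. (cmod (h (\<pi> z) / \<kappa> z $ i / D z))\<^sup>2 * Re (det (g (U, \<phi>) z))) \<longlongrightarrow> l) (at (\<phi> q) within {z. \<kappa> z $ i \<noteq> 0})"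
  proof -
    have "(D \<longlongrightarrow> D (\<phi> q)) (at (\<phi> q) within {z. \<kappa> z $ i \<noteq> 0})"
      using cD unfolding isCont_def by (rule Lim_at_imp_Lim_at_within)
    moreover have "((\<lambda>z. Re (det (g (U, \<phi>) z))) \<longlongrightarrow> Re (det (g (U, \<phi>) (\<phi> q)))) (at (\<phi> q) within {z. \<kappa> z $ i \<noteq> 0})"
      by (rule Lim_at_imp_Lim_at_within[OF cont_g[OF U(1) imageI[OF U(2)], unfolded isCont_def]])
    ultimately show ?thesis unfolding l_def by (intro tendsto_mult tendsto_power tendsto_norm tendsto_divide ratio_lim D0')
  qed
  have f0e: "section_norm (inv_into U \<phi> z) = (cmod (h (\<pi> z) / \<kappa> z $ i / D z))\<^sup>2 * Re (det (g (U, \<phi>) z))" if z: "z \<in> N" for z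
  proof -
    have "section_norm (inv_into U \<phi> z) = density U \<phi> (\<Lambda>0 \<circ> (bl_proj i \<circ> \<kappa>)) z"
      using section_norm_chart[OF U(1) L z] N(3) z by blast
    moreover have "lift_ratio a (\<Lambda>0 \<circ> (bl_proj i \<circ> \<kappa>)) z = lift_ratio a \<Lambda>0 (\<pi> z) / det (cderiv (bl_proj i \<circ> \<kappa>) z)"
      using lift_ratio_compose[OF h\<pi>[OF z], of \<Lambda>0 a] L0 inD[OF z] by (simp add: is_lift_def \<pi>_def)
    moreover have "det (cderiv (bl_proj i \<circ> \<kappa>) z) = \<kappa> z $ i * det (cderiv \<kappa> z)"
      by (simp add: cderiv_compose[OF \<kappa>(1)[OF z] hol_bl_proj] det_mul det_bl_proj)
    ultimately show ?thesis by (simp add: density_def lift_ratio_def h_def D_def field_simps)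
  qed
  have "((\<lambda>z. section_norm (inv_into U \<phi> z)) \<longlongrightarrow> l) (at (\<phi> q) within (N \<inter> {z. \<kappa> z $ i \<noteq> 0}))"
  proof (rule Lim_transform_eventually)
    show "((\<lambda>z. (cmod (h (\<pi> z) / \<kappa> z $ i / D z))\<^sup>2 * Re (det (g (U, \<phi>) z))) \<longlongrightarrow> l) (at (\<phi> q) within (N \<inter> {z. \<kappa> z $ i \<noteq> 0}))"
      by (rule tendsto_within_subset[OF lim1]) auto
  qed (auto simp: eventually_at_filter f0e)
  \<comment> \<open>Inside \<open>N\<close> the points off the exceptional set are those with
    \<open>\<kappa> z $ i \<noteq> 0\<close>, so both filters describe the same approach to
    \<open>\<phi> q\<close>.\<close>
  moreover have "at (\<phi> q) within \<phi> ` (U \<inter> (points X \<inter> p -` (- S))) = at (\<phi> q) within (N \<inter> {z. \<kappa> z $ i \<noteq> 0})"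
  proof (rule at_within_nhd[of _ N])
    show "\<phi> ` (U \<inter> (points X \<inter> p -` (- S))) \<inter> N - {\<phi> q} = N \<inter> {z. \<kappa> z $ i \<noteq> 0} \<inter> N - {\<phi> q}"
    proof -
      have "z \<in> \<phi> ` (U \<inter> (points X \<inter> p -` (- S))) \<longleftrightarrow> \<kappa> z $ i \<noteq> 0" if z: "z \<in> N" for z
      proof -
        obtain x where x: "x \<in> U" "z = \<phi> x" using z N(3) by blast
        have "z \<in> \<phi> ` (U \<inter> (points X \<inter> p -` (- S))) \<longleftrightarrow> p x \<notin> S"
          using x inj complex_atlasD(3)[OF atlas_X U(1)] by (auto simp: inj_on_eq_iff)
        moreover have "inv_into U \<phi> z = x" using x inj by simp
        ultimately have "z \<in> \<phi> ` (U \<inter> (points X \<inter> p -` (- S))) \<longleftrightarrow> p (inv_into U \<phi> z) \<notin> S" by simp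
        then show ?thesis using E[OF z] by simp
      qed
      then show ?thesis by blast
    qed
  qed (use N in auto)
  ultimately show ?thesis using limitin_chart[OF atlas_X U] by metis
qed

text \<open>At an exceptional point a direction is generic if the derivative of
  \<open>\<kappa> z $ i\<close> along it is nonzero. The line then crosses the exceptional curve
  transversally, and nearby it meets the curve only at the point itself. At other points every
  direction qualifies.\<close>

lemma generic_lines:
  assumes U: "(U, \<phi>) \<in> X" and z: "z \<in> \<phi> ` U"
  obtains G where "closure G = UNIV"
    "\<And>\<xi>. \<xi> \<in> G \<Longrightarrow> \<forall>\<^sub>F \<zeta> in at 0. z + \<zeta> *s \<xi> \<in> \<phi> ` U \<and> p (inv_into U \<phi> (z + \<zeta> *s \<xi>)) \<notin> S"
proof -
  have inj: "inj_on \<phi> U" by (rule complex_atlasD(1)[OF atlas_X U(1)])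
  obtain q where q: "q \<in> U" "z = \<phi> q" using z by blast
  show thesis
  proof (cases "p q \<in> S")
    case False
    define V where "V = \<phi> ` (U \<inter> p -` (points projective_plane - S))"
    have "open V" unfolding V_def by (rule open_chart_preimage[OF atlas_X U cont_p openin_diff_S[OF finite_S]])
    moreover have "z \<in> V" using q False p_in complex_atlasD(3)[OF atlas_X U] by (auto simp: V_def points_projective_plane)
    ultimately have "\<forall>\<^sub>F \<zeta> in at 0. z + \<zeta> *s \<xi> \<in> V" for \<xi> using topological_tendstoD[OF tendsto_line] by blast
    then have "\<forall>\<^sub>F \<zeta> in at 0. z + \<zeta> *s \<xi> \<in> \<phi> ` U \<and> p (inv_into U \<phi> (z + \<zeta> *s \<xi>)) \<notin> S" for \<xi>
      by (rule eventually_mono) (use inj in \<open>auto simp: V_def\<close>)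
    then show thesis using that[of UNIV] by simp
  next
    case True
    obtain N \<kappa> i P0 D0 \<Lambda>0 where N: "open N" "\<phi> q \<in> N" "N \<subseteq> \<phi> ` U"
      and \<kappa>: "\<And>z. z \<in> N \<Longrightarrow> hol_map_at \<kappa> z" "\<And>z. z \<in> N \<Longrightarrow> det (cderiv \<kappa> z) \<noteq> 0" "\<kappa> (\<phi> q) $ i = 0"
      and E: "\<And>z. z \<in> N \<Longrightarrow> \<kappa> z $ i = 0 \<longleftrightarrow> p (inv_into U \<phi> z) \<in> S"
      and "is_lift P0 D0 \<Lambda>0"
      by (rule exceptional_chart[OF U q(1) True]) blast
    define G where "G = {\<xi>. (cderiv \<kappa> z *v \<xi>) $ i \<noteq> 0}"
    have "closure G = UNIV" unfolding G_def using \<kappa>(2) N q by (intro dense_nonzero_functional) auto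
    moreover have "\<forall>\<^sub>F \<zeta> in at 0. z + \<zeta> *s \<xi> \<in> \<phi> ` U \<and> p (inv_into U \<phi> (z + \<zeta> *s \<xi>)) \<notin> S" if \<xi>: "\<xi> \<in> G" for \<xi>
    proof -
      have zN: "z \<in> N" using N q by simp
      have "hol_at (\<lambda>x. \<kappa> x $ i) (z + 0 *s \<xi>)" using \<kappa>(1)[OF zN] by (simp add: hol_map_at_def)
      from hol_at_line[OF this]
      have "((\<lambda>\<zeta>. \<kappa> (z + \<zeta> *s \<xi>) $ i) has_field_derivative (cderiv \<kappa> z *v \<xi>) $ i) (at 0)"
        by (simp add: matrix_vector_mult_def cderiv_component[OF \<kappa>(1)[OF zN]])
      then have "((\<lambda>\<zeta>. \<kappa> (z + \<zeta> *s \<xi>) $ i / \<zeta>) \<longlongrightarrow> (cderiv \<kappa> z *v \<xi>) $ i) (at 0)"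
        by (simp add: has_field_derivative_iff \<kappa>(3) flip: q(2))
           (simp add: q(2) \<kappa>(3))
      then have "\<forall>\<^sub>F \<zeta> in at 0. \<kappa> (z + \<zeta> *s \<xi>) $ i / \<zeta> \<noteq> 0"
        using \<xi> by (intro tendsto_imp_eventually_ne) (auto simp: G_def)
      moreover have "\<forall>\<^sub>F \<zeta> in at 0. z + \<zeta> *s \<xi> \<in> N" using topological_tendstoD[OF tendsto_line N(1) zN] .
      ultimately show ?thesis by eventually_elim (use E N(3) in auto)
    qed
    ultimately show thesis by (rule that)
  qed
qed

text \<open>Through every point there is a generic line, and it leaves the exceptional curves at
  once.\<close>

lemma closure_off_S: "TX closure_of (points X \<inter> p -` (- S)) = points X"
proof
  show "TX closure_of (points X \<inter> p -` (- S)) \<subseteq> points X"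
    using closure_of_subset_topspace by (metis topspace_X)
  show "points X \<subseteq> TX closure_of (points X \<inter> p -` (- S))"
  proof
    fix q assume q: "q \<in> points X"
    obtain U \<phi> where U: "(U, \<phi>) \<in> X" "q \<in> U" using q by (auto simp: points_def)
    have inj: "inj_on \<phi> U" by (rule complex_atlasD(1)[OF atlas_X U(1)])
    obtain G where G: "closure G = UNIV"
      "\<And>\<xi>. \<xi> \<in> G \<Longrightarrow> \<forall>\<^sub>F \<zeta> in at 0. \<phi> q + \<zeta> *s \<xi> \<in> \<phi> ` U \<and> p (inv_into U \<phi> (\<phi> q + \<zeta> *s \<xi>)) \<notin> S"
      using generic_lines[OF U(1), of "\<phi> q"] U(2) by blast
    obtain \<xi> where \<xi>: "\<xi> \<in> G" using G(1) by fastforce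
    show "q \<in> TX closure_of (points X \<inter> p -` (- S))"
      unfolding in_closure_of
    proof (intro conjI allI impI)
      fix T assume T: "q \<in> T \<and> openin TX T"
      then have "open (\<phi> ` (T \<inter> U))" using U by (auto simp: openin_atlas_topology[OF atlas_X])
      then have "\<forall>\<^sub>F \<zeta> in at 0. \<phi> q + \<zeta> *s \<xi> \<in> \<phi> ` (T \<inter> U)"
        by (rule topological_tendstoD[OF tendsto_line]) (use T U in blast)
      with G(2)[OF \<xi>] have "\<forall>\<^sub>F \<zeta> in at (0::complex). \<exists>x. x \<in> points X \<inter> p -` (- S) \<and> x \<in> T"
      proof eventually_elim
        case (elim \<zeta>)
        then obtain x where "x \<in> T" "x \<in> U" "\<phi> q + \<zeta> *s \<xi> = \<phi> x" by auto
        then show ?case using elim inj complex_atlasD(3)[OF atlas_X U(1)] by auto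
      qed
      then show "\<exists>x. x \<in> points X \<inter> p -` (- S) \<and> x \<in> T"
        using eventually_happens trivial_limit_at by blast
    qed (use q in \<open>simp add: topspace_X\<close>)
  qed
qed

text \<open>Because the real line is regular, a limit at each missing point, taken along the dense
  set off the exceptional curves, already yields a continuous extension.\<close>

lemma section_norm_exists:
  obtains f where "continuous_map TX euclideanreal f" "\<And>x. x \<in> points X \<Longrightarrow> p x \<notin> S \<Longrightarrow> f x = section_norm x"
proof -
  let ?A = "points X \<inter> p -` (- S)"
  have "continuous_map (subtopology TX ?A) euclideanreal section_norm"
    unfolding continuous_map_atin
    using section_norm_limit_regular by (auto simp: atin_subtopology_within topspace_X)
  moreover have "\<exists>l. limitin euclideanreal section_norm l (atin_within TX x ?A)" if "x \<in> points X - ?A" for x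
    using that section_norm_limit_exceptional[of x] by auto
  moreover have "?A \<subseteq> points X" "points X \<subseteq> TX closure_of ?A" by (auto simp: closure_off_S)
  ultimately obtain f where "continuous_map (subtopology TX (points X)) euclideanreal f" "\<And>x. x \<in> ?A \<Longrightarrow> f x = section_norm x"
    using continuous_map_extension_pointwise_alt[where S = ?A and T = "points X" and X = TX and Y = euclideanreal and f = section_norm]
      regular_space_euclidean by blast
  then show thesis using that[of f] by (auto simp flip: topspace_X)
qed

end

section \<open>Compactness of the blown-up plane\<close>

lemma compact_polydisc: "compact {u :: complex^'n. \<forall>k. cmod (u $ k) \<le> 1}"
proof (rule compact_eq_bounded_closed[THEN iffD2], intro conjI)
  show "bounded {u :: complex^'n. \<forall>k. cmod (u $ k) \<le> 1}"
    unfolding bounded_iff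
  proof (intro exI ballI)
    fix u :: "complex^'n" assume u: "u \<in> {u. \<forall>k. cmod (u $ k) \<le> 1}"
    have "norm u \<le> (\<Sum>k\<in>UNIV. cmod (u $ k))" unfolding norm_vec_def by (rule L2_set_le_sum) simp
    also have "\<dots> \<le> (\<Sum>k\<in>(UNIV :: 'n set). 1)" using u by (intro sum_mono) auto
    finally show "norm u \<le> (\<Sum>k\<in>(UNIV :: 'n set). 1)" .
  qed
  have "{u :: complex^'n. \<forall>k. cmod (u $ k) \<le> 1} = (\<Inter>k. {u. cmod (u $ k) \<le> 1})" by auto
  moreover have "closed {u :: complex^'n. cmod (u $ k) \<le> 1}" for k
    by (intro closed_Collect_le continuous_intros)
  ultimately show "closed {u :: complex^'n. \<forall>k. cmod (u $ k) \<le> 1}" by auto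
qed

text \<open>Since a line can be normalised by its largest coordinate, the pieces for all
  \<open>i\<close> together cover the part of the local model over a closed ball.\<close>

lemma compact_bl_piece: "compact {y :: complex^'n. norm (bl_proj i y) \<le> r \<and> (\<forall>k. k \<noteq> i \<longrightarrow> cmod (y $ k) \<le> 1)}" (is "compact ?C")
proof (rule compact_eq_bounded_closed[THEN iffD2], intro conjI)
  show "bounded ?C"
    unfolding bounded_iff
  proof (intro exI ballI)
    fix u :: "complex^'n" assume u: "u \<in> ?C"
    have "cmod (u $ i) = cmod (bl_proj i u $ i)" by (simp add: bl_proj_def)
    also have "\<dots> \<le> norm (bl_proj i u)" by (rule Finite_Cartesian_Product.norm_nth_le)
    also have "\<dots> \<le> r" using u by simp
    finally have "cmod (u $ i) \<le> r" .
    then have "cmod (u $ k) \<le> max r 1" for k using u by (cases "k = i") auto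
    then have "(\<Sum>k\<in>UNIV. cmod (u $ k)) \<le> (\<Sum>k\<in>(UNIV :: 'n set). max r 1)" by (intro sum_mono)
    moreover have "norm u \<le> (\<Sum>k\<in>UNIV. cmod (u $ k))" unfolding norm_vec_def by (rule L2_set_le_sum) simp
    ultimately show "norm u \<le> (\<Sum>k\<in>(UNIV :: 'n set). max r 1)" by linarith
  qed
  have "?C = {u. norm (bl_proj i u) \<le> r} \<inter> (\<Inter>k\<in>-{i}. {u. cmod (u $ k) \<le> 1})" by auto
  moreover have "closed {u :: complex^'n. cmod (u $ k) \<le> 1}" for k
    by (intro closed_Collect_le continuous_intros)
  moreover have "continuous_on UNIV (bl_proj i :: complex^'n \<Rightarrow> _)"
    by (intro continuous_at_imp_continuous_on ballI hol_map_at_imp_continuous hol_bl_proj)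
  then have "closed {u. norm (bl_proj i u) \<le> r}"
    by (intro closed_Collect_le continuous_intros)
  ultimately show "closed ?C" by (auto intro!: closed_Int)
qed

lemma openin_single_atlas:
  assumes "open V" "open B" "B \<subseteq> V"
  shows "openin (atlas_topology {(V, id)}) B"
  using assms by (simp add: openin_atlas_topology[OF complex_atlas_single] points_def Int_absorb2)

lemma compact_projective_plane: "compact_space (atlas_topology projective_plane)"
proof -
  let ?T = "atlas_topology projective_plane"
  let ?K = "{u :: complex^2. \<forall>k. cmod (u $ k) \<le> 1}"
  have "compactin ?T (inv_into (affine_piece i) (affine_chart i) ` ?K)" for i
  proof (rule image_compactin)
    show "compactin (top_of_set (affine_chart i ` affine_piece i)) ?K"
      by (simp add: bij_affine_chart(2) compact_polydisc)
    show "continuous_map (top_of_set (affine_chart i ` affine_piece i)) ?T (inv_into (affine_piece i) (affine_chart i))"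
      by (rule continuous_map_inv_chart[OF complex_atlas_projective_plane]) (auto simp: projective_plane_eq)
  qed
  then have "compactin ?T (\<Union>i. inv_into (affine_piece i) (affine_chart i) ` ?K)"
    by (intro compactin_Union) auto
  moreover have "topspace ?T = (\<Union>i. inv_into (affine_piece i) (affine_chart i) ` ?K)"
  proof
    show "topspace ?T \<subseteq> (\<Union>i. inv_into (affine_piece i) (affine_chart i) ` ?K)"
    proof
      fix l assume "l \<in> topspace ?T"
      then have "l \<in> proj_space"
        by (simp add: topspace_atlas_topology[OF complex_atlas_projective_plane] points_projective_plane)
      then obtain i where i: "l \<in> affine_piece i" "\<And>k. cmod (affine_rep i l $ k) \<le> 1"
        using bounded_affine_rep by metis
      have "affine_chart i l \<in> ?K" using i(2) by (auto simp: affine_chart_def forall_2)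
      moreover have "l = inv_into (affine_piece i) (affine_chart i) (affine_chart i l)"
        using i(1) bij_affine_chart(1) by simp
      ultimately show "l \<in> (\<Union>i. inv_into (affine_piece i) (affine_chart i) ` ?K)" by blast
    qed
    show "(\<Union>i. inv_into (affine_piece i) (affine_chart i) ` ?K) \<subseteq> topspace ?T"
      using calculation by (rule compactin_subset_topspace)
  qed
  ultimately show ?thesis by (simp add: compact_space_def)
qed

context blown_up_plane
begin

text \<open>Properness of \<open>p\<close> at a centre: in the local model the part over a closed
  ball is covered by finitely many compact pieces, and \<open>F\<close> carries them back to
  \<open>X\<close>.\<close>

lemma compact_nbhd:
  assumes s: "s \<in> S"
  obtains V K where "openin TP V" "s \<in> V" "compactin TX K" "points X \<inter> p -` V \<subseteq> K"
proof -
  obtain W and \<tau> :: "(complex^3) set \<Rightarrow> complex^2" and F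
    where W12: "openin TP W" "s \<in> W" and WP: "W \<subseteq> proj_space" and W34: "\<tau> s = 0" "open (\<tau> ` W)"
    and inj\<tau>: "inj_on \<tau> W" and ptsP: "points (restrict_atlas projective_plane W) = W"
    and b1: "biholomorphism (restrict_atlas projective_plane W) {(\<tau> ` W, id)} \<tau>"
    and b2: "biholomorphism (restrict_atlas X (p -` W)) (restrict_atlas blowup_origin (fst -` (\<tau> ` W))) F"
    and F: "\<forall>x\<in>points X. p x \<in> W \<longrightarrow> fst (F x) = \<tau> (p x)"
    and aP: "complex_atlas (restrict_atlas projective_plane W)"
    and aV: "complex_atlas {(\<tau> ` W, id)}"
    and aX: "complex_atlas (restrict_atlas X (p -` W))"
    and oX: "openin TX (points X \<inter> p -` W)"
    and aB: "complex_atlas (restrict_atlas blowup_origin (fst -` (\<tau> ` W)))"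
    by (rule local_model[OF s]) (rule that)
  have "0 \<in> \<tau> ` W" using W12(2) W34(1) by force
  then obtain r where r: "r > 0" "cball 0 r \<subseteq> \<tau> ` W" using W34(2) open_contains_cball by blast
  define V where "V = {l \<in> W. \<tau> l \<in> ball 0 r}"
  have WP': "points projective_plane \<inter> W = W" using WP by (auto simp: points_projective_plane)
  have "continuous_map (atlas_topology (restrict_atlas projective_plane W)) (atlas_topology {(\<tau> ` W, id)}) \<tau>"
    using b1 by (simp add: biholomorphism_def holomorphic_between_def)
  from openin_continuous_map_preimage[OF this openin_single_atlas[OF W34(2) open_ball, of 0 r]]
  have "openin (atlas_topology (restrict_atlas projective_plane W)) V"
    using r by (simp add: V_def topspace_atlas_topology[OF aP] ptsP subset_iff)
  moreover have "atlas_topology (restrict_atlas projective_plane W) = subtopology TP W"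
    by (rule atlas_topology_restrict[OF atlas_P]) (simp add: WP' W12)
  ultimately have oV: "openin TP V" using openin_open_subtopology[OF W12(1)] by simp
  have sV: "s \<in> V" using W12 W34 r by (simp add: V_def)
  let ?A = "points X \<inter> p -` W"
  let ?B = "\<lambda>i. bl_domain i \<inter> fst -` (\<tau> ` W)"
  let ?C = "\<lambda>i. {y :: complex^2. norm (bl_proj i y) \<le> r \<and> (\<forall>k. k \<noteq> i \<longrightarrow> cmod (y $ k) \<le> 1)}"
  have ptsX: "points (restrict_atlas X (p -` W)) = ?A" by (simp add: points_restrict_atlas)
  have bijF: "inj_on F ?A" using b2 by (simp add: biholomorphism_def ptsX bij_betw_def)
  have cF: "continuous_map (atlas_topology (restrict_atlas blowup_origin (fst -` (\<tau> ` W)))) (subtopology TX (p -` W)) (inv_into ?A F)"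
    using b2 atlas_topology_restrict[OF atlas_X oX] by (simp add: biholomorphism_def holomorphic_between_def ptsX)
  have Bi: "(?B i, bl_chart i) \<in> restrict_atlas blowup_origin (fst -` (\<tau> ` W))" for i
    by (rule restrict_atlasI) (auto simp: blowup_origin_eq)
  have CB: "?C i \<subseteq> bl_chart i ` ?B i" for i
  proof
    fix y assume "y \<in> ?C i"
    then have "bl_proj i y \<in> \<tau> ` W" using r by auto
    then have "bl_inv i y \<in> ?B i" using bl_inv_in_domain[of i y] by (auto simp: bl_inv_def)
    then show "y \<in> bl_chart i ` ?B i" by (rule image_eqI[rotated]) (simp add: bl_chart_inv)
  qed
  define H where "H = (\<lambda>i. inv_into ?A F \<circ> inv_into (?B i) (bl_chart i))"
  have "compactin TX (H i ` ?C i)" for i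
  proof -
    have "compactin (top_of_set (bl_chart i ` ?B i)) (?C i)"
      using CB[of i] compact_bl_piece[of i r] by (simp add: compactin_subtopology)
    moreover have "continuous_map (top_of_set (bl_chart i ` ?B i)) (subtopology TX (p -` W)) (H i)"
      unfolding H_def by (rule continuous_map_compose[OF continuous_map_inv_chart[OF aB Bi] cF])
    ultimately have "compactin (subtopology TX (p -` W)) (H i ` ?C i)" by (rule image_compactin)
    then show ?thesis by (simp add: compactin_subtopology)
  qed
  then have "compactin TX (\<Union>i. H i ` ?C i)" by (intro compactin_Union) auto
  moreover have "points X \<inter> p -` V \<subseteq> (\<Union>i. H i ` ?C i)"
  proof
    fix x assume x: "x \<in> points X \<inter> p -` V"
    then have xA: "x \<in> ?A" by (auto simp: V_def)
    have fst: "fst (F x) = \<tau> (p x)" using F xA by auto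
    have "F x \<in> points (restrict_atlas blowup_origin (fst -` (\<tau> ` W)))"
      using b2 xA by (auto simp: biholomorphism_def ptsX bij_betw_def)
    then obtain z l where zl: "F x = (z, l)" "l \<in> proj_space" "z \<in> l" "z \<in> \<tau> ` W"
      by (auto simp: points_restrict_atlas points_blowup_origin)
    obtain i where i: "l \<in> affine_piece i" "\<And>k. cmod (affine_rep i l $ k) \<le> 1"
      using bounded_affine_rep[OF zl(2)] by metis
    have FB: "F x \<in> ?B i" using zl i by (simp add: bl_domain_def)
    have inj: "inj_on (bl_chart i) (?B i)" using bij_bl_chart(1) inj_on_subset by blast
    define y where "y = bl_chart i (F x)"
    have "bl_proj i y = z" using bl_inv_chart[of "F x" i] FB zl(1) by (simp add: y_def bl_inv_def)
    then have "norm (bl_proj i y) \<le> r" using x zl(1) fst by (simp add: V_def)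
    moreover have "cmod (y $ k) \<le> 1" if "k \<noteq> i" for k using that i(2) by (simp add: y_def zl(1) bl_chart_def)
    ultimately have "y \<in> ?C i" by simp
    moreover have "H i y = x" using inj FB bijF xA by (simp add: H_def y_def)
    ultimately show "x \<in> (\<Union>i. H i ` ?C i)" by blast
  qed
  ultimately show thesis using that oV sV by blast
qed

definition p_inverse :: "(complex^3) set \<Rightarrow> 'a" where
  "p_inverse = inv_into (points X \<inter> p -` (- S)) p"

lemma
  shows continuous_map_p_inverse: "continuous_map (subtopology TP (- S)) (subtopology TX (p -` (- S))) p_inverse"
    and p_p_inverse: "l \<in> proj_space \<Longrightarrow> l \<notin> S \<Longrightarrow> p_inverse l \<in> points X \<and> p (p_inverse l) = l"
    and p_inverse_p: "x \<in> points X \<Longrightarrow> p x \<notin> S \<Longrightarrow> p_inverse (p x) = x"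
proof -
  have PS: "points projective_plane \<inter> - S = points projective_plane - S" by auto
  have pts: "points (restrict_atlas X (p -` (- S))) = points X \<inter> p -` (- S)"
    "points (restrict_atlas projective_plane (- S)) = proj_space \<inter> - S"
    by (simp_all add: points_restrict_atlas points_projective_plane)
  have bi: "biholomorphism (restrict_atlas X (p -` (- S))) (restrict_atlas projective_plane (- S)) p"
    using blowup by (simp add: is_blowup_def)
  have T: "atlas_topology (restrict_atlas projective_plane (- S)) = subtopology TP (- S)"
    by (rule atlas_topology_restrict[OF atlas_P]) (simp add: PS openin_diff_S finite_S)
  show "continuous_map (subtopology TP (- S)) (subtopology TX (p -` (- S))) p_inverse"
    using bi unfolding biholomorphism_def holomorphic_between_def pts T atlas_topology_restrict[OF atlas_X openin_off_S] p_inverse_def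
    by blast
  have bij: "bij_betw p (points X \<inter> p -` (- S)) (proj_space \<inter> - S)"
    using bi by (simp add: biholomorphism_def pts)
  show "p_inverse l \<in> points X \<and> p (p_inverse l) = l" if "l \<in> proj_space" "l \<notin> S"
  proof -
    have "l \<in> p ` (points X \<inter> p -` (- S))" using bij that by (simp add: bij_betw_def)
    from inv_into_into[OF this] f_inv_into_f[OF this] show ?thesis by (simp add: p_inverse_def)
  qed
  show "p_inverse (p x) = x" if "x \<in> points X" "p x \<notin> S"
    using bij that by (simp add: p_inverse_def bij_betw_def)
qed

text \<open>The neighbourhoods of the centres are handled by \<open>compact_nbhd\<close>. Their
  complement in the plane is a compact set disjoint from \<open>S\<close>, on which \<open>p\<close>
  has a continuous inverse.\<close>

lemma compact_X: "compactin TX (points X)"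
proof -
  have "\<forall>s\<in>S. \<exists>V K. openin TP V \<and> s \<in> V \<and> compactin TX K \<and> points X \<inter> p -` V \<subseteq> K"
  proof
    fix s assume s: "s \<in> S"
    show "\<exists>V K. openin TP V \<and> s \<in> V \<and> compactin TX K \<and> points X \<inter> p -` V \<subseteq> K"
      by (rule compact_nbhd[OF s]) blast
  qed
  then obtain V K where VK: "\<And>s. s \<in> S \<Longrightarrow> openin TP (V s)" "\<And>s. s \<in> S \<Longrightarrow> s \<in> V s"
    "\<And>s. s \<in> S \<Longrightarrow> compactin TX (K s)" "\<And>s. s \<in> S \<Longrightarrow> points X \<inter> p -` V s \<subseteq> K s"
    by metis
  define L where "L = topspace TP - (\<Union>s\<in>S. V s)"
  have "closedin TP L" unfolding L_def using VK(1) by (intro closedin_diff closedin_topspace openin_Union) auto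
  then have "compactin TP L" using compact_projective_plane closedin_compact_space by blast
  moreover have "L \<subseteq> - S" using VK(2) by (auto simp: L_def)
  ultimately have "compactin (subtopology TP (- S)) L" by (simp add: compactin_subtopology)
  from image_compactin[OF this continuous_map_p_inverse]
  have cL: "compactin TX (p_inverse ` L)" by (simp add: compactin_subtopology)
  have c: "compactin TX (p_inverse ` L \<union> \<Union> (K ` S))"
    by (intro compactin_Un cL compactin_Union) (use finite_S VK(3) in auto)
  have "points X \<subseteq> p_inverse ` L \<union> \<Union> (K ` S)"
  proof
    fix x assume x: "x \<in> points X"
    show "x \<in> p_inverse ` L \<union> \<Union> (K ` S)"
    proof (cases "\<exists>s\<in>S. p x \<in> V s")
      case True
      then show ?thesis using VK(4) x by blast
    next
      case False
      then have "p x \<in> L" "p x \<notin> S" using p_in[OF x] VK(2) by (auto simp: L_def topspace_P)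
      then show ?thesis using p_inverse_p[OF x] by (metis UnI1 imageI)
    qed
  qed
  moreover have "p_inverse ` L \<union> \<Union> (K ` S) \<subseteq> points X" using compactin_subset_topspace[OF c] by (simp add: topspace_X)
  ultimately have "points X = p_inverse ` L \<union> \<Union> (K ` S)" by (rule subset_antisym)
  with c show ?thesis by (simp only:)
qed

text \<open>Turns a path of nonzero vectors into a path in the plane, for the connectedness argument
  at the end.\<close>

lemma continuous_map_span: "continuous_map (top_of_set (- {0})) TP (\<lambda>w. vec.span {w})"
  unfolding continuous_map_def
proof (intro conjI allI impI)
  show "(\<lambda>w. vec.span {w}) \<in> topspace (top_of_set (- {0})) \<rightarrow> topspace TP"
    by (auto simp: topspace_P span_in_proj_space)
  fix T assume T: "openin TP T"
  define Q where "Q = (\<lambda>i. {w :: complex^3. w $ i \<noteq> 0} \<inter> (\<lambda>w. vector [w $ (i + 1) / w $ i, w $ (i + 2) / w $ i]) -` (affine_chart i ` (T \<inter> affine_piece i)))"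
  have "open (Q i)" for i
    unfolding Q_def
  proof (rule continuous_open_preimage)
    show "open {w :: complex^3. w $ i \<noteq> 0}" by (intro open_Collect_neq continuous_intros)
    show "open (affine_chart i ` (T \<inter> affine_piece i))"
      using T affine_chart_in_atlas[of i] by (auto simp: openin_atlas_topology[OF atlas_P])
    have v: "vector [x, y] = (\<chi> k::2. if k = 1 then x else y)" for x y :: complex
      by (simp add: vec_eq_iff forall_2)
    show "continuous_on {w :: complex^3. w $ i \<noteq> 0} (\<lambda>w. vector [w $ (i + 1) / w $ i, w $ (i + 2) / w $ i] :: complex^2)"
      unfolding v
    proof (rule continuous_on_vec_lambda)
      show "continuous_on {w :: complex^3. w $ i \<noteq> 0} (\<lambda>w. if k = 1 then w $ (i + 1) / w $ i else w $ (i + 2) / w $ i)" for k :: 2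
        by (cases "k = 1") (auto intro!: continuous_intros)
    qed
  qed
  moreover have "{w \<in> topspace (top_of_set (- {0})). vec.span {w} \<in> T} = (\<Union>i. Q i)"
  proof -
    have Q: "w \<in> Q i \<longleftrightarrow> vec.span {w} \<in> T" if "w $ i \<noteq> 0" for w i
    proof -
      have "vector [w $ (i + 1) / w $ i, w $ (i + 2) / w $ i] = affine_chart i (vec.span {w})"
        using that by (simp add: affine_chart_def affine_rep_span vec_eq_iff forall_2)
      moreover have "vec.span {w} \<in> affine_piece i" using that by (simp add: span_in_affine_piece)
      ultimately show ?thesis using that bij_affine_chart(1)[of i] by (auto simp: Q_def inj_on_eq_iff)
    qed
    show ?thesis
    proof (intro equalityI subsetI)
      fix w assume w: "w \<in> {w \<in> topspace (top_of_set (- {0})). vec.span {w} \<in> T}"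
      then obtain i where "w $ i \<noteq> 0" by (auto simp: vec_eq_iff)
      then show "w \<in> (\<Union>i. Q i)" using Q w by blast
    next
      fix w assume "w \<in> (\<Union>i. Q i)"
      then obtain i where i: "w \<in> Q i" by blast
      then have "w $ i \<noteq> 0" by (simp add: Q_def)
      then show "w \<in> {w \<in> topspace (top_of_set (- {0})). vec.span {w} \<in> T}" using Q i by auto
    qed
  qed
  moreover have "openin (top_of_set (- {0})) (\<Union>i. Q i)"
    using \<open>\<And>i. open (Q i)\<close> by (intro open_subset) (auto simp: Q_def)
  ultimately show "openin (top_of_set (- {0})) {w \<in> topspace (top_of_set (- {0})). vec.span {w} \<in> T}"
    by (simp only:)
qed

end

text \<open>
  Only finitely many of the lines through \<open>[w]\<close> spanned by the vectors \<open>e\<^sub>1 + c e\<^sub>2\<close> can meet \<open>S\<close>,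
  because distinct \<open>c\<close> give lines that meet in \<open>[w]\<close> only.
\<close>

lemma line_avoiding_finite:
  fixes w :: "complex^3" and S :: "(complex^3) set set"
  assumes "finite S" "w $ k \<noteq> 0"
  obtains u where "u $ k = 0" "u \<noteq> 0" "\<And>b. vec.span {u + b *s w} \<notin> S"
proof -
  define u :: "complex \<Rightarrow> complex^3" where "u = (\<lambda>c. axis (k + 1) 1 + c *s axis (k + 2) 1)"
  have u: "u c $ k = 0" "u c $ (k + 1) = 1" "u c $ (k + 2) = c" for c
    using index3(1-3)[of k] by (auto simp: u_def axis_def)
  define Bad where "Bad = {c. \<exists>b. vec.span {u c + b *s w} \<in> S}"
  define \<sigma> where "\<sigma> = (\<lambda>c. SOME l. l \<in> S \<and> (\<exists>b. l = vec.span {u c + b *s w}))"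
  have \<sigma>: "\<sigma> c \<in> S \<and> (\<exists>b. \<sigma> c = vec.span {u c + b *s w})" if "c \<in> Bad" for c
    unfolding \<sigma>_def by (rule someI_ex) (use that in \<open>auto simp: Bad_def\<close>)
  \<comment> \<open>Where two of these lines share a point, the coordinate \<open>k\<close> gives
    \<open>b = t * b'\<close>, so the multiples of \<open>w\<close> cancel. The coordinate
    \<open>k + 1\<close> then gives \<open>t = 1\<close>, and \<open>k + 2\<close> gives
    \<open>c = c'\<close>.\<close>
  have "inj_on \<sigma> Bad"
  proof (rule inj_onI)
    fix c c' assume c: "c \<in> Bad" "c' \<in> Bad" "\<sigma> c = \<sigma> c'"
    obtain b b' where "vec.span {u c + b *s w} = vec.span {u c' + b' *s w}" using \<sigma>[OF c(1)] \<sigma>[OF c(2)] c(3) by metis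
    then have "u c + b *s w \<in> vec.span {u c' + b' *s w}" using vec.span_base by blast
    then obtain t where t: "u c + b *s w = t *s (u c' + b' *s w)" by (auto simp: span_single)
    then have e: "u c $ j + b * w $ j = t * (u c' $ j + b' * w $ j)" for j
      by (metis vector_add_component vector_smult_component)
    have "b = t * b'" using e[of k] assms(2) by (simp add: u)
    then have e': "u c $ j = t * u c' $ j" for j using e[of j] by (simp add: algebra_simps)
    show "c = c'" using e'[of "k + 1"] e'[of "k + 2"] by (simp add: u)
  qed
  then have "finite Bad" using \<sigma> \<open>finite S\<close> inj_on_finite[of \<sigma> Bad S] by blast
  then obtain c where "c \<notin> Bad" using ex_new_if_finite infinite_UNIV_char_0 by blast
  moreover have "u c \<noteq> 0" using u(2)[of c] by auto
  ultimately show thesis using that[of "u c"] u(1) by (auto simp: Bad_def)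
qed

section \<open>The maximum of the norm and the contradiction\<close>

context anticanonical_section
begin

lemma section_norm_vanishing:
  assumes x: "x \<in> points X" "p x \<notin> S" and w: "w \<in> p x" "w \<noteq> 0"
  shows "section_norm x \<ge> 0" "section_norm x = 0 \<longleftrightarrow> cubic a w = 0"
proof -
  obtain U \<phi> where U: "(U, \<phi>) \<in> X" "x \<in> U" using x by (auto simp: points_def)
  obtain i where i: "p x \<in> affine_piece i" by (rule piece_exists[OF x(1)])
  have inj: "inj_on \<phi> U" by (rule complex_atlasD(1)[OF atlas_X U(1)])
  define \<Lambda> where "\<Lambda> = std_lift U \<phi> i"
  have xN: "\<phi> x \<in> \<phi> ` (U \<inter> p -` affine_piece i)" using U i by auto
  have L: "is_lift (p \<circ> inv_into U \<phi>) (\<phi> ` (U \<inter> p -` affine_piece i)) \<Lambda>" unfolding \<Lambda>_def by (rule is_lift_std[OF U(1)])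
  have nz: "lift_det \<Lambda> (\<phi> x) \<noteq> 0" unfolding \<Lambda>_def
    by (rule lift_det_std[OF U(1) xN]) (use x U inj in simp)
  have "(p \<circ> inv_into U \<phi>) (\<phi> x) = vec.span {\<Lambda> (\<phi> x)}" using L xN unfolding is_lift_def by blast
  then have "p x = vec.span {\<Lambda> (\<phi> x)}" using inj U by simp
  then obtain c where c: "w = c *s \<Lambda> (\<phi> x)" using w(1) by (auto simp: span_single)
  have "c \<noteq> 0" using c w(2) by auto
  have f: "section_norm x = density U \<phi> \<Lambda> (\<phi> x)" by (rule section_norm_eq[OF U L xN])
  have d: "Re (det (g (U, \<phi>) (\<phi> x))) > 0" using hermitian_pos_def_2(5)[OF posdef_g[OF U(1)]] U(2) by blast
  show "section_norm x \<ge> 0" using d by (simp add: f density_def)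
  show "section_norm x = 0 \<longleftrightarrow> cubic a w = 0"
    using d nz \<open>c \<noteq> 0\<close> by (simp add: f density_def lift_ratio_def c cubic_smult)
qed

text \<open>Supplies the hypothesis \<open>lines\<close> of the maximum principle. \<open>H\<close>
  is the coefficient of the section restricted to a generic line; in a small punctured disc the line
  avoids the exceptional curves, so \<open>lift_det\<close> has no zero there and \<open>H\<close>
  is holomorphic.\<close>

lemma section_norm_lines:
  assumes f: "\<And>x. x \<in> points X \<Longrightarrow> p x \<notin> S \<Longrightarrow> f x = section_norm x"
    and U: "(U, \<phi>) \<in> X" and z: "z \<in> \<phi> ` U"
  shows "\<exists>G. closure G = UNIV \<and> (\<forall>\<xi>\<in>G. \<exists>r>0. \<exists>H. H holomorphic_on (ball 0 r - {0}) \<and>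
      (\<forall>\<zeta>\<in>ball 0 r - {0}. f (inv_into U \<phi> (z + \<zeta> *s \<xi>)) = (cmod (H \<zeta>))\<^sup>2 * Re (det (g (U, \<phi>) (z + \<zeta> *s \<xi>)))))"
proof -
  have UX: "U \<subseteq> points X" by (rule complex_atlasD(3)[OF atlas_X U])
  obtain G where G: "closure G = UNIV"
    "\<And>\<xi>. \<xi> \<in> G \<Longrightarrow> \<forall>\<^sub>F \<zeta> in at 0. z + \<zeta> *s \<xi> \<in> \<phi> ` U \<and> p (inv_into U \<phi> (z + \<zeta> *s \<xi>)) \<notin> S"
    using generic_lines[OF U z] by blast
  have zU: "inv_into U \<phi> z \<in> U" using z by (rule inv_into_into)
  then obtain i where i: "p (inv_into U \<phi> z) \<in> affine_piece i" using piece_exists UX by blast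
  define N where "N = \<phi> ` (U \<inter> p -` affine_piece i)"
  define \<Lambda> where "\<Lambda> = std_lift U \<phi> i"
  have L: "is_lift (p \<circ> inv_into U \<phi>) N \<Lambda>" unfolding N_def \<Lambda>_def by (rule is_lift_std[OF U(1)])
  have zN: "z \<in> N" unfolding N_def using zU i z by (metis IntI f_inv_into_f image_eqI vimageI)
  have "\<exists>r>0. \<exists>H. H holomorphic_on (ball 0 r - {0}) \<and>
      (\<forall>\<zeta>\<in>ball 0 r - {0}. f (inv_into U \<phi> (z + \<zeta> *s \<xi>)) = (cmod (H \<zeta>))\<^sup>2 * Re (det (g (U, \<phi>) (z + \<zeta> *s \<xi>))))"
    if \<xi>: "\<xi> \<in> G" for \<xi>
  proof -
    have "\<forall>\<^sub>F \<zeta> in at 0. z + \<zeta> *s \<xi> \<in> N"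
      by (rule topological_tendstoD[OF tendsto_line]) (use L zN in \<open>auto simp: is_lift_def\<close>)
    with G(2)[OF \<xi>] have "\<forall>\<^sub>F \<zeta> in at 0. z + \<zeta> *s \<xi> \<in> N \<and> p (inv_into U \<phi> (z + \<zeta> *s \<xi>)) \<notin> S"
      by eventually_elim simp
    then obtain r where r: "r > 0" "\<And>\<zeta>. \<zeta> \<noteq> 0 \<Longrightarrow> dist \<zeta> 0 < r \<Longrightarrow> z + \<zeta> *s \<xi> \<in> N \<and> p (inv_into U \<phi> (z + \<zeta> *s \<xi>)) \<notin> S"
      unfolding eventually_at by blast
    have r': "z + \<zeta> *s \<xi> \<in> N" "p (inv_into U \<phi> (z + \<zeta> *s \<xi>)) \<notin> S" if "\<zeta> \<in> ball 0 r - {0}" for \<zeta>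
      using r(2)[of \<zeta>] that by auto
    have hol: "hol_at (lift_ratio a \<Lambda>) (z + \<zeta> *s \<xi>)" if "\<zeta> \<in> ball 0 r - {0}" for \<zeta>
      using r'[OF that] unfolding N_def \<Lambda>_def
      by (intro hol_at_lift_ratio[OF L[unfolded N_def \<Lambda>_def]] lift_det_std[OF U])
    have "(\<lambda>\<zeta>. lift_ratio a \<Lambda> (z + \<zeta> *s \<xi>)) holomorphic_on (ball 0 r - {0})"
      unfolding holomorphic_on_def field_differentiable_def
    proof
      fix \<zeta> :: complex assume "\<zeta> \<in> ball 0 r - {0}"
      from hol_at_line[OF hol[OF this]]
      show "\<exists>D. ((\<lambda>\<zeta>. lift_ratio a \<Lambda> (z + \<zeta> *s \<xi>)) has_field_derivative D) (at \<zeta> within ball 0 r - {0})"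
        by (intro exI) (rule has_field_derivative_at_within)
    qed
    moreover have "f (inv_into U \<phi> (z + \<zeta> *s \<xi>)) = (cmod (lift_ratio a \<Lambda> (z + \<zeta> *s \<xi>)))\<^sup>2 * Re (det (g (U, \<phi>) (z + \<zeta> *s \<xi>)))"
      if \<zeta>: "\<zeta> \<in> ball 0 r - {0}" for \<zeta>
    proof -
      have im: "z + \<zeta> *s \<xi> \<in> \<phi> ` U" using r'(1)[OF \<zeta>] by (auto simp: N_def)
      then have "inv_into U \<phi> (z + \<zeta> *s \<xi>) \<in> points X" using inv_into_into[OF im] UX by blast
      then show ?thesis using f r'(2)[OF \<zeta>] section_norm_chart[OF U L r'(1)[OF \<zeta>] im] by (simp add: density_def)
    qed
    ultimately show ?thesis using r(1) by blast
  qed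
  then show ?thesis using G(1) by blast
qed

lemma no_scalar_flat:
  assumes flat: "scalar_flat X g" and nz: "cubic a w0 \<noteq> 0"
  shows False
proof -
  obtain f where cf: "continuous_map TX euclideanreal f" and f: "\<And>x. x \<in> points X \<Longrightarrow> p x \<notin> S \<Longrightarrow> f x = section_norm x"
    using section_norm_exists by metis
  have w0: "w0 \<noteq> 0"
  proof
    assume "w0 = 0"
    then have "w0 = 0 *s w0" by simp
    then have "cubic a w0 = 0" using cubic_smult[of a 0 w0] by simp
    then show False using nz by simp
  qed
  have off: "vec.span {w} \<notin> S" if "cubic a w \<noteq> 0" for w
    using vanish[of "vec.span {w}" w] that by (auto simp: vec.span_base)
  \<comment> \<open>A point where the cubic is nonzero lies outside \<open>S\<close> and has
    positive norm. This makes the maximum \<open>M\<close> positive, as the maximum principle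
    requires.\<close>
  define x0 where "x0 = p_inverse (vec.span {w0})"
  have x0: "x0 \<in> points X" "p x0 = vec.span {w0}"
    using p_p_inverse[OF span_in_proj_space[OF w0] off[OF nz]] by (auto simp: x0_def)
  have "w0 \<in> p x0" unfolding x0(2) by (simp add: vec.span_base)
  then have fx0: "f x0 > 0" using section_norm_vanishing[of x0 w0] f[OF x0(1)] x0 off[OF nz] nz w0 by simp
  have "compact (f ` points X)"
    using image_compactin[OF compact_X cf] by simp
  then obtain q where q: "q \<in> points X" "\<And>x. x \<in> points X \<Longrightarrow> f x \<le> f q"
    using compact_attains_sup[of "f ` points X"] x0(1) by auto
  define M where "M = f q"
  have M: "M > 0" "\<And>x. x \<in> points X \<Longrightarrow> f x \<le> M" using q(2) fx0 x0(1) by (auto simp: M_def intro: less_le_trans)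
  define Z where "Z = {x \<in> points X. f x = M}"
  have oZ: "openin TX Z"
    unfolding openin_subopen[of TX Z]
  proof
    fix x assume x: "x \<in> Z"
    then obtain U \<phi> where U: "(U, \<phi>) \<in> X" "x \<in> U" by (auto simp: Z_def points_def)
    have inj: "inj_on \<phi> U" and oU: "open (\<phi> ` U)" and UX: "U \<subseteq> points X" using complex_atlasD(1-3)[OF atlas_X U(1)] .
    have cU: "continuous_on (\<phi> ` U) (\<lambda>z. f (inv_into U \<phi> z))"
      using continuous_map_compose[OF continuous_map_inv_chart[OF atlas_X U(1)] cf] by (simp add: o_def)
    have "\<forall>\<^sub>F z in nhds (\<phi> x). f (inv_into U \<phi> z) = M"
    proof (rule scalar_flat_max_principle[OF oU smooth_g[OF U(1)] posdef_g[OF U(1)] _ cU _ M(1)])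
      show "chern_scalar (g (U, \<phi>)) z = 0" if "z \<in> \<phi> ` U" for z
        using flat U(1) that unfolding scalar_flat_def by blast
      show "f (inv_into U \<phi> z) \<le> M" if "z \<in> \<phi> ` U" for z
        using M(2) inv_into_into[OF that] UX by blast
      show "\<phi> x \<in> \<phi> ` U" "f (inv_into U \<phi> (\<phi> x)) = M" using U x inj by (auto simp: Z_def)
    qed (assumption | rule section_norm_lines[OF f U(1)])+
    then obtain B where B: "open B" "\<phi> x \<in> B" "\<And>z. z \<in> B \<Longrightarrow> f (inv_into U \<phi> z) = M"
      unfolding eventually_nhds by blast
    define T where "T = {y \<in> U. \<phi> y \<in> B}"
    have "\<phi> ` T = \<phi> ` U \<inter> B" by (auto simp: T_def)
    then have "openin TX T" using oU B(1) by (subst openin_atlas_chart[OF atlas_X U(1)]) (auto simp: T_def)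
    moreover have "x \<in> T" using U B by (simp add: T_def)
    moreover have "T \<subseteq> Z"
    proof
      fix y assume "y \<in> T"
      then show "y \<in> Z" using B(3)[of "\<phi> y"] inj UX by (auto simp: T_def Z_def)
    qed
    ultimately show "\<exists>T. openin TX T \<and> x \<in> T \<and> T \<subseteq> Z" by blast
  qed
  \<comment> \<open>The maximum point \<open>q\<close> may lie on an exceptional curve. As
    \<open>Z\<close> is open and the complement of these curves is dense, there is another maximum
    point \<open>y\<close> off them, where the norm is given by the cubic.\<close>
  have "q \<in> TX closure_of (points X \<inter> p -` (- S))" using q(1) by (simp add: closure_off_S)
  moreover have "q \<in> Z" using q(1) by (simp add: Z_def M_def)
  ultimately obtain y where y: "y \<in> points X" "p y \<notin> S" "y \<in> Z" using oZ unfolding in_closure_of by blast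
  obtain w where w: "p y = vec.span {w}" "w \<noteq> 0" using p_in[OF y(1)] by (auto simp: proj_space_def)
  have "w \<in> p y" unfolding w(1) by (simp add: vec.span_base)
  then have cw: "cubic a w \<noteq> 0"
    using section_norm_vanishing[OF y(1,2) _ w(2)] f[OF y(1,2)] y(3) M(1) by (auto simp: Z_def)
  obtain k where k: "w $ k \<noteq> 0" using w(2) by (auto simp: vec_eq_iff)
  obtain u where u: "u $ k = 0" "u \<noteq> 0" "\<And>b. vec.span {u + b *s w} \<notin> S"
    using line_avoiding_finite[OF finite_S k] by metis
  obtain t where t: "cubic a (u + t *s w) = 0" using cubic_root_on_line[OF cw] by blast
  \<comment> \<open>A path on the avoiding line from \<open>[w]\<close>, where the maximum is
    attained, to a zero of the cubic. For \<open>s \<noteq> 0\<close> the vector \<open>v s\<close>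
    is a multiple of some \<open>u + b *s w\<close>, and \<open>v 0 = w\<close>, so the path misses
    \<open>S\<close> and lifts to \<open>X\<close>.\<close>
  define v where "v = (\<lambda>s::real. of_real (1 - s) *s w + of_real s *s (u + t *s w))"
  have v: "v s \<noteq> 0 \<and> vec.span {v s} \<notin> S" for s
  proof (cases "s = 0")
    case True
    then show ?thesis using w y(2) by (simp add: v_def)
  next
    case False
    define b where "b = of_real (1 - s) / of_real s + t"
    have vs: "v s = of_real s *s (u + b *s w)"
      using False by (simp add: v_def b_def vec_eq_iff field_simps)
    have "u + b *s w \<noteq> 0"
    proof
      assume e: "u + b *s w = 0"
      then have "(u + b *s w) $ k = 0" by simp
      then have "b = 0" using u(1) k by simp
      then show False using e u(2) by simp
    qed
    then have nz: "v s \<noteq> 0" using False unfolding vs vector_mul_eq_0 by simp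
    moreover have "v s \<in> vec.span {u + b *s w}" unfolding vs by (simp add: span_single)
    ultimately have "vec.span {v s} = vec.span {u + b *s w}" by (intro span_eq_of_mem)
    then show ?thesis using nz u(3) by simp
  qed
  define \<gamma> where "\<gamma> = (\<lambda>s. p_inverse (vec.span {v s}))"
  have \<gamma>: "\<gamma> s \<in> points X" "p (\<gamma> s) = vec.span {v s}" for s
    using p_p_inverse[OF span_in_proj_space, of "v s"] v[of s] by (auto simp: \<gamma>_def)
  have c\<gamma>: "continuous_map (top_of_set {0..1}) TX \<gamma>"
  proof -
    have "continuous_on {0..1} v" unfolding v_def by (intro continuous_intros)
    then have "continuous_map (top_of_set {0..1}) (top_of_set (- {0})) v" using v by (auto simp: continuous_map_in_subtopology)
    from continuous_map_compose[OF this continuous_map_span]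
    have "continuous_map (top_of_set {0..1}) TP (\<lambda>s. vec.span {v s})" by (simp add: o_def)
    then have "continuous_map (top_of_set {0..1}) (subtopology TP (- S)) (\<lambda>s. vec.span {v s})"
      using v by (auto simp: continuous_map_in_subtopology)
    from continuous_map_compose[OF this continuous_map_p_inverse]
    have "continuous_map (top_of_set {0..1}) (subtopology TX (p -` (- S))) \<gamma>" by (simp add: \<gamma>_def o_def)
    then show ?thesis by (simp add: continuous_map_in_subtopology)
  qed
  have connected: "connected {0..1::real}" by simp
  define I where "I = {s \<in> {0..1::real}. \<gamma> s \<in> Z}"
  have "openin (top_of_set {0..1}) I"
    using openin_continuous_map_preimage[OF c\<gamma> oZ] by (simp add: I_def)
  moreover have "closedin (top_of_set {0..1}) I"
  proof -
    have "closedin TX {x \<in> topspace TX. f x \<in> {M}}" by (rule closedin_continuous_map_preimage[OF cf]) simp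
    then have "closedin TX Z" by (simp add: Z_def topspace_X)
    from closedin_continuous_map_preimage[OF c\<gamma> this] show ?thesis by (simp add: I_def)
  qed
  ultimately have "I = {} \<or> I = {0..1}"
    using connected[unfolded connected_clopen] by simp
  moreover have "0 \<in> I"
  proof -
    have "\<gamma> 0 = y" using p_inverse_p[OF y(1,2)] by (simp add: \<gamma>_def v_def w(1))
    then show ?thesis using y by (simp add: I_def)
  qed
  ultimately have "I = {0..1}" by (metis empty_iff)
  then have "1 \<in> I" by simp
  then have "\<gamma> 1 \<in> Z" by (simp only: I_def mem_Collect_eq)
  moreover have "f (\<gamma> 1) = 0"
  proof -
    have v1: "v 1 = u + t *s w" by (simp add: v_def)
    have "v 1 \<in> p (\<gamma> 1)" unfolding \<gamma>(2) by (simp add: vec.span_base)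
    then have "section_norm (\<gamma> 1) = 0" using section_norm_vanishing(2)[OF \<gamma>(1), of 1 "v 1"] v[of 1] \<gamma>(2)[of 1] t v1 by simp
    then show ?thesis using f[OF \<gamma>(1)] v[of 1] \<gamma>(2)[of 1] by simp
  qed
  ultimately show False using M(1) by (simp add: Z_def)
qed

end

theorem corollary1p4:
  fixes S :: "(complex^3) set set" and X :: "('a, 2) atlas"
    and p :: "'a \<Rightarrow> (complex^3) set" and m :: nat
  assumes "is_blowup projective_plane S X p"
    and "card S = m"
    and "\<exists>g. hermitian_metric X g \<and> scalar_flat X g"
  shows "m \<ge> 10"
proof (rule ccontr)
  assume "\<not> m \<ge> 10"
  interpret blown_up_plane S X p by unfold_locales (rule assms(1))
  obtain g where g: "hermitian_metric X g" "scalar_flat X g" using assms(3) by blast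
  have "\<forall>l\<in>S. \<exists>w. w \<noteq> 0 \<and> l = vec.span {w}" using S_points by (auto simp: proj_space_def)
  then obtain r where r: "\<And>l. l \<in> S \<Longrightarrow> l = vec.span {r l}" by metis
  have "card S < card cubic_exps" using \<open>\<not> m \<ge> 10\<close> assms(2) by (simp add: card_cubic_exps)
  \<comment> \<open>One linear condition per centre, tested at the representative
    \<open>r l\<close>; homogeneity extends the vanishing to the whole line
    \<open>l\<close>.\<close>
  from homogeneous_system_nontrivial[OF finite_S finite_cubic_exps this,
      of "\<lambda>l (i, j). r l $ 1 ^ i * r l $ 2 ^ j * r l $ 3 ^ (3 - i - j)"]
  obtain a where a: "\<exists>e\<in>cubic_exps. a e \<noteq> 0" "\<And>l. l \<in> S \<Longrightarrow> cubic a (r l) = 0"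
    by (auto simp: cubic_def case_prod_beta)
  interpret anticanonical_section S X p g a
  proof unfold_locales
    fix l w assume l: "l \<in> S" and "w \<in> l"
    then obtain c where "w = c *s r l" using r[OF l] by (metis rangeE span_single)
    then show "cubic a w = 0" using a(2)[OF l] by (simp add: cubic_smult)
  qed (rule g(1))
  obtain w0 where "cubic a w0 \<noteq> 0" using a(1) cubic_nonzero by blast
  then show False by (rule no_scalar_flat[OF g(2)])
qed

end
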